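(* Let $m\ge 1$ be an integer and let $\omega$ be a modulus of continuity. Let $K\subset\mathbb{R}$ be a compact set and let $F=(F^{k})_{k=0}^{m}$, $G=(G^{k})_{k=0}^{m}$, $H=(H^{k})_{k=0}^{m}$ be collections of continuous, real-valued functions on $K$. Then there is a horizontal curve $\Gamma\in C^{m,\omega}(\mathbb{R},\mathbb{R}^3)$ such that $D^k\Gamma|_K=(F^k,G^k,H^k)$ for $0\le k\le m$ if and only if the following three conditions hold: (1) $F$, $G$, and $H$ are Whitney fields of class $C^{m,\omega}$ on $K$; (2) for every $1\le k\le m$ the following holds on $K$: \[ H^k = 2\sum_{i=0}^{k-1}\binom{k-1}{i}\left(F^{k-i}G^i-G^{k-i}F^i\right); \] (3) there is a constant $C\ge 1$ such that \[ \left|\frac{A(a,b)}{V_\omega(a,b)}\right|\le C\qquad\text{for all } a,b\in K \text{ with } a<b. \]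
   Context: A modulus of continuity is a function $\omega\colon[0,\infty]\to[0,\infty]$ which is continuous, increasing, and concave with $\omega(0)=0$ and which is not identically $0$. Given an interval $I\subset\mathbb{R}$, a map $\varphi\colon I\to\mathbb{R}$ is of class $C^{m,\omega}$ if $\varphi$ is $C^m$ and $\sup_{a,b\in I,\,a\ne b}\frac{|D^m\varphi(b)-D^m\varphi(a)|}{\omega(|b-a|)}<\infty$. A map into $\mathbb{R}^3$ is of class $C^{m,\omega}$ if each component is. The first Heisenberg group $\mathbb{H}^1$ is identified with $\mathbb{R}^3$ with coordinates $(x,y,t)$, with vector fields $X=\partial_x+2y\,\partial_t$ and $Y=\partial_y-2x\,\partial_t$. An absolutely continuous curve $\gamma$ in $\mathbb{R}^3$ is horizontal if, at almost every parameter $s$, $\gamma'(s)$ is a linear combination of $X(\gamma(s))$ and $Y(\gamma(s))$. For a collection $F=(F^k)_{k=0}^m$ of continuous real-valued functions on $K$ write $F(x)=F^0(x)$, and for $a\in K$ let $T_a^mF(x)=\sum_{k=0}^m\frac{F^k(a)}{k!}(x-a)^k$, $x\in\mathbb{R}$; similarly $T_a^{m-k}F^k(x)=\sum_{\ell=0}^{m-k}\frac{F^{k+\ell}(a)}{\ell!}(x-a)^\ell$. $F$ is a Whitney field of class $C^{m,\omega}$ on the compact set $K$ if there is a constant $C>0$ with $|F^k(b)-T_a^{m-k}F^k(b)|\le C\,\omega(|b-a|)\,|b-a|^{m-k}$ for every $0\le k\le m$ and $a,b\in K$. For $a,b\in K$ with $a<b$, the area discrepancy is \[A(a,b)=H(b)-H(a)-2\int_a^b\big((T_a^mF)'(T_a^mG)-(T_a^mG)'(T_a^mF)\big)+2F(a)\big(G(b)-T_a^mG(b)\big)-2G(a)\big(F(b)-T_a^mF(b)\big),\]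 and the velocity is \[V_\omega(a,b)=(\omega(b-a))^2(b-a)^{2m}+\omega(b-a)(b-a)^m\int_a^b\big(|(T_a^mF)'|+|(T_a^mG)'|\big).\] *)

theory Defs
  imports "HOL-Analysis.Analysis"
begin

(* Concavity is spelled out because the library's concave_on needs a real vector space;
   in ennreal, 0 * top = 0. "Increasing" is non-strict, so that bounded moduli such as
   min t 1 are included. *)
definition modulus_of_continuity :: "(ennreal \<Rightarrow> ennreal) \<Rightarrow> bool" where
  "modulus_of_continuity \<omega> \<longleftrightarrow>
     continuous_on UNIV \<omega> \<and> mono \<omega> \<and>
     (\<forall>x y u v. u + v = 1 \<longrightarrow> u * \<omega> x + v * \<omega> y \<le> \<omega> (u * x + v * y)) \<and>
     \<omega> 0 = 0 \<and> (\<exists>x. \<omega> x \<noteq> 0)"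

(* Only meant for t \<ge> 0. For a modulus of continuity, concavity and continuity at 0 force
   \<omega> to be finite at finite arguments, so that enn2real loses nothing there. *)
definition modulus_real :: "(ennreal \<Rightarrow> ennreal) \<Rightarrow> real \<Rightarrow> real" where
  "modulus_real \<omega> t = enn2real (\<omega> (ennreal t))"

definition iter_deriv :: "nat \<Rightarrow> (real \<Rightarrow> 'a::real_normed_vector) \<Rightarrow> real \<Rightarrow> 'a" where
  "iter_deriv k f = ((\<lambda>g x. vector_derivative g (at x)) ^^ k) f"

definition C_m :: "nat \<Rightarrow> (real \<Rightarrow> real) \<Rightarrow> bool" where
  "C_m m \<phi> \<longleftrightarrow>
     (\<forall>k<m. \<forall>x. iter_deriv k \<phi> differentiable (at x)) \<and> continuous_on UNIV (iter_deriv m \<phi>)"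

definition C_m_omega :: "nat \<Rightarrow> (ennreal \<Rightarrow> ennreal) \<Rightarrow> (real \<Rightarrow> real) \<Rightarrow> bool" where
  "C_m_omega m \<omega> \<phi> \<longleftrightarrow> C_m m \<phi> \<and>
     bdd_above {\<bar>iter_deriv m \<phi> b - iter_deriv m \<phi> a\<bar> / modulus_real \<omega> \<bar>b - a\<bar> | a b. a \<noteq> b}"

definition curve_C_m_omega :: "nat \<Rightarrow> (ennreal \<Rightarrow> ennreal) \<Rightarrow> (real \<Rightarrow> real ^ 3) \<Rightarrow> bool" where
  "curve_C_m_omega m \<omega> \<Gamma> \<longleftrightarrow> (\<forall>i. C_m_omega m \<omega> (\<lambda>s. \<Gamma> s $ i))"

definition abs_continuous_on :: "real set \<Rightarrow> (real \<Rightarrow> 'a::metric_space) \<Rightarrow> bool" where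
  "abs_continuous_on S f \<longleftrightarrow>
     (\<forall>\<epsilon>>0. \<exists>\<delta>>0. \<forall>n (u :: nat \<Rightarrow> real) v.
        (\<forall>i<n. u i \<le> v i \<and> {u i..v i} \<subseteq> S) \<and>
        disjoint_family_on (\<lambda>i. {u i<..<v i}) {..<n} \<and>
        (\<Sum>i<n. v i - u i) < \<delta> \<longrightarrow>
        (\<Sum>i<n. dist (f (u i)) (f (v i))) < \<epsilon>)"

(* The coordinates (x, y, t) of a point p are p $ 1, p $ 2, p $ 3. *)
definition heis_X :: "real ^ 3 \<Rightarrow> real ^ 3" where
  "heis_X p = vector [1, 0, 2 * p $ 2]"

definition heis_Y :: "real ^ 3 \<Rightarrow> real ^ 3" where
  "heis_Y p = vector [0, 1, - 2 * p $ 1]"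

(* On the unbounded parameter domain, absolute continuity means absolute continuity on every
   compact interval. *)
definition horizontal :: "(real \<Rightarrow> real ^ 3) \<Rightarrow> bool" where
  "horizontal \<gamma> \<longleftrightarrow>
     (\<forall>a b. abs_continuous_on {a..b} \<gamma>) \<and>
     (AE s in lborel. \<exists>w. (\<gamma> has_vector_derivative w) (at s) \<and>
                          w \<in> span {heis_X (\<gamma> s), heis_Y (\<gamma> s)})"

(* A collection (F^0, ..., F^m) on K is a function F :: nat \<Rightarrow> real \<Rightarrow> real of which only the
   values F k x with k \<le> m and x \<in> K are used. *)
definition taylor :: "nat \<Rightarrow> (nat \<Rightarrow> real \<Rightarrow> real) \<Rightarrow> real \<Rightarrow> real \<Rightarrow> real" where
  "taylor m F a x = (\<Sum>k\<le>m. F k a / fact k * (x - a) ^ k)"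

definition whitney_field ::
  "nat \<Rightarrow> (ennreal \<Rightarrow> ennreal) \<Rightarrow> real set \<Rightarrow> (nat \<Rightarrow> real \<Rightarrow> real) \<Rightarrow> bool" where
  "whitney_field m \<omega> K F \<longleftrightarrow>
     (\<exists>C>0. \<forall>k\<le>m. \<forall>a\<in>K. \<forall>b\<in>K.
        \<bar>F k b - taylor (m - k) (\<lambda>l. F (k + l)) a b\<bar>
          \<le> C * modulus_real \<omega> \<bar>b - a\<bar> * \<bar>b - a\<bar> ^ (m - k))"

definition area_discrepancy ::
  "nat \<Rightarrow> (nat \<Rightarrow> real \<Rightarrow> real) \<Rightarrow> (nat \<Rightarrow> real \<Rightarrow> real) \<Rightarrow> (nat \<Rightarrow> real \<Rightarrow> real)
     \<Rightarrow> real \<Rightarrow> real \<Rightarrow> real" where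
  "area_discrepancy m F G H a b =
     H 0 b - H 0 a
     - 2 * integral {a..b} (\<lambda>s. deriv (taylor m F a) s * taylor m G a s
                                - deriv (taylor m G a) s * taylor m F a s)
     + 2 * F 0 a * (G 0 b - taylor m G a b)
     - 2 * G 0 a * (F 0 b - taylor m F a b)"

definition velocity ::
  "nat \<Rightarrow> (ennreal \<Rightarrow> ennreal) \<Rightarrow> (nat \<Rightarrow> real \<Rightarrow> real) \<Rightarrow> (nat \<Rightarrow> real \<Rightarrow> real)
     \<Rightarrow> real \<Rightarrow> real \<Rightarrow> real" where
  "velocity m \<omega> F G a b =
     (modulus_real \<omega> (b - a))\<^sup>2 * (b - a) ^ (2 * m)
     + modulus_real \<omega> (b - a) * (b - a) ^ m
       * integral {a..b} (\<lambda>s. \<bar>deriv (taylor m F a) s\<bar> + \<bar>deriv (taylor m G a) s\<bar>)"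

end

theory Submission
  imports Defs
begin

text \<open>A horizontal curve is determined by its projection \<open>(f, g)\<close> to the plane and one value of the
vertical coordinate \<open>h\<close>, because horizontality is the equation \<open>h' = 2 (f' g - g' f)\<close>
(\<open>horizontal_contact\<close>, \<open>horizontal_lift\<close>). So, up to a constant
factor, the increment of \<open>h\<close> over \<open>[a, b]\<close> is the signed area swept by \<open>(f, g)\<close> about the origin, and the problem is to extend the two planar jets \<open>F\<close> and \<open>G\<close> in such
a way that over each complementary interval of \<open>K\<close> the swept area is the prescribed one.

Necessity. Taylor's theorem gives the Whitney estimates, and differentiating the contact equation with
the Leibniz rule gives the formula for \<open>H\<^sup>k\<close>. For the area condition write \<open>f = S + e\<close> and \<open>g = T + d\<close> with
\<open>S\<close>, \<open>T\<close> the Taylor polynomials at \<open>a\<close>. Expanding the area and integrating by parts turns the area discrepancy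
into terms that are linear in \<open>(e, d)\<close> with coefficients \<open>S'\<close>, \<open>T'\<close>, and a term quadratic in \<open>(e, d)\<close>
(\<open>area_estimate\<close>). Since \<open>e\<close> and \<open>d\<close> are of size \<open>\<omega>(b - a) (b - a)\<^sup>m\<close>, these are the two summands of the
velocity.

Sufficiency. Rescale a gap to \<open>[0, 1]\<close> and divide all values by \<open>\<omega>(b - a) (b - a)\<^sup>m\<close>. Hermite interpolation
matches the jets at both ends, and by the same \<open>area_estimate\<close> the area then misses the prescribed one
by at most a multiple of \<open>1 + \<parallel>p\<parallel> + \<parallel>q\<parallel>\<close>, where \<open>p\<close>, \<open>q\<close> are the derivatives of the two interpolants. The
area is corrected by adding polynomials that vanish to order \<open>m\<close> at both ends (\<open>area_solvable\<close>). If
\<open>p\<close> and \<open>q\<close> are small, a fixed pair of bumps sweeps a definite area of its own. If \<open>p\<close> is large, changing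
the second component by a multiple of \<open>p\<close> times a weight changes the area at a rate given by the square of
a weighted \<open>L\<^sup>2\<close> norm of \<open>p\<close>, which controls \<open>\<parallel>p\<parallel>\<^sup>2\<close> because polynomials of bounded degree form a finite-dimensional
space (\<open>weighted_L2_coercive\<close>). The interpolation and correction terms have bounded degree and
coefficients, and the Taylor polynomials have degree at most \<open>m\<close>, so that
after scaling back the derivative of order \<open>m + 1\<close> is at most a multiple of \<open>\<omega>(b - a) / (b - a)\<close>; by concavity
this is what a \<open>C\<^sup>m\<^sup>,\<^sup>\<omega>\<close> bound on the gap requires (\<open>mean_value_modulus\<close>).

The pieces are glued along \<open>K\<close> (locale \<open>whitney_gluing\<close>): the Whitney estimates pass from an endpoint of a gap
to all points of \<open>K\<close>, and they give differentiability at the points of \<open>K\<close>. Beforehand \<open>K\<close> is enlarged by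
one point on each side carrying zero jets, so that the extension has compact support. Finally the vertical
coordinate of the lift agrees with \<open>H\<close> on \<open>K\<close>: their difference does not change across gaps and is \<open>o(|b - a|)\<close>
along \<open>K\<close>, hence it is constant (\<open>constant_on_compact\<close>).\<close>

section \<open>Derivative chains and Taylor polynomials\<close>

text \<open>A function together with its derivatives up to order \<open>m\<close>. All jets,
Taylor polynomials and extensions are handled in this form, which avoids iterating a derivative
operator.\<close>

definition deriv_chain :: "nat \<Rightarrow> (nat \<Rightarrow> real \<Rightarrow> real) \<Rightarrow> bool" where
  "deriv_chain m D \<longleftrightarrow> (\<forall>k<m. \<forall>x. (D k has_real_derivative D (Suc k) x) (at x))"

lemma deriv_chainD:
  "deriv_chain m D \<Longrightarrow> k < m \<Longrightarrow> (D k has_real_derivative D (Suc k) x) (at x)"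
  by (simp add: deriv_chain_def)

lemma deriv_chain_continuous:
  assumes "deriv_chain m D" "k < m"
  shows "continuous_on S (D k)"
  using assms by (meson DERIV_isCont continuous_at_imp_continuous_on deriv_chainD)

lemma taylor_at_centre [simp]: "taylor n F a a = F 0 a"
proof -
  have "taylor n F a a = (\<Sum>k\<le>n. if k = 0 then F 0 a else 0)"
    unfolding taylor_def by (rule sum.cong) auto
  then show ?thesis by simp
qed

lemma taylor_0 [simp]: "taylor 0 F a x = F 0 a"
  by (simp add: taylor_def)

lemma taylor_has_derivative:
  "((\<lambda>x. taylor (Suc n) F a x) has_real_derivative taylor n (\<lambda>j. F (Suc j)) a x) (at x)"
proof -
  have *: "taylor (Suc n) F a = (\<lambda>x. F 0 a + (\<Sum>k\<le>n. F (Suc k) a / fact (Suc k) * (x - a) ^ Suc k))"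
    unfolding taylor_def by (subst sum.atMost_Suc_shift) simp
  have d: "((\<lambda>x. c / fact (Suc k) * (x - a) ^ Suc k) has_real_derivative c / fact k * (x - a) ^ k) (at x)"
    for c :: real and k
    by (rule derivative_eq_intros refl)+ (simp add: fact_Suc del: of_nat_Suc)
  show ?thesis
    unfolding * taylor_def
    by (rule derivative_eq_intros d refl)+ simp
qed

text \<open>The Taylor polynomials of the shifted jets are the successive derivatives of the
Taylor polynomial, so \<open>taylor_remainder\<close> and \<open>chain_unique\<close> apply to
Taylor polynomials themselves.\<close>

lemma taylor_chain: "deriv_chain n (\<lambda>l x. taylor (n - l) (\<lambda>j. F (l + j)) a x)"
  unfolding deriv_chain_def
proof (intro allI impI)
  fix k x assume "k < n"
  then have "n - k = Suc (n - Suc k)" by simp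
  then show "((\<lambda>x. taylor (n - k) (\<lambda>j. F (k + j)) a x) has_real_derivative
      taylor (n - Suc k) (\<lambda>j. F (Suc k + j)) a x) (at x)"
    using taylor_has_derivative[of "n - Suc k" "\<lambda>j. F (k + j)" a x] by simp
qed

lemma deriv_taylor:
  assumes "1 \<le> m"
  shows "deriv (taylor m F a) = taylor (m - 1) (\<lambda>j. F (Suc j)) a"
    and "(taylor m F a has_real_derivative taylor (m - 1) (\<lambda>j. F (Suc j)) a x) (at x)"
proof -
  show *: "(taylor m F a has_real_derivative taylor (m - 1) (\<lambda>j. F (Suc j)) a x) (at x)" for x
    using taylor_has_derivative[of "m - 1" F a x] assms by simp
  show "deriv (taylor m F a) = taylor (m - 1) (\<lambda>j. F (Suc j)) a"
    using * by (auto intro!: DERIV_imp_deriv)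
qed

lemma continuous_on_taylor: "continuous_on S (taylor m F a)"
  unfolding taylor_def by (intro continuous_intros)

text \<open>The Lagrange form of the remainder replaces the top coefficient \<open>D m a\<close>
by \<open>D m \<xi>\<close>, so the error is governed by the oscillation of the top derivative
alone.\<close>

lemma taylor_remainder:
  assumes D: "deriv_chain m D" and E: "\<And>\<xi>. \<xi> \<in> closed_segment a b \<Longrightarrow> \<bar>D m \<xi> - D m a\<bar> \<le> E"
    and "k \<le> m"
  shows "\<bar>D k b - taylor (m - k) (\<lambda>l. D (k + l)) a b\<bar> \<le> E * \<bar>b - a\<bar> ^ (m - k)"
proof -
  define n where "n = m - k"
  have E0: "0 \<le> E" using E[of a] by simp
  consider "n = 0" | "a = b" | "0 < n" "a \<noteq> b" by blast
  then show ?thesis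
  proof cases
    case 1 then show ?thesis using E[of b] \<open>k \<le> m\<close> by (simp add: n_def)
  next
    case 2 then show ?thesis using E0 by simp
  next
    case 3
    have "\<exists>t. (if b < a then b < t \<and> t < a else a < t \<and> t < b) \<and>
      D k b = (\<Sum>j<n. (D (k + j) a / fact j) * (b - a) ^ j) + (D (k + n) t / fact n) * (b - a) ^ n"
      by (rule Taylor[where a = "min a b" and b = "max a b"])
        (use 3 D n_def in \<open>auto intro: deriv_chainD\<close>)
    then obtain t where t: "if b < a then b < t \<and> t < a else a < t \<and> t < b"
      and eq: "D k b = (\<Sum>j<n. (D (k + j) a / fact j) * (b - a) ^ j) + (D (k + n) t / fact n) * (b - a) ^ n"
      by blast
    have kn: "k + n = m" using \<open>k \<le> m\<close> by (simp add: n_def)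
    have tm: "t \<in> closed_segment a b" using t by (auto simp: closed_segment_eq_real_ivl split: if_splits)
    have "taylor n (\<lambda>l. D (k + l)) a b = (\<Sum>j<n. (D (k + j) a / fact j) * (b - a) ^ j) + (D m a / fact n) * (b - a) ^ n"
      unfolding taylor_def by (simp add: kn lessThan_Suc_atMost[symmetric])
    then have "D k b - taylor n (\<lambda>l. D (k + l)) a b = (D m t - D m a) * (b - a) ^ n / fact n"
      by (simp add: eq kn diff_divide_distrib left_diff_distrib)
    then have "\<bar>D k b - taylor n (\<lambda>l. D (k + l)) a b\<bar> = \<bar>D m t - D m a\<bar> * \<bar>b - a\<bar> ^ n / fact n"
      by (simp add: abs_mult power_abs)
    also have "\<dots> \<le> \<bar>D m t - D m a\<bar> * \<bar>b - a\<bar> ^ n / 1"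
      by (intro divide_left_mono) (auto simp: fact_ge_1)
    also have "\<dots> \<le> E * \<bar>b - a\<bar> ^ n"
      using E[OF tm] by (simp add: mult_right_mono)
    finally show ?thesis by (simp add: n_def)
  qed
qed

text \<open>A Taylor polynomial has constant top derivative, so re-expanding it at another centre
leaves no remainder.\<close>

lemma taylor_recentre:
  "taylor n F a x = taylor n (\<lambda>l c. taylor (n - l) (\<lambda>j. F (l + j)) a c) c x"
  using taylor_remainder[OF taylor_chain[of n F a], of c x 0 0] by simp

lemma taylor_diff: "taylor n F c x - taylor n G c x = taylor n (\<lambda>l y. F l y - G l y) c x"
  by (simp add: taylor_def sum_subtractf left_diff_distrib diff_divide_distrib)

text \<open>The \<open>k\<close>-th entry is the \<open>k\<close>-th derivative of \<open>p 0 * q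
0\<close>; the induction step is Pascal's rule.\<close>

lemma leibniz_chain:
  assumes p: "deriv_chain n p" and q: "deriv_chain n q"
  shows "deriv_chain n (\<lambda>k x. \<Sum>i\<le>k. real (k choose i) * (p (k - i) x * q i x))"
  unfolding deriv_chain_def
proof (intro allI impI)
  fix k x assume k: "k < n"
  let ?t = "\<lambda>k i. real (k choose i) * (p (k - i) x * q i x)"
  have "((\<lambda>x. \<Sum>i\<le>k. real (k choose i) * (p (k - i) x * q i x)) has_real_derivative
     (\<Sum>i\<le>k. real (k choose i) * (p (Suc (k - i)) x * q i x + p (k - i) x * q (Suc i) x))) (at x)"
  proof (rule DERIV_sum)
    fix i assume "i \<in> {..k}"
    then have "k - i < n" "i < n" using k by auto
    note d = deriv_chainD[OF p this(1), of x] deriv_chainD[OF q this(2), of x]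
    show "((\<lambda>x. real (k choose i) * (p (k - i) x * q i x)) has_real_derivative
      real (k choose i) * (p (Suc (k - i)) x * q i x + p (k - i) x * q (Suc i) x)) (at x)"
      by (rule derivative_eq_intros d refl)+ (simp add: algebra_simps)
  qed
  moreover have "(\<Sum>i\<le>k. real (k choose i) * (p (Suc (k - i)) x * q i x + p (k - i) x * q (Suc i) x))
     = (\<Sum>i\<le>Suc k. ?t (Suc k) i)"
  proof -
    have "(\<Sum>i\<le>Suc k. ?t (Suc k) i) = ?t (Suc k) 0 + (\<Sum>i\<le>k. ?t (Suc k) (Suc i))"
      by (rule sum.atMost_Suc_shift)
    also have "(\<Sum>i\<le>k. ?t (Suc k) (Suc i)) = (\<Sum>i\<le>k. real (k choose i) * (p (k - i) x * q (Suc i) x))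
        + (\<Sum>i\<le>k. real (k choose Suc i) * (p (k - i) x * q (Suc i) x))"
      by (simp add: sum.distrib[symmetric] algebra_simps)
    also have "?t (Suc k) 0 + \<dots> = (\<Sum>i\<le>k. real (k choose i) * (p (k - i) x * q (Suc i) x))
       + (\<Sum>i\<le>Suc k. real (k choose i) * (p (Suc k - i) x * q i x))"
      by (subst sum.atMost_Suc_shift) simp
    also have "(\<Sum>i\<le>Suc k. real (k choose i) * (p (Suc k - i) x * q i x))
       = (\<Sum>i\<le>k. real (k choose i) * (p (Suc (k - i)) x * q i x))"
      by (simp add: Suc_diff_le)
    finally show ?thesis by (simp add: sum.distrib[symmetric] algebra_simps)
  qed
  ultimately show "((\<lambda>x. \<Sum>i\<le>k. real (k choose i) * (p (k - i) x * q i x)) has_real_derivative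
     (\<Sum>i\<le>Suc k. ?t (Suc k) i)) (at x)" by simp
qed

section \<open>Iterated derivatives\<close>

lemma iter_deriv_0 [simp]: "iter_deriv 0 f = f"
  by (simp add: iter_deriv_def)

lemma iter_deriv_Suc: "iter_deriv (Suc k) f x = vector_derivative (iter_deriv k f) (at x)"
  by (simp add: iter_deriv_def)

lemma iter_deriv_chain:
  assumes "deriv_chain m D" "k \<le> m"
  shows "iter_deriv k (D 0) = D k"
  using \<open>k \<le> m\<close>
proof (induction k)
  case (Suc k)
  then have "iter_deriv k (D 0) = D k" "k < m" by auto
  then show ?case
    using deriv_chainD[OF assms(1) \<open>k < m\<close>]
    by (intro ext)
      (simp add: iter_deriv_Suc has_real_derivative_iff_has_vector_derivative vector_derivative_at)
qed simp

lemma C_m_chain: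
  assumes "C_m m \<phi>"
  shows "deriv_chain m (\<lambda>k. iter_deriv k \<phi>)"
  using assms
  by (auto simp: C_m_def deriv_chain_def iter_deriv_Suc has_real_derivative_iff_has_vector_derivative
      vector_derivative_works)

lemma has_vector_derivative_vec_lambda:
  assumes "\<And>i. (D i has_real_derivative E i) (at x)"
  shows "((\<lambda>x. \<chi> i. D i x) has_vector_derivative (\<chi> i. E i)) (at x)"
proof -
  have "((\<lambda>x. D i x) has_derivative (\<lambda>h. h *\<^sub>R E i)) (at x)" for i
    using assms[of i] by (simp add: has_field_derivative_def mult.commute[of _ "E i"])
  then have "((\<lambda>x. \<chi> i. D i x) has_derivative (\<lambda>h. \<chi> i. h *\<^sub>R E i)) (at x)"
    unfolding has_derivative_componentwise_within[of "\<lambda>x. \<chi> i. D i x"]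
    by (auto simp: Basis_vec_def inner_axis)
  moreover have "(\<lambda>h. \<chi> i. h *\<^sub>R E i) = (\<lambda>h. h *\<^sub>R (\<chi> i. E i))"
    by (auto simp: vec_eq_iff)
  ultimately show ?thesis by (simp add: has_vector_derivative_def)
qed

lemma iter_deriv_vec_lambda:
  fixes D :: "'n::finite \<Rightarrow> nat \<Rightarrow> real \<Rightarrow> real"
  assumes "\<And>i. deriv_chain m (D i)" "k \<le> m"
  shows "iter_deriv k (\<lambda>x. \<chi> i. D i 0 x) = (\<lambda>x. \<chi> i. D i k x)"
  using \<open>k \<le> m\<close>
proof (induction k)
  case (Suc k)
  then have "k < m" and IH: "iter_deriv k (\<lambda>x. \<chi> i. D i 0 x) = (\<lambda>x. \<chi> i. D i k x)" by auto
  show ?case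
    by (auto simp: iter_deriv_Suc fun_eq_iff IH
        intro!: vector_derivative_at has_vector_derivative_vec_lambda deriv_chainD assms(1) \<open>k < m\<close>)
qed simp

section \<open>Moduli of continuity\<close>

text \<open>The properties of \<open>t \<mapsto> \<omega> t\<close> at finite arguments that the
proof uses. Concavity appears as \<open>star\<close>: the quotient \<open>w t / t\<close> is
non-increasing.\<close>

locale modulus =
  fixes w :: "real \<Rightarrow> real"
  assumes zero [simp]: "w 0 = 0"
    and mono: "0 \<le> s \<Longrightarrow> s \<le> t \<Longrightarrow> w s \<le> w t"
    and pos: "0 < t \<Longrightarrow> 0 < w t"
    and star: "0 \<le> s \<Longrightarrow> s \<le> t \<Longrightarrow> s * w t \<le> t * w s"
    and lim: "(w \<longlongrightarrow> 0) (at_right 0)"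
begin

lemma nonneg: "0 \<le> t \<Longrightarrow> 0 \<le> w t"
  using mono[of 0 t] by simp

lemma abs_nonneg [simp]: "0 \<le> w \<bar>t\<bar>"
  by (simp add: nonneg)

end

text \<open>Concavity between \<open>0\<close> and a point of infinite value would make all
smaller positive arguments infinite too, against continuity at \<open>0\<close>.\<close>

lemma ennreal_modulus_finite:
  assumes "modulus_of_continuity \<omega>"
  shows "\<omega> (ennreal t) < top"
proof (rule ccontr)
  assume "\<not> \<omega> (ennreal t) < top"
  then have T: "\<omega> (ennreal t) = top" by (simp add: not_less top_unique)
  have conc: "\<And>u v x y. u + v = 1 \<Longrightarrow> u * \<omega> x + v * \<omega> y \<le> \<omega> (u * x + v * y)"
    and z: "\<omega> 0 = 0" and cont: "continuous_on UNIV \<omega>"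
    using assms by (auto simp: modulus_of_continuity_def)
  have "\<omega> (ennreal (1 / real (Suc n)) * ennreal t) = top" for n
  proof -
    have "ennreal (1 / real (Suc n)) + ennreal (1 - 1 / real (Suc n)) = 1"
      by (subst ennreal_plus[symmetric]) auto
    from conc[OF this, of "ennreal t" 0] T z show ?thesis
      by (simp add: ennreal_mult_top top_unique)
  qed
  moreover have "(\<lambda>n. \<omega> (ennreal (1 / real (Suc n)) * ennreal t)) \<longlonglongrightarrow> \<omega> (ennreal 0)"
  proof (rule continuous_on_tendsto_compose[OF cont])
    have "(\<lambda>n. ennreal (1 / real (Suc n) * max 0 t)) \<longlonglongrightarrow> ennreal 0"
      by (intro tendsto_ennrealI tendsto_mult_left_zero) (rule lim_1_over_n[THEN LIMSEQ_Suc])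
    moreover have "ennreal (1 / real (Suc n) * max 0 t) = ennreal (1 / real (Suc n)) * ennreal t" for n
      by (cases "0 \<le> t") (simp_all add: ennreal_mult[symmetric] ennreal_neg)
    ultimately show "(\<lambda>n. ennreal (1 / real (Suc n)) * ennreal t) \<longlonglongrightarrow> ennreal 0" by simp
  qed auto
  ultimately have "(\<lambda>n. top) \<longlonglongrightarrow> \<omega> 0" by simp
  then have "\<omega> 0 = top" using LIMSEQ_unique tendsto_const by blast
  with z show False by simp
qed

text \<open>Positivity: a zero at some \<open>t > 0\<close> spreads to the left by monotonicity
and to the right by concavity, and then to \<open>\<infinity>\<close> by continuity, contradicting
that \<open>\<omega>\<close> does not vanish identically.\<close>

lemma modulus_modulus_real:
  assumes \<omega>: "modulus_of_continuity \<omega>"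
  shows "modulus (modulus_real \<omega>)"
proof
  let ?w = "modulus_real \<omega>"
  have conc: "\<And>u v x y. u + v = 1 \<Longrightarrow> u * \<omega> x + v * \<omega> y \<le> \<omega> (u * x + v * y)"
    and z: "\<omega> 0 = 0" and cont: "continuous_on UNIV \<omega>" and mon: "mono \<omega>"
    and nz: "\<exists>x. \<omega> x \<noteq> 0"
    using assms by (auto simp: modulus_of_continuity_def)
  have w: "ennreal (?w t) = \<omega> (ennreal t)" for t
    unfolding modulus_real_def using ennreal_modulus_finite[OF \<omega>, of t] by simp
  have w0: "0 \<le> ?w t" for t by (simp add: modulus_real_def)
  show "?w 0 = 0" by (simp add: modulus_real_def z)
  show mo: "?w s \<le> ?w t" if "0 \<le> s" "s \<le> t" for s t
    using that monoD[OF mon, of "ennreal s" "ennreal t"] w w0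
    by (metis ennreal_le_iff ennreal_leI)
  show st: "s * ?w t \<le> t * ?w s" if "0 \<le> s" "s \<le> t" for s t
  proof (cases "t = 0")
    case False
    then have t: "0 < t" using that by simp
    have "ennreal (s/t) + ennreal (1 - s/t) = 1"
      using that t by (subst ennreal_plus[symmetric]) auto
    from conc[OF this, of "ennreal t" 0]
    have "ennreal (s/t) * ennreal (?w t) \<le> \<omega> (ennreal (s/t) * ennreal t)" by (simp add: z w)
    also have "ennreal (s/t) * ennreal t = ennreal s"
      using t that by (subst ennreal_mult[symmetric]) auto
    finally have "ennreal (s/t * ?w t) \<le> ennreal (?w s)"
      using that t w0 by (subst ennreal_mult) (auto simp: w)
    then have "s/t * ?w t \<le> ?w s" using w0 by simp
    then show ?thesis using t by (simp add: field_simps)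
  qed (use that in simp)
  show "(?w \<longlongrightarrow> 0) (at_right 0)"
  proof -
    have "((\<lambda>t. \<omega> (ennreal t)) \<longlongrightarrow> \<omega> (ennreal 0)) (at_right 0)"
      by (rule continuous_on_tendsto_compose[OF cont tendsto_ennrealI[OF tendsto_ident_at]]) auto
    then have "((\<lambda>t. ennreal (?w t)) \<longlongrightarrow> ennreal 0) (at_right 0)" by (simp add: w z)
    then show ?thesis
      by (rule tendsto_ennrealD) (simp_all add: w0)
  qed
  show "0 < ?w t" if "0 < t" for t
  proof (rule ccontr)
    assume "\<not> 0 < ?w t"
    then have t0: "?w t = 0" using w0[of t] by simp
    have s0: "?w s = 0" if "0 \<le> s" for s
    proof (cases "s \<le> t")
      case True then show ?thesis using mo[OF that True] t0 w0[of s] by simp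
    next
      case False then show ?thesis using st[of t s] \<open>0 < t\<close> t0 w0[of s]
        by (simp add: mult_le_0_iff)
    qed
    have fin: "\<omega> (ennreal s) = 0" if "0 \<le> s" for s
      using w[of s] s0[OF that] by simp
    have "(\<lambda>n. \<omega> (of_nat n)) \<longlonglongrightarrow> \<omega> top"
      by (rule continuous_on_tendsto_compose[OF cont of_nat_tendsto_top_ennreal]) auto
    moreover have "\<omega> (of_nat n) = 0" for n
      using fin[of "real n"] by (simp add: ennreal_of_nat_eq_real_of_nat)
    ultimately have "\<omega> top = 0" by (simp add: LIMSEQ_const_iff)
    moreover obtain x where "\<omega> x \<noteq> 0" using nz by blast
    ultimately show False using fin by (cases x) auto
  qed
qed

section \<open>The area functional\<close>

definition cont_deriv :: "(real \<Rightarrow> real) \<Rightarrow> (real \<Rightarrow> real) \<Rightarrow> bool" where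
  "cont_deriv f f' \<longleftrightarrow> (\<forall>x. (f has_real_derivative f' x) (at x)) \<and> continuous_on UNIV f'"

lemma cont_deriv_continuous: "cont_deriv f f' \<Longrightarrow> continuous_on S f" "cont_deriv f f' \<Longrightarrow> continuous_on S f'"
  unfolding cont_deriv_def
  by (meson DERIV_isCont continuous_at_imp_continuous_on, meson continuous_on_subset subset_UNIV)

lemma cont_deriv_diff: "cont_deriv f f' \<Longrightarrow> cont_deriv g g' \<Longrightarrow> cont_deriv (\<lambda>x. f x - g x) (\<lambda>x. f' x - g' x)"
  unfolding cont_deriv_def by (auto intro!: DERIV_diff continuous_intros)

lemma cont_deriv_poly: "cont_deriv (poly p) (poly (pderiv p))"
  unfolding cont_deriv_def by (auto intro!: continuous_intros)

lemma continuous_on_poly_fun [continuous_intros]: "continuous_on S (poly (p :: real poly))"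
  by (rule cont_deriv_continuous[OF cont_deriv_poly])

lemma cont_deriv_integral:
  assumes "cont_deriv f f'" "a \<le> b"
  shows "integral {a..b} f' = f b - f a"
  using assms
  by (intro integral_unique fundamental_theorem_of_calculus)
    (auto simp: cont_deriv_def has_real_derivative_iff_has_vector_derivative[symmetric]
      intro: has_field_derivative_at_within)

lemma cont_deriv_parts:
  assumes f: "cont_deriv f f'" and g: "cont_deriv g g'" and "a \<le> b"
  shows "integral {a..b} (\<lambda>x. f' x * g x) = f b * g b - f a * g a - integral {a..b} (\<lambda>x. f x * g' x)"
proof -
  have "((\<lambda>x. f' x * g x + f x * g' x) has_integral f b * g b - f a * g a) {a..b}"
    using assms
    by (intro fundamental_theorem_of_calculus)
      (auto simp: cont_deriv_def has_real_derivative_iff_has_vector_derivative[symmetric]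
        intro!: derivative_eq_intros has_field_derivative_at_within[of _ _ _ "{a..b}"])
  moreover have "((\<lambda>x. f x * g' x) has_integral integral {a..b} (\<lambda>x. f x * g' x)) {a..b}"
    by (intro integrable_integral integrable_continuous_real continuous_intros cont_deriv_continuous[OF f] cont_deriv_continuous[OF g])
  ultimately have "((\<lambda>x. f' x * g x + f x * g' x - f x * g' x) has_integral
      f b * g b - f a * g a - integral {a..b} (\<lambda>x. f x * g' x)) {a..b}"
    by (rule has_integral_diff)
  then show ?thesis by (simp add: integral_unique)
qed

text \<open>Half the vertical increment of a horizontal curve over \<open>[a, b]\<close> with
planar components \<open>f\<close> and \<open>g\<close>. The derivatives are separate arguments so
that \<open>deriv\<close>, \<open>pderiv\<close> and members of derivative chains can be
inserted.\<close>

definition area :: "real \<Rightarrow> real \<Rightarrow> (real \<Rightarrow> real) \<Rightarrow> (real \<Rightarrow> real) \<Rightarrow> (real \<Rightarrow> real) \<Rightarrow> (real \<Rightarrow> real) \<Rightarrow> real" where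
  "area a b f f' g g' = integral {a..b} (\<lambda>s. f' s * g s - g' s * f s)"

text \<open>Integration by parts moves the derivative from the perturbation \<open>(e, d)\<close>
to \<open>(S, T)\<close>; the boundary term at \<open>a\<close> vanishes.\<close>

lemma area_add:
  assumes S: "cont_deriv S S'" and T: "cont_deriv T T'" and e: "cont_deriv e e'" and d: "cont_deriv d d'" and "a \<le> b"
    and 0: "e a = 0" "d a = 0"
  shows "area a b (\<lambda>x. S x + e x) (\<lambda>x. S' x + e' x) (\<lambda>x. T x + d x) (\<lambda>x. T' x + d' x) =
    area a b S S' T T' + e b * T b - d b * S b
    + 2 * integral {a..b} (\<lambda>x. S' x * d x - T' x * e x) + area a b e e' d d'"
proof -
  note co = continuous_intros S[THEN cont_deriv_continuous(1)] S[THEN cont_deriv_continuous(2)]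
     T[THEN cont_deriv_continuous(1)] T[THEN cont_deriv_continuous(2)]
     e[THEN cont_deriv_continuous(1)] e[THEN cont_deriv_continuous(2)]
     d[THEN cont_deriv_continuous(1)] d[THEN cont_deriv_continuous(2)]
  note ii = integrable_continuous_real
  have "area a b (\<lambda>x. S x + e x) (\<lambda>x. S' x + e' x) (\<lambda>x. T x + d x) (\<lambda>x. T' x + d' x)
     = integral {a..b} (\<lambda>s. (S' s * T s - T' s * S s) + (e' s * T s - d' s * S s) + (S' s * d s - T' s * e s)
          + (e' s * d s - d' s * e s))"
    unfolding area_def by (rule integral_cong) (simp add: algebra_simps)
  also have "\<dots> = area a b S S' T T' + (integral {a..b} (\<lambda>s. e' s * T s) - integral {a..b} (\<lambda>s. d' s * S s))
      + integral {a..b} (\<lambda>s. S' s * d s - T' s * e s) + area a b e e' d d'"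
    unfolding area_def
    by (subst integral_add integral_diff; (intro ii co)?)+ simp
  also have "integral {a..b} (\<lambda>s. e' s * T s) = e b * T b - integral {a..b} (\<lambda>x. e x * T' x)"
    using cont_deriv_parts[OF e T \<open>a \<le> b\<close>] 0 by simp
  also have "integral {a..b} (\<lambda>s. d' s * S s) = d b * S b - integral {a..b} (\<lambda>x. d x * S' x)"
    using cont_deriv_parts[OF d S \<open>a \<le> b\<close>] 0 by simp
  also have J: "integral {a..b} (\<lambda>s. S' s * d s - T' s * e s) =
      integral {a..b} (\<lambda>x. d x * S' x) - integral {a..b} (\<lambda>x. e x * T' x)"
    by (subst integral_diff[symmetric]; (intro ii co)?) (simp add: mult.commute)
  finally have fin: "area a b (\<lambda>x. S x + e x) (\<lambda>x. S' x + e' x) (\<lambda>x. T x + d x) (\<lambda>x. T' x + d' x) =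
    area a b S S' T T' + (e b * T b - integral {a..b} (\<lambda>x. e x * T' x) -
      (d b * S b - integral {a..b} (\<lambda>x. d x * S' x)))
    + (integral {a..b} (\<lambda>x. d x * S' x) - integral {a..b} (\<lambda>x. e x * T' x)) + area a b e e' d d'" .
  have "x = A + p - q + 2 * (v - u) + R"
    if "x = A + (p - u - (q - v)) + (v - u) + R" for x A p q u v R :: real
    using that by simp
  from this[OF fin] show ?thesis unfolding J .
qed

lemma integral_abs_le_real:
  fixes f g :: "real \<Rightarrow> real"
  assumes "continuous_on {a..b} f" "continuous_on {a..b} g" "\<And>x. x \<in> {a..b} \<Longrightarrow> \<bar>f x\<bar> \<le> g x"
  shows "\<bar>integral {a..b} f\<bar> \<le> integral {a..b} g"
  using integral_norm_bound_integral[OF integrable_continuous_real[OF assms(1)]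
      integrable_continuous_real[OF assms(2)]] assms(3) by simp

text \<open>The left-hand side is the area discrepancy when \<open>S\<close> and \<open>T\<close>
are Taylor polynomials at \<open>a\<close>. The correction terms with \<open>S a\<close> and
\<open>T a\<close> combine with the boundary terms at \<open>b\<close> from the integration by
parts to products such as \<open>e b * (T b - T a)\<close>, and \<open>T b - T a\<close> is at
most the integral of \<open>|T'|\<close>. The right-hand side is the velocity, up to constants, if
\<open>M1 = \<omega>(b - a) (b - a)\<^sup>m\<close> and \<open>M2 = M1 / (b - a)\<close>. The
lemma serves both directions of the theorem.\<close>

lemma area_estimate:
  assumes S: "cont_deriv S S'" and T: "cont_deriv T T'" and e: "cont_deriv e e'" and d: "cont_deriv d d'" and "a \<le> b"
    and 0: "e a = 0" "d a = 0"
    and M1: "\<And>x. x \<in> {a..b} \<Longrightarrow> \<bar>e x\<bar> \<le> M1" "\<And>x. x \<in> {a..b} \<Longrightarrow> \<bar>d x\<bar> \<le> M1"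
    and M2: "\<And>x. x \<in> {a..b} \<Longrightarrow> \<bar>e' x\<bar> \<le> M2" "\<And>x. x \<in> {a..b} \<Longrightarrow> \<bar>d' x\<bar> \<le> M2"
  shows "\<bar>2 * area a b (\<lambda>x. S x + e x) (\<lambda>x. S' x + e' x) (\<lambda>x. T x + d x) (\<lambda>x. T' x + d' x)
     - 2 * area a b S S' T T' + 2 * S a * d b - 2 * T a * e b\<bar>
    \<le> 6 * M1 * integral {a..b} (\<lambda>s. \<bar>S' s\<bar> + \<bar>T' s\<bar>) + 4 * M1 * M2 * (b - a)"
proof -
  note co = continuous_intros S[THEN cont_deriv_continuous(1)] S[THEN cont_deriv_continuous(2)]
     T[THEN cont_deriv_continuous(1)] T[THEN cont_deriv_continuous(2)]
     e[THEN cont_deriv_continuous(1)] e[THEN cont_deriv_continuous(2)]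
     d[THEN cont_deriv_continuous(1)] d[THEN cont_deriv_continuous(2)]
  note ii = integrable_continuous_real
  have M0: "0 \<le> M1" using M1(1)[of a] \<open>a \<le> b\<close> by auto
  have M20: "0 \<le> M2" using M2(1)[of a] \<open>a \<le> b\<close> by auto
  let ?I = "integral {a..b} (\<lambda>s. \<bar>S' s\<bar> + \<bar>T' s\<bar>)"
  let ?J = "integral {a..b} (\<lambda>x. S' x * d x - T' x * e x)"
  let ?A = "area a b e e' d d'"
  have Isum: "?I = integral {a..b} (\<lambda>s. \<bar>S' s\<bar>) + integral {a..b} (\<lambda>s. \<bar>T' s\<bar>)"
    by (subst integral_add; (intro ii co)?) simp
  have DT: "\<bar>T b - T a\<bar> \<le> integral {a..b} (\<lambda>s. \<bar>T' s\<bar>)"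
    unfolding cont_deriv_integral[OF T \<open>a \<le> b\<close>, symmetric] by (rule integral_abs_le_real) (intro co order_refl)+
  have DS: "\<bar>S b - S a\<bar> \<le> integral {a..b} (\<lambda>s. \<bar>S' s\<bar>)"
    unfolding cont_deriv_integral[OF S \<open>a \<le> b\<close>, symmetric] by (rule integral_abs_le_real) (intro co order_refl)+
  have eb: "\<bar>e b\<bar> \<le> M1" "\<bar>d b\<bar> \<le> M1" using M1 \<open>a \<le> b\<close> by auto
  have 1: "\<bar>e b * (T b - T a) - d b * (S b - S a)\<bar> \<le> M1 * ?I"
  proof -
    have "\<bar>e b * (T b - T a)\<bar> \<le> M1 * integral {a..b} (\<lambda>s. \<bar>T' s\<bar>)"
      unfolding abs_mult using eb DT M0 by (intro mult_mono) auto
    moreover have "\<bar>d b * (S b - S a)\<bar> \<le> M1 * integral {a..b} (\<lambda>s. \<bar>S' s\<bar>)"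
      unfolding abs_mult using eb DS M0 by (intro mult_mono) auto
    ultimately show ?thesis unfolding Isum by (simp add: distrib_left) 
  qed
  have 2: "\<bar>?J\<bar> \<le> M1 * ?I"
  proof -
    have "\<bar>?J\<bar> \<le> integral {a..b} (\<lambda>s. M1 * (\<bar>S' s\<bar> + \<bar>T' s\<bar>))"
    proof (rule integral_abs_le_real)
      fix x assume x: "x \<in> {a..b}"
      have "\<bar>S' x * d x\<bar> \<le> \<bar>S' x\<bar> * M1" "\<bar>T' x * e x\<bar> \<le> \<bar>T' x\<bar> * M1"
        unfolding abs_mult using M1[OF x] by (auto intro: mult_left_mono)
      then show "\<bar>S' x * d x - T' x * e x\<bar> \<le> M1 * (\<bar>S' x\<bar> + \<bar>T' x\<bar>)"
        by (simp add: algebra_simps)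
    qed (intro co)+
    then show ?thesis by simp
  qed
  have 3: "\<bar>?A\<bar> \<le> 2 * M1 * M2 * (b - a)"
  proof -
    have "\<bar>?A\<bar> \<le> integral {a..b} (\<lambda>s. 2 * M1 * M2)"
      unfolding area_def
    proof (rule integral_abs_le_real)
      fix x assume x: "x \<in> {a..b}"
      have "\<bar>e' x * d x\<bar> \<le> M2 * M1" "\<bar>d' x * e x\<bar> \<le> M2 * M1"
        unfolding abs_mult using M1[OF x] M2[OF x] M20 by (auto intro: mult_mono)
      then show "\<bar>e' x * d x - d' x * e x\<bar> \<le> 2 * M1 * M2"
        by (simp add: algebra_simps)
    qed (intro co)+
    then show ?thesis using \<open>a \<le> b\<close> by (simp add: algebra_simps)
  qed
  have eq: "2 * area a b (\<lambda>x. S x + e x) (\<lambda>x. S' x + e' x) (\<lambda>x. T x + d x) (\<lambda>x. T' x + d' x)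
     - 2 * area a b S S' T T' + 2 * S a * d b - 2 * T a * e b
    = 2 * (e b * (T b - T a) - d b * (S b - S a)) + 4 * ?J + 2 * ?A"
    unfolding area_add[OF S T e d \<open>a \<le> b\<close> 0] by (simp add: algebra_simps)
  have "\<bar>2 * x + 4 * y + 2 * z\<bar> \<le> 6 * p + 2 * q"
    if "\<bar>x\<bar> \<le> p" "\<bar>y\<bar> \<le> p" "\<bar>z\<bar> \<le> q" for x y z p q :: real
    using that by linarith
  from this[OF 1 2 3] show ?thesis unfolding eq by (simp add: mult.assoc)
qed

section \<open>Coefficient norms of polynomials\<close>

text \<open>The \<open>\<ell>\<^sup>1\<close> norm of the coefficients: it is submultiplicative,
and on \<open>[0, 1]\<close> it bounds the polynomial.\<close>

definition pnorm :: "real poly \<Rightarrow> real" where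
  "pnorm p = (\<Sum>i\<le>degree p. \<bar>coeff p i\<bar>)"

lemma pnorm_0 [simp]: "pnorm 0 = 0"
  by (simp add: pnorm_def)

lemma pnorm_pCons [simp]: "pnorm (pCons a p) = \<bar>a\<bar> + pnorm p"
proof (cases "p = 0")
  case False
  then show ?thesis by (simp add: pnorm_def degree_pCons_eq sum.atMost_Suc_shift del: sum.atMost_Suc)
qed (simp add: pnorm_def)

lemma pnorm_nonneg [simp]: "0 \<le> pnorm p"
  by (simp add: pnorm_def sum_nonneg)

lemma pnorm_pos: "p \<noteq> 0 \<Longrightarrow> 0 < pnorm p"
  unfolding pnorm_def by (rule sum_pos2[of _ "degree p"]) auto

lemma pnorm_add_le: "pnorm (p + q) \<le> pnorm p + pnorm q"
proof (induction p arbitrary: q)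
  case (pCons a p)
  obtain b r where "q = pCons b r" by (cases q)
  then show ?case using pCons.IH[of r] by simp
qed simp

lemma pnorm_smult [simp]: "pnorm (smult c p) = \<bar>c\<bar> * pnorm p"
  by (induction p) (simp_all add: abs_mult algebra_simps)

lemma pnorm_minus [simp]: "pnorm (- p) = pnorm p"
  by (induction p) simp_all

lemma pnorm_diff_le: "pnorm (p - q) \<le> pnorm p + pnorm q"
  using pnorm_add_le[of p "- q"] by simp

lemma pnorm_sum_le: "pnorm (sum f A) \<le> (\<Sum>i\<in>A. pnorm (f i))"
proof (induction A rule: infinite_finite_induct)
  case (insert x A)
  then show ?case using pnorm_add_le[of "f x" "sum f A"] by simp
qed simp_all

lemma pnorm_mult_le: "pnorm (p * q) \<le> pnorm p * pnorm q"
proof (induction p)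
  case (pCons a p)
  have "pnorm (pCons a p * q) \<le> pnorm (smult a q) + pnorm (pCons 0 (p * q))"
    by (simp only: mult_pCons_left pnorm_add_le)
  also have "\<dots> \<le> pnorm (pCons a p) * pnorm q" using pCons.IH by (simp add: algebra_simps)
  finally show ?case .
qed simp

lemma pnorm_pderiv_le:
  assumes "degree p \<le> n"
  shows "pnorm (pderiv p) \<le> real n * pnorm p"
  using assms
proof (induction p arbitrary: n)
  case (pCons a p)
  show ?case
  proof (cases "p = 0")
    case False
    define k where "k = n - 1"
    have "Suc (degree p) \<le> n" using pCons.prems False by (simp add: degree_pCons_eq)
    then have k: "n = Suc k" "degree p \<le> k" by (simp_all add: k_def)
    have "pnorm (pderiv (pCons a p)) \<le> pnorm p + pnorm (pderiv p)"
      using pnorm_add_le[of p "pCons 0 (pderiv p)"] by (simp add: pderiv_pCons)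
    also have "\<dots> \<le> real n * pnorm p" using pCons.IH[OF k(2)] k by (simp add: algebra_simps)
    also have "\<dots> \<le> real n * pnorm (pCons a p)" by (simp add: mult_left_mono)
    finally show ?thesis .
  qed simp
qed simp

lemma pnorm_higher_pderiv_le:
  assumes "degree p \<le> n"
  shows "pnorm ((pderiv ^^ k) p) \<le> real n ^ k * pnorm p"
proof (induction k)
  case (Suc k)
  have "pnorm ((pderiv ^^ Suc k) p) \<le> real n * pnorm ((pderiv ^^ k) p)"
    using assms by (simp add: pnorm_pderiv_le degree_higher_pderiv)
  also have "\<dots> \<le> real n * (real n ^ k * pnorm p)" using Suc by (simp add: mult_left_mono)
  finally show ?case by simp
qed simp

lemma abs_poly_le_pnorm:
  assumes "\<bar>t\<bar> \<le> 1"
  shows "\<bar>poly p t\<bar> \<le> pnorm p"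
proof (induction p)
  case (pCons a p)
  have "\<bar>poly (pCons a p) t\<bar> \<le> \<bar>a\<bar> + \<bar>t\<bar> * \<bar>poly p t\<bar>"
    using abs_triangle_ineq[of a "t * poly p t"] by (simp add: abs_mult)
  also have "\<bar>t\<bar> * \<bar>poly p t\<bar> \<le> 1 * pnorm p" using pCons.IH assms by (intro mult_mono) auto
  finally show ?case by simp
qed simp

lemma poly_integral_bound:
  "\<bar>integral {0..1} (poly p)\<bar> \<le> pnorm p"
proof -
  have "\<bar>integral {0..1} (poly p)\<bar> \<le> integral {0..1::real} (\<lambda>_. pnorm p)"
    by (rule integral_abs_le_real[OF continuous_on_poly_fun continuous_on_const])
      (rule abs_poly_le_pnorm, simp)
  then show ?thesis by simp
qed

lemma poly_smult_fun: "poly (smult c p) = (\<lambda>x. c * poly p x)"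
  by (simp add: fun_eq_iff)

lemma poly_0_fun: "poly 0 = (\<lambda>x. 0)"
  by (simp add: fun_eq_iff)

text \<open>The weighted \<open>L\<^sup>2\<close> norm and the coefficient norm are both norms on
the finite-dimensional space of polynomials of degree at most \<open>d\<close>. The quadratic form
\<open>Q\<close> is continuous and positive on the compact set \<open>K\<close> of coefficient
sequences of norm one, so it has a positive minimum there.\<close>

lemma weighted_L2_coercive:
  fixes W :: "real poly"
  assumes W: "\<And>x. 0 < x \<Longrightarrow> x < 1 \<Longrightarrow> 0 < poly W x"
  shows "\<exists>c>0. \<forall>p. degree p \<le> d \<longrightarrow> c * (pnorm p)\<^sup>2 \<le> integral {0..1} (poly (W * p\<^sup>2))"
proof -
  define P where "P f = (\<Sum>i\<le>d. monom (f i) i)" for f :: "nat \<Rightarrow> real"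
  define Q where "Q f = (\<Sum>i\<le>d. \<Sum>j\<le>d. f i * f j * integral {0..1} (poly (W * monom 1 (i + j))))" for f :: "nat \<Rightarrow> real"
  have QP: "Q f = integral {0..1} (poly (W * (P f)\<^sup>2))" for f
  proof -
    have "(P f)\<^sup>2 = (\<Sum>i\<le>d. \<Sum>j\<le>d. smult (f i * f j) (monom 1 (i + j)))"
      by (simp add: P_def power2_eq_square sum_product mult_monom smult_monom)
    then have "W * (P f)\<^sup>2 = (\<Sum>i\<le>d. \<Sum>j\<le>d. smult (f i * f j) (W * monom 1 (i + j)))"
      by (simp add: sum_distrib_left)
    then have "poly (W * (P f)\<^sup>2) = (\<lambda>x. \<Sum>i\<le>d. \<Sum>j\<le>d. (f i * f j) * poly (W * monom 1 (i + j)) x)"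
      by (simp add: poly_sum fun_eq_iff)
    then show ?thesis unfolding Q_def
      by (simp add: integral_sum integrable_continuous_real continuous_intros del: poly_mult)
  qed
  have Wnn: "0 \<le> poly W x" if "x \<in> {0..1}" for x
  proof -
    have "closed {x. 0 \<le> poly W x}"
      by (intro closed_Collect_le continuous_on_const continuous_on_poly_fun)
    moreover have "{0<..<1} \<subseteq> {x. 0 \<le> poly W x}"
    proof
      fix x :: real assume "x \<in> {0<..<1}"
      then have "0 < x" "x < 1" by auto
      from W[OF this] show "x \<in> {x. 0 \<le> poly W x}" by simp
    qed
    ultimately have "closure {0<..<1} \<subseteq> {x. 0 \<le> poly W x}" by (rule closure_minimal[rotated])
    then show ?thesis using that by (auto simp: closure_greaterThanLessThan)
  qed
  have Qpos: "0 < Q f" if "P f \<noteq> 0" for f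
  proof (rule ccontr)
    let ?h = "poly (W * (P f)\<^sup>2)"
    have nn: "0 \<le> ?h x" if "x \<in> {0..1}" for x
      by (simp only: poly_mult poly_power) (rule mult_nonneg_nonneg[OF Wnn[OF that] zero_le_power2])
    assume "\<not> 0 < Q f"
    moreover have "0 \<le> integral {0..1} ?h"
      by (rule Henstock_Kurzweil_Integration.integral_nonneg
          [OF integrable_continuous_real[OF continuous_on_poly_fun]]) (rule nn)
    ultimately have "integral {0..1} ?h = 0" using QP by simp
    then have hi: "(?h has_integral 0) (cbox 0 1)"
      using integrable_integral[OF integrable_continuous_real[OF
          continuous_on_poly_fun[of "{0..1}" "W * (P f)\<^sup>2"]]]
      by (simp only: box_real)
    have "?h x = 0" if "x \<in> {0<..<1}" for x
      by (rule has_integral_0_cbox_imp_0[OF continuous_on_poly_fun nn hi])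
        (use that in \<open>simp_all del: poly_mult\<close>)
    then have "{0<..<1} \<subseteq> {x. poly (P f) x = 0}" using W by force
    then have "finite {0<..<1::real}" using poly_roots_finite[OF that] finite_subset by blast
    then show False using infinite_Ioo[of 0 "1::real"] by simp
  qed
  define B where "B i = (if i \<le> d then {-1..1::real} else {0})" for i
  define K where "K = (PiE UNIV B) \<inter> {f. (\<Sum>i\<le>d. \<bar>f i\<bar>) = 1}"
  have cc: "continuous_on S (\<lambda>f :: nat \<Rightarrow> real. f i)" for S i
    by (rule continuous_on_subset[OF continuous_on_product_coordinates]) simp
  have "compact (PiE UNIV B)"
  proof -
    have "compactin (product_topology (\<lambda>i::nat. euclidean) UNIV) (PiE UNIV B)"
      unfolding compactin_PiE by (auto simp: B_def)
    then show ?thesis by (simp add: euclidean_product_topology)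
  qed
  moreover have "closed {f :: nat \<Rightarrow> real. (\<Sum>i\<le>d. \<bar>f i\<bar>) = 1}"
    by (intro closed_Collect_eq continuous_intros cc)
  ultimately have cK: "compact K" unfolding K_def by (rule compact_Int_closed)
  have "(\<lambda>i. if i = 0 then 1 else 0) \<in> K" by (auto simp: K_def B_def if_distrib[of abs] cong: if_cong)
  then have "K \<noteq> {}" by blast
  moreover have "continuous_on K Q" unfolding Q_def by (intro continuous_intros cc)
  ultimately obtain f0 where f0: "f0 \<in> K" "\<And>f. f \<in> K \<Longrightarrow> Q f0 \<le> Q f"
    using continuous_attains_inf[OF cK] by blast
  have coeffP: "coeff (P f) i = (if i \<le> d then f i else 0)" for f i
    by (simp add: P_def coeff_sum)
  have "P f0 \<noteq> 0"
  proof
    assume "P f0 = 0"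
    then have "f0 i = 0" if "i \<le> d" for i using coeffP[of f0 i] that by simp
    then have "(\<Sum>i\<le>d. \<bar>f0 i\<bar>) = 0" by simp
    then show False using f0(1) by (simp add: K_def)
  qed
  then have "0 < Q f0" by (rule Qpos)
  moreover have "Q f0 * (pnorm p)\<^sup>2 \<le> integral {0..1} (poly (W * p\<^sup>2))" if dp: "degree p \<le> d" for p
  proof (cases "p = 0")
    case False
    \<comment> \<open>By homogeneity it suffices to consider the normalised coefficients.\<close>
    define f where "f i = coeff p i / pnorm p" for i
    note pp = pnorm_pos[OF False]
    have pn: "(\<Sum>i\<le>d. \<bar>coeff p i\<bar>) = pnorm p" unfolding pnorm_def
      using dp by (intro sum.mono_neutral_right) (auto simp: coeff_eq_0)
    have "\<bar>f i\<bar> \<le> 1" if "i \<le> d" for i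
    proof -
      have "\<bar>coeff p i\<bar> \<le> pnorm p" unfolding pn[symmetric] using that by (intro member_le_sum) auto
      then show ?thesis using pp by (simp add: f_def)
    qed
    moreover have "f i = 0" if "\<not> i \<le> d" for i using dp that by (simp add: f_def coeff_eq_0)
    moreover have "(\<Sum>i\<le>d. \<bar>f i\<bar>) = 1"
      using pp by (simp add: f_def pn sum_divide_distrib[symmetric])
    ultimately have "f \<in> K" by (auto simp: K_def B_def abs_le_iff PiE_iff split: if_splits)
    then have le: "Q f0 \<le> Q f" by (rule f0(2))
    have eq: "smult (pnorm p) (P f) = p"
      using pp dp by (intro poly_eqI) (auto simp: coeffP f_def coeff_eq_0)
    have "W * p\<^sup>2 = smult ((pnorm p)\<^sup>2) (W * (P f)\<^sup>2)"
      by (subst eq[symmetric]) (simp add: power2_eq_square)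
    then have "integral {0..1} (poly (W * p\<^sup>2)) = (pnorm p)\<^sup>2 * Q f"
      by (simp add: QP poly_smult_fun del: poly_mult)
    then show ?thesis using mult_right_mono[OF le, of "(pnorm p)\<^sup>2"] by (simp add: mult.commute)
  qed (simp add: poly_0_fun)
  ultimately show ?thesis by blast
qed

section \<open>Hermite interpolation\<close>

lemma higher_pderiv_root:
  fixes p :: "real poly"
  assumes "[:- c, 1:] ^ n dvd p" "k < n"
  shows "poly ((pderiv ^^ k) p) c = 0"
  using assms
proof (induction k arbitrary: p n)
  case 0
  then obtain q where "p = [:- c, 1:] ^ n * q" by (elim dvdE)
  then show ?case using 0(2) by (simp add: power_0_left)
next
  case (Suc k)
  then obtain n' where n: "n = Suc n'" "k < n'" by (cases n) auto
  from Suc.prems obtain q where p: "p = [:- c, 1:] ^ Suc n' * q" unfolding n by (elim dvdE)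
  have "pderiv p = [:- c, 1:] ^ n' * (smult (real (Suc n')) q + [:- c, 1:] * pderiv q)"
    unfolding p pderiv_mult pderiv_power_Suc by (simp add: pderiv_pCons algebra_simps)
  then have "[:- c, 1:] ^ n' dvd pderiv p" by (rule dvdI)
  from Suc.IH[OF this n(2)] show ?case by (simp add: funpow_swap1)
qed

lemma higher_pderiv_power_root:
  "poly ((pderiv ^^ j) ([:- c, 1:] ^ j * q)) c = fact j * poly q (c :: real)"
proof (induction j arbitrary: q)
  case (Suc j)
  have "pderiv ([:- c, 1:] ^ Suc j * q) = [:- c, 1:] ^ j * (smult (real (Suc j)) q + [:- c, 1:] * pderiv q)"
    unfolding pderiv_mult pderiv_power_Suc by (simp add: pderiv_pCons algebra_simps)
  then have "(pderiv ^^ Suc j) ([:- c, 1:] ^ Suc j * q)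
     = (pderiv ^^ j) ([:- c, 1:] ^ j * (smult (real (Suc j)) q + [:- c, 1:] * pderiv q))"
    by (simp only: funpow_Suc_right o_apply)
  then show ?case by (simp only: Suc.IH) (simp add: algebra_simps)
qed simp

lemma higher_pderiv_diff: "(pderiv ^^ n) (p - q :: real poly) = (pderiv ^^ n) p - (pderiv ^^ n) q"
  using higher_pderiv_add[of n p "smult (-1) q"] unfolding higher_pderiv_smult by simp

text \<open>The polynomial \<open>(x - 1)\<^sup>j x\<^sup>n\<close> has derivatives at
\<open>1\<close> that vanish below order \<open>j\<close> and equal \<open>j!\<close> at order
\<open>j\<close>; those of higher order are removed by basis polynomials constructed earlier,
going down in \<open>j\<close>.\<close>

lemma hermite_basis:
  assumes "j \<le> m"
  shows "\<exists>E :: real poly. [:0, 1:] ^ n dvd E \<and>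
    (\<forall>k\<le>m. poly ((pderiv ^^ k) E) 1 = (if k = j then 1 else 0))"
  using assms
proof (induction "m - j" arbitrary: j rule: less_induct)
  case less
  have "\<forall>i\<in>{j<..m}. \<exists>E :: real poly. [:0, 1:] ^ n dvd E \<and>
    (\<forall>k\<le>m. poly ((pderiv ^^ k) E) 1 = (if k = i then 1 else 0))"
  proof
    fix i assume "i \<in> {j<..m}"
    then have "m - i < m - j" "i \<le> m" by auto
    then show "\<exists>E :: real poly. [:0, 1:] ^ n dvd E \<and>
      (\<forall>k\<le>m. poly ((pderiv ^^ k) E) 1 = (if k = i then 1 else 0))"
      by (rule less.hyps)
  qed
  then obtain E :: "nat \<Rightarrow> real poly" where E: "\<And>i. i \<in> {j<..m} \<Longrightarrow> [:0, 1:] ^ n dvd E i"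
    "\<And>i k. i \<in> {j<..m} \<Longrightarrow> k \<le> m \<Longrightarrow> poly ((pderiv ^^ k) (E i)) 1 = (if k = i then 1 else 0)"
    by metis
  define B :: "real poly" where "B = [:- 1, 1:] ^ j * [:0, 1:] ^ n"
  define b where "b k = poly ((pderiv ^^ k) B) 1" for k
  have b0: "b k = 0" if "k < j" for k
    unfolding b_def using that by (intro higher_pderiv_root[of _ j]) (auto simp: B_def)
  have bj: "b j = fact j"
    unfolding b_def B_def using higher_pderiv_power_root[of j 1] by (simp add: poly_power)
  define R where "R = smult (1 / b j) (B - (\<Sum>i\<in>{j<..m}. smult (b i) (E i)))"
  have "[:0, 1:] ^ n dvd R" unfolding R_def
    by (intro dvd_smult dvd_diff dvd_sum) (auto simp: B_def intro: E(1))
  moreover have "poly ((pderiv ^^ k) R) 1 = (if k = j then 1 else 0)" if k: "k \<le> m" for k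
  proof -
    have "(\<Sum>i\<in>{j<..m}. b i * poly ((pderiv ^^ k) (E i)) 1) = (\<Sum>i\<in>{j<..m}. if k = i then b i else 0)"
      using E(2) k by (intro sum.cong) auto
    also have "\<dots> = (if j < k then b k else 0)" using k by simp
    finally have "poly ((pderiv ^^ k) R) 1 = (1 / b j) * (b k - (if j < k then b k else 0))"
      by (simp add: R_def higher_pderiv_smult higher_pderiv_diff higher_pderiv_sum poly_sum b_def)
    then show ?thesis using b0[of k] bj by (cases "k < j") auto
  qed
  ultimately show ?case by blast
qed

text \<open>The degree and the norm of the interpolant are bounded uniformly in the data, since
the interpolant is a linear combination of fixed basis polynomials.\<close>

lemma hermite_interpolation:
  "\<exists>C\<ge>0. \<exists>d. \<forall>r M. (\<forall>k\<le>m. \<bar>r k\<bar> \<le> M) \<longrightarrow>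
     (\<exists>e :: real poly. degree e \<le> d \<and> pnorm e \<le> C * M \<and>
       (\<forall>k\<le>m. poly ((pderiv ^^ k) e) 0 = 0 \<and> poly ((pderiv ^^ k) e) 1 = r k))"
proof -
  have "\<forall>j\<in>{..m}. \<exists>E :: real poly. [:0, 1:] ^ Suc m dvd E \<and>
    (\<forall>k\<le>m. poly ((pderiv ^^ k) E) 1 = (if k = j then 1 else 0))"
    using hermite_basis by blast
  then obtain E :: "nat \<Rightarrow> real poly" where E: "\<And>j. j \<le> m \<Longrightarrow> [:0, 1:] ^ Suc m dvd E j"
    "\<And>j k. j \<le> m \<Longrightarrow> k \<le> m \<Longrightarrow> poly ((pderiv ^^ k) (E j)) 1 = (if k = j then 1 else 0)"
    by (metis atMost_iff)
  define d where "d = (\<Sum>j\<le>m. degree (E j))"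
  define C where "C = (\<Sum>j\<le>m. pnorm (E j))"
  have "\<exists>e :: real poly. degree e \<le> d \<and> pnorm e \<le> C * M \<and>
       (\<forall>k\<le>m. poly ((pderiv ^^ k) e) 0 = 0 \<and> poly ((pderiv ^^ k) e) 1 = r k)"
    if r: "\<forall>k\<le>m. \<bar>r k\<bar> \<le> M" for r M
  proof (intro exI conjI allI impI)
    let ?e = "\<Sum>j\<le>m. smult (r j) (E j)"
    show "degree ?e \<le> d"
    proof (intro degree_sum_le)
      fix j assume "j \<in> {..m}"
      then have "degree (E j) \<le> d" unfolding d_def by (intro member_le_sum) auto
      then show "degree (smult (r j) (E j)) \<le> d" using degree_smult_le le_trans by blast
    qed simp
    have "pnorm ?e \<le> (\<Sum>j\<le>m. pnorm (smult (r j) (E j)))" by (rule pnorm_sum_le)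
    also have "\<dots> \<le> (\<Sum>j\<le>m. M * pnorm (E j))"
      using r by (intro sum_mono) (auto intro: mult_right_mono)
    finally show "pnorm ?e \<le> C * M" by (simp add: C_def sum_distrib_left mult.commute)
    fix k assume k: "k \<le> m"
    have "[:0, 1:] ^ Suc m dvd ?e" using E(1) by (intro dvd_sum dvd_smult) auto
    then show "poly ((pderiv ^^ k) ?e) 0 = 0"
      using k higher_pderiv_root[of 0 "Suc m" ?e k] by simp
    have "poly ((pderiv ^^ k) ?e) 1 = (\<Sum>j\<le>m. if k = j then r j else 0)"
      using E(2) k unfolding higher_pderiv_sum poly_sum higher_pderiv_smult poly_smult
      by (intro sum.cong) auto
    then show "poly ((pderiv ^^ k) ?e) 1 = r k" using k by simp
  qed
  moreover have "0 \<le> C" unfolding C_def by (intro sum_nonneg) auto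
  ultimately show ?thesis by blast
qed

section \<open>Correcting the area on the unit interval\<close>

definition pint :: "real poly \<Rightarrow> real" where
  "pint p = integral {0..1} (poly p)"

lemma pint_add: "pint (p + q) = pint p + pint q"
  unfolding pint_def
  by (subst integral_add[symmetric])
    (auto intro: integrable_continuous_real continuous_on_poly_fun simp: fun_eq_iff intro!: arg_cong[of _ _ "integral _"])

lemma pint_smult [simp]: "pint (smult c p) = c * pint p"
  by (simp add: pint_def poly_smult_fun)

lemma pint_minus [simp]: "pint (- p) = - pint p"
  using pint_smult[of "-1" p] by simp

lemma pint_diff: "pint (p - q) = pint p - pint q"
  using pint_add[of p "- q"] by simp

lemma pint_0 [simp]: "pint 0 = 0"
  using pint_smult[of 0 0] by simp

lemma pint_le: "\<bar>pint p\<bar> \<le> pnorm p"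
  unfolding pint_def by (rule poly_integral_bound)

definition poly_area :: "real poly \<Rightarrow> real poly \<Rightarrow> real" where
  "poly_area p q = pint (pderiv p * q - pderiv q * p)"

lemma poly_area_eq: "poly_area p q = area 0 1 (poly p) (poly (pderiv p)) (poly q) (poly (pderiv q))"
  unfolding poly_area_def pint_def area_def
  by (rule integral_cong) simp

lemma poly_area_add:
  assumes "poly u 0 = 0" "poly v 0 = 0" "poly u 1 = 0" "poly v 1 = 0"
  shows "poly_area (p + u) (q + v) = poly_area p q + 2 * pint (pderiv p * v - pderiv q * u) + poly_area u v"
proof -
  have "pint (pderiv p * v - pderiv q * u) =
      integral {0..1} (\<lambda>x. poly (pderiv p) x * poly v x - poly (pderiv q) x * poly u x)"
    unfolding pint_def by (rule integral_cong) simp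
  moreover have "area 0 1 (poly (p + u)) (poly (pderiv (p + u))) (poly (q + v)) (poly (pderiv (q + v)))
    = area 0 1 (\<lambda>x. poly p x + poly u x) (\<lambda>x. poly (pderiv p) x + poly (pderiv u) x)
       (\<lambda>x. poly q x + poly v x) (\<lambda>x. poly (pderiv q) x + poly (pderiv v) x)"
    unfolding area_def by (rule integral_cong) (simp add: pderiv_add)
  ultimately show ?thesis
    using area_add[OF cont_deriv_poly[of p] cont_deriv_poly[of q] cont_deriv_poly[of u] cont_deriv_poly[of v], of 0 1] assms
    by (simp add: poly_area_eq)
qed

text \<open>A square, hence positive inside \<open>(0, 1)\<close>, with zeros of high order at
both ends: adding a multiple of it leaves the jets at the ends unchanged.\<close>

definition end_weight :: "nat \<Rightarrow> real poly" where
  "end_weight n = ([:0, 1:] ^ n * [:- 1, 1:] ^ n)\<^sup>2"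

lemma end_weight_pos: "0 < x \<Longrightarrow> x < 1 \<Longrightarrow> 0 < poly (end_weight n) x"
  by (simp add: end_weight_def poly_power zero_less_power2)

lemma end_weight_dvd: "[:0, 1:] ^ n dvd end_weight n" "[:- 1, 1:] ^ n dvd end_weight n"
  by (simp_all add: end_weight_def power2_eq_square mult.assoc dvd_mult dvd_mult2)

lemma end_weight_self_pos: "0 < pint (end_weight n * end_weight n)"
proof -
  obtain c where c: "c > 0" "\<And>p. degree p \<le> 0 \<Longrightarrow> c * (pnorm p)\<^sup>2 \<le> integral {0..1} (poly (end_weight n * end_weight n * p\<^sup>2))"
    using weighted_L2_coercive[of "end_weight n * end_weight n" 0] end_weight_pos[of _ n] by auto
  have "pnorm 1 = 1" by (simp add: pnorm_def)
  then show ?thesis using c(2)[of 1] c(1) by (simp add: pint_def)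
qed


text \<open>Here \<open>p\<close> and \<open>q\<close> are the derivatives of the two components,
\<open>u\<close> and \<open>v\<close> the perturbations, and the left-hand side of the equation is
the change of \<open>2 * poly_area\<close>. In the regime \<open>small\<close> the perturbations
\<open>u = \<nu> W\<close> and \<open>v = \<mu> x W\<close> contribute the bilinear term \<open>-
\<nu> \<mu> \<kappa>\<close> with \<open>\<kappa> > 0\<close>; in the regime \<open>large\<close>
one perturbation is zero, so that the equation is linear in the other one.\<close>

lemma area_solvable:
  "\<exists>C1\<ge>0. \<exists>D. \<forall>p q \<delta>. degree p \<le> d \<longrightarrow> degree q \<le> d \<longrightarrow> \<bar>\<delta>\<bar> \<le> C0 * (1 + pnorm p + pnorm q) \<longrightarrow>
    (\<exists>u v. end_weight n dvd u \<and> end_weight n dvd v \<and> degree u \<le> D \<and> degree v \<le> D \<and>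
      pnorm u \<le> C1 \<and> pnorm v \<le> C1 \<and> 4 * pint (p * v - q * u) + 2 * poly_area u v = \<delta>)"
proof -
  define W where "W = end_weight n"
  define w where "w = pnorm W"
  obtain c where c: "c > 0" and cp: "\<And>p. degree p \<le> d \<Longrightarrow> c * (pnorm p)\<^sup>2 \<le> pint (W * p\<^sup>2)"
    using weighted_L2_coercive[of W d] end_weight_pos unfolding W_def pint_def by blast
  define \<kappa> where "\<kappa> = 2 * pint (W * W)"
  have \<kappa>: "0 < \<kappa>" using end_weight_self_pos[of n] by (simp add: \<kappa>_def W_def)
  define B where "B = 4 * w"
  define M where "M = (1 + B) / \<kappa>"
  define K0 where "K0 = \<bar>C0\<bar>"
  define L where "L = M * B + 3 * K0"
  define S where "S = 3 * K0 / (4 * c)"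
  have w0: "0 \<le> w" by (simp add: w_def)
  have pos: "0 \<le> B" "0 \<le> M" "0 \<le> K0" "0 \<le> L" "0 \<le> S"
    using w0 \<kappa> c by (simp_all add: B_def M_def K0_def L_def S_def)
  define C1 where "C1 = (L + M + S) * w"
  define D where "D = Suc (degree W + d)"
  let ?P = "\<lambda>p q \<delta> u v. end_weight n dvd u \<and> end_weight n dvd v \<and> degree u \<le> D \<and> degree v \<le> D \<and>
      pnorm u \<le> C1 \<and> pnorm v \<le> C1 \<and> 4 * pint (p * v - q * u) + 2 * poly_area u v = \<delta>"
  have C1: "0 \<le> C1" using pos w0 by (simp add: C1_def)
  have SC: "x \<le> C1" if "x \<le> t * w" "t \<le> L \<or> t \<le> M \<or> t \<le> S" for x t
  proof -
    have "t \<le> L + M + S" using that(2) pos by auto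
    then have "t * w \<le> C1" unfolding C1_def using w0 by (rule mult_right_mono)
    with that(1) show ?thesis by simp
  qed
  have small: "\<exists>u v. ?P p q \<delta> u v"
    if p: "pnorm p \<le> 1" and q: "pnorm q \<le> 1" and \<delta>: "\<bar>\<delta>\<bar> \<le> 3 * K0" for p q \<delta>
  proof -
    define X where "X = [:0, 1:] * W"
    define \<alpha> where "\<alpha> = 4 * pint (p * X)"
    define \<beta> where "\<beta> = 4 * pint (q * W)"
    have pX: "pnorm X = w" by (simp add: X_def w_def)
    have "\<bar>pint (p * X)\<bar> \<le> pnorm p * pnorm X" by (rule order_trans[OF pint_le pnorm_mult_le])
    also have "\<dots> \<le> 1 * w" using p pX w0 by (intro mult_mono) auto
    finally have \<alpha>: "\<bar>\<alpha>\<bar> \<le> B" by (simp add: \<alpha>_def B_def)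
    have "\<bar>pint (q * W)\<bar> \<le> pnorm q * pnorm W" by (rule order_trans[OF pint_le pnorm_mult_le])
    also have "\<dots> \<le> 1 * w" using q w0 unfolding w_def[symmetric] by (intro mult_mono) auto
    finally have \<beta>: "\<bar>\<beta>\<bar> \<le> B" by (simp add: \<beta>_def B_def)
    \<comment> \<open>The equation to solve is \<open>\<mu> \<alpha> - \<nu> (\<beta> + \<mu> \<kappa>) = \<delta>\<close>; this \<open>\<mu>\<close> makes the bracket equal to \<open>1\<close>.\<close>
    define \<mu> where "\<mu> = (1 - \<beta>) / \<kappa>"
    define \<nu> where "\<nu> = \<mu> * \<alpha> - \<delta>"
    have \<mu>: "\<bar>\<mu>\<bar> \<le> M" unfolding \<mu>_def M_def abs_divide using \<beta> \<kappa>
      by (auto intro: divide_right_mono)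
    have "\<bar>\<nu>\<bar> \<le> \<bar>\<mu> * \<alpha>\<bar> + \<bar>\<delta>\<bar>" by (simp add: \<nu>_def)
    also have "\<bar>\<mu> * \<alpha>\<bar> \<le> M * B" unfolding abs_mult using \<mu> \<alpha> pos by (intro mult_mono) auto
    finally have \<nu>: "\<bar>\<nu>\<bar> \<le> L" using \<delta> by (simp add: L_def)
    have dX: "pderiv X = W + [:0, 1:] * pderiv W"
      unfolding X_def pderiv_mult by (simp add: pderiv_pCons)
    have "poly_area (smult \<nu> W) (smult \<mu> X) = \<nu> * \<mu> * pint (- (W * W))"
    proof -
      have "pderiv W * X - pderiv X * W = - (W * W)"
      proof -
        have "W' * (x * W) - (W + x * W') * W = - (W * W)" for x W' :: "real poly"
          by (simp add: algebra_simps)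
        then show ?thesis unfolding dX unfolding X_def .
      qed
      then have "pderiv (smult \<nu> W) * smult \<mu> X - pderiv (smult \<mu> X) * smult \<nu> W
          = smult (\<nu> * \<mu>) (- (W * W))"
        by (simp add: pderiv_smult smult_diff_right[symmetric] mult.commute[of \<mu>] del: smult_diff_right smult_minus_right)
      then show ?thesis unfolding poly_area_def by (simp only: pint_smult)
    qed
    then have "2 * poly_area (smult \<nu> W) (smult \<mu> X) = - (\<nu> * \<mu> * \<kappa>)"
      by (simp add: \<kappa>_def)
    moreover have "4 * pint (p * smult \<mu> X - q * smult \<nu> W) = \<mu> * \<alpha> - \<nu> * \<beta>"
      by (simp add: pint_diff \<alpha>_def \<beta>_def algebra_simps)
    moreover have "\<mu> * \<kappa> = 1 - \<beta>" using \<kappa> by (simp add: \<mu>_def)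
    then have "\<nu> * \<mu> * \<kappa> = \<nu> - \<nu> * \<beta>" by (simp add: mult.assoc right_diff_distrib)
    ultimately have "4 * pint (p * smult \<mu> X - q * smult \<nu> W) + 2 * poly_area (smult \<nu> W) (smult \<mu> X) = \<delta>"
      by (simp add: \<nu>_def)
    moreover have "pnorm (smult \<nu> W) \<le> C1"
      by (rule SC[of _ "\<bar>\<nu>\<bar>"]) (use \<nu> in \<open>auto simp: w_def\<close>)
    moreover have "pnorm (smult \<mu> X) \<le> C1"
      by (rule SC[of _ "\<bar>\<mu>\<bar>"]) (use \<mu> in \<open>auto simp: pX\<close>)
    moreover have "degree (smult \<nu> W) \<le> D" "degree (smult \<mu> X) \<le> D"
      by (auto simp: D_def X_def degree_pCons_eq_if degree_smult_le[THEN order_trans])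
    moreover have "end_weight n dvd smult \<nu> W" "end_weight n dvd smult \<mu> X"
      unfolding X_def W_def by (intro dvd_smult dvd_refl dvd_mult)+
    ultimately show ?thesis by blast
  qed
  have large: "\<exists>v. end_weight n dvd v \<and> degree v \<le> D \<and> pnorm v \<le> C1 \<and> 4 * pint (p * v) = \<delta>"
    if dp: "degree p \<le> d" and p: "1 \<le> pnorm p" and \<delta>: "\<bar>\<delta>\<bar> \<le> 3 * K0 * pnorm p" for p \<delta>
  proof -
    \<comment> \<open>With \<open>v = s W p\<close> the change of the area is \<open>4 s I\<close>.\<close>
    define I where "I = pint (W * p\<^sup>2)"
    define s where "s = \<delta> / (4 * I)"
    have I: "c * (pnorm p)\<^sup>2 \<le> I" unfolding I_def by (rule cp[OF dp])
    have cpos: "0 < c * (pnorm p)\<^sup>2" using c p by simp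
    then have Ipos: "0 < I" using I by simp
    have "\<bar>s\<bar> \<le> 3 * K0 * pnorm p / (4 * (c * (pnorm p)\<^sup>2))"
      unfolding s_def abs_divide using \<delta> I cpos Ipos by (intro frac_le) auto
    then have "\<bar>s\<bar> * pnorm p \<le> 3 * K0 * pnorm p / (4 * (c * (pnorm p)\<^sup>2)) * pnorm p"
      by (rule mult_right_mono) simp
    also have "\<dots> = S" using p by (simp add: S_def power2_eq_square)
    finally have sS: "\<bar>s\<bar> * pnorm p \<le> S" .
    have "pnorm (smult s (W * p)) \<le> \<bar>s\<bar> * (w * pnorm p)"
      unfolding pnorm_smult w_def by (intro mult_left_mono pnorm_mult_le) auto
    then have "pnorm (smult s (W * p)) \<le> C1"
      by (intro SC[of _ "\<bar>s\<bar> * pnorm p"]) (use sS in \<open>auto simp: mult_ac\<close>)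
    moreover have "4 * pint (p * smult s (W * p)) = \<delta>"
    proof -
      have "p * smult s (W * p) = smult s (W * p\<^sup>2)" by (simp add: power2_eq_square mult_ac)
      then show ?thesis using Ipos by (simp add: s_def I_def)
    qed
    moreover have "degree (smult s (W * p)) \<le> D"
      using degree_mult_le[of W p] dp by (simp add: D_def degree_smult_le[THEN order_trans])
    moreover have "end_weight n dvd smult s (W * p)"
      unfolding W_def by (intro dvd_smult dvd_mult2 dvd_refl)
    ultimately show ?thesis by blast
  qed
  have "\<exists>u v. ?P p q \<delta> u v"
    if dp: "degree p \<le> d" and dq: "degree q \<le> d" and \<delta>: "\<bar>\<delta>\<bar> \<le> C0 * (1 + pnorm p + pnorm q)" for p q \<delta>
  proof -
    have "C0 * (1 + pnorm p + pnorm q) \<le> K0 * (1 + pnorm p + pnorm q)"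
      by (intro mult_right_mono) (auto simp: K0_def)
    then have \<delta>': "\<bar>\<delta>\<bar> \<le> K0 * (1 + pnorm p + pnorm q)" using \<delta> by linarith
    have bound: "\<bar>\<delta>\<bar> \<le> 3 * K0 * t" if "1 + pnorm p + pnorm q \<le> 3 * t" for t
      using mult_left_mono[OF that, of K0] \<delta>' pos by (simp add: mult_ac)
    consider "pnorm p \<le> 1" "pnorm q \<le> 1" | "1 \<le> pnorm p" "pnorm q \<le> pnorm p" | "1 \<le> pnorm q" "pnorm p \<le> pnorm q"
      by linarith
    then show ?thesis
    proof cases
      case 1
      then show ?thesis using bound[of 1] by (intro small) auto
    next
      case 2
      obtain v where v: "end_weight n dvd v" "degree v \<le> D" "pnorm v \<le> C1" "4 * pint (p * v) = \<delta>"
        using large[OF dp 2(1) bound] 2 by auto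
      then have "?P p q \<delta> 0 v" using C1 by (simp add: poly_area_def)
      then show ?thesis by blast
    next
      case 3
      obtain v where v: "end_weight n dvd v" "degree v \<le> D" "pnorm v \<le> C1" "4 * pint (q * v) = \<delta>"
        using large[OF dq 3(1) bound] 3 by auto
      then have "?P p q \<delta> (- v) 0" using C1 by (simp add: poly_area_def)
      then show ?thesis by blast
    qed
  qed
  then show ?thesis using C1 by blast
qed

lemma higher_pderiv_degree_less: "degree p < k \<Longrightarrow> (pderiv ^^ k) p = (0 :: real poly)"
proof (induction k arbitrary: p)
  case (Suc k)
  show ?case
  proof (cases "degree p = 0")
    case True
    then have "pderiv p = 0" by (simp add: pderiv_eq_0_iff)
    then show ?thesis by (simp add: funpow_swap1)
  next
    case False
    then have "degree (pderiv p) < k" using Suc.prems by (simp add: degree_pderiv)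
    from Suc.IH[OF this] show ?thesis by (simp add: funpow_swap1)
  qed
qed simp

text \<open>The data are normalised so that the errors \<open>r\<close>, \<open>s\<close> of the
Taylor jets at \<open>1\<close> are of order one; then all constants depend only on
\<open>m\<close> and \<open>C0\<close>. The velocity becomes \<open>1 + \<parallel>S'\<parallel> +
\<parallel>T'\<parallel>\<close> up to constants.\<close>

lemma unit_gap_fill:
  assumes C0: "0 \<le> C0"
  shows "\<exists>C1. \<forall>S T r s \<tau>. degree S \<le> m \<longrightarrow> degree T \<le> m \<longrightarrow>
    (\<forall>k\<le>m. \<bar>r k\<bar> \<le> C0 \<and> \<bar>s k\<bar> \<le> C0) \<longrightarrow>
    \<bar>\<tau> - 2 * poly_area S T + 2 * poly S 0 * s 0 - 2 * poly T 0 * r 0\<bar>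
       \<le> C0 * (1 + pnorm (pderiv S) + pnorm (pderiv T)) \<longrightarrow>
    (\<exists>P Q. (\<forall>k\<le>m. poly ((pderiv ^^ k) P) 0 = poly ((pderiv ^^ k) S) 0 \<and>
              poly ((pderiv ^^ k) P) 1 = poly ((pderiv ^^ k) S) 1 + r k \<and>
              poly ((pderiv ^^ k) Q) 0 = poly ((pderiv ^^ k) T) 0 \<and>
              poly ((pderiv ^^ k) Q) 1 = poly ((pderiv ^^ k) T) 1 + s k) \<and>
       2 * poly_area P Q = \<tau> \<and>
       (\<forall>t\<in>{0..1}. \<bar>poly ((pderiv ^^ Suc m) P) t\<bar> \<le> C1 \<and> \<bar>poly ((pderiv ^^ Suc m) Q) t\<bar> \<le> C1))"
proof -
  obtain Ch dh where Ch: "0 \<le> Ch" and herm: "\<And>r M. (\<And>k. k \<le> m \<Longrightarrow> \<bar>r k\<bar> \<le> M) \<Longrightarrow>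
     \<exists>e :: real poly. degree e \<le> dh \<and> pnorm e \<le> Ch * M \<and>
       (\<forall>k\<le>m. poly ((pderiv ^^ k) e) 0 = 0 \<and> poly ((pderiv ^^ k) e) 1 = r k)"
    using hermite_interpolation[of m] by metis
  define E where "E = Ch * C0"
  define E' where "E' = real dh * E"
  have E0: "0 \<le> E" "0 \<le> E'" using Ch C0 by (simp_all add: E_def E'_def)
  define C2 where "C2 = C0 + 6 * E + 4 * E * E'"
  \<comment> \<open>The factor \<open>1 + 2 E'\<close> accounts for replacing \<open>S'\<close>, \<open>T'\<close> by the derivatives \<open>p\<close>, \<open>q\<close> of the interpolants.\<close>
  define C3 where "C3 = C2 * (1 + 2 * E')"
  have C20: "0 \<le> C2" using E0 C0 by (simp add: C2_def)
  obtain C4 D where C4: "0 \<le> C4" and solve: "\<And>p q \<delta>. degree p \<le> m + dh \<Longrightarrow> degree q \<le> m + dh \<Longrightarrow>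
     \<bar>\<delta>\<bar> \<le> C3 * (1 + pnorm p + pnorm q) \<Longrightarrow>
    \<exists>u v. end_weight (Suc m) dvd u \<and> end_weight (Suc m) dvd v \<and> degree u \<le> D \<and> degree v \<le> D \<and>
      pnorm u \<le> C4 \<and> pnorm v \<le> C4 \<and> 4 * pint (p * v - q * u) + 2 * poly_area u v = \<delta>"
    using area_solvable[of "m + dh" C3 "Suc m"] by metis
  define C1 where "C1 = real dh ^ Suc m * E + real D ^ Suc m * C4"
  show ?thesis
  proof (rule exI[of _ C1], intro allI impI)
    fix S T r s \<tau>
    assume S: "degree S \<le> m" and T: "degree T \<le> m" and rs: "\<forall>k\<le>m. \<bar>r k\<bar> \<le> C0 \<and> \<bar>s k\<bar> \<le> C0"
      and \<tau>: "\<bar>\<tau> - 2 * poly_area S T + 2 * poly S 0 * s 0 - 2 * poly T 0 * r 0\<bar>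
       \<le> C0 * (1 + pnorm (pderiv S) + pnorm (pderiv T))"
    obtain e where e: "degree e \<le> dh" "pnorm e \<le> E" and ek: "\<And>k. k \<le> m \<Longrightarrow> poly ((pderiv ^^ k) e) 0 = 0"
      "\<And>k. k \<le> m \<Longrightarrow> poly ((pderiv ^^ k) e) 1 = r k"
      using herm[of r C0] rs unfolding E_def by auto
    obtain g where g: "degree g \<le> dh" "pnorm g \<le> E" and gk: "\<And>k. k \<le> m \<Longrightarrow> poly ((pderiv ^^ k) g) 0 = 0"
      "\<And>k. k \<le> m \<Longrightarrow> poly ((pderiv ^^ k) g) 1 = s k"
      using herm[of s C0] rs unfolding E_def by auto
    have e': "pnorm (pderiv e) \<le> E'" using pnorm_pderiv_le[OF e(1)] mult_left_mono[OF e(2), of "real dh"]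
      by (simp add: E'_def)
    have g': "pnorm (pderiv g) \<le> E'" using pnorm_pderiv_le[OF g(1)] mult_left_mono[OF g(2), of "real dh"]
      by (simp add: E'_def)
    define N where "N = pnorm (pderiv S) + pnorm (pderiv T)"
    define p where "p = pderiv (S + e)"
    define q where "q = pderiv (T + g)"
    \<comment> \<open>The area still missing after interpolation.\<close>
    define \<delta> where "\<delta> = \<tau> - 2 * poly_area (S + e) (T + g)"
    have "\<bar>2 * poly_area (S + e) (T + g) - 2 * poly_area S T + 2 * poly S 0 * s 0 - 2 * poly T 0 * r 0\<bar>
       \<le> 6 * E * N + 4 * E * E'"
    proof -
      have unit: "\<bar>x\<bar> \<le> 1" if "x \<in> {0..1}" for x :: real using that by auto
      have "\<bar>2 * area 0 1 (\<lambda>x. poly S x + poly e x) (\<lambda>x. poly (pderiv S) x + poly (pderiv e) x)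
              (\<lambda>x. poly T x + poly g x) (\<lambda>x. poly (pderiv T) x + poly (pderiv g) x)
           - 2 * area 0 1 (poly S) (poly (pderiv S)) (poly T) (poly (pderiv T))
           + 2 * poly S 0 * poly g 1 - 2 * poly T 0 * poly e 1\<bar>
         \<le> 6 * E * integral {0..1} (\<lambda>x. \<bar>poly (pderiv S) x\<bar> + \<bar>poly (pderiv T) x\<bar>) + 4 * E * E' * (1 - 0)"
        using ek(1)[of 0] gk(1)[of 0]
        by (intro area_estimate cont_deriv_poly)
          (auto intro: order_trans[OF abs_poly_le_pnorm[OF unit]] e(2) g(2) e' g')
      moreover have "(\<lambda>x. poly S x + poly e x) = poly (S + e)" "(\<lambda>x. poly T x + poly g x) = poly (T + g)"
        "(\<lambda>x. poly (pderiv S) x + poly (pderiv e) x) = poly (pderiv (S + e))"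
        "(\<lambda>x. poly (pderiv T) x + poly (pderiv g) x) = poly (pderiv (T + g))"
        by (simp_all add: fun_eq_iff pderiv_add)
      moreover have "poly g 1 = s 0" "poly e 1 = r 0" using ek(2)[of 0] gk(2)[of 0] by auto
      moreover have "6 * E * integral {0..1} (\<lambda>x. \<bar>poly (pderiv S) x\<bar> + \<bar>poly (pderiv T) x\<bar>) \<le> 6 * E * N"
      proof (intro mult_left_mono)
        have "\<bar>integral {0..1} (\<lambda>x. \<bar>poly (pderiv S) x\<bar> + \<bar>poly (pderiv T) x\<bar>)\<bar> \<le> integral {0..1::real} (\<lambda>x. N)"
          by (rule integral_abs_le_real)
            (auto simp: N_def intro!: continuous_on_add continuous_on_rabs continuous_on_poly_fun
              add_mono abs_poly_le_pnorm[OF unit] simp del: poly_smult)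
        then show "integral {0..1} (\<lambda>x. \<bar>poly (pderiv S) x\<bar> + \<bar>poly (pderiv T) x\<bar>) \<le> N" by simp
      qed (use E0 in simp)
      ultimately show ?thesis by (simp add: poly_area_eq)
    qed
    then have "\<bar>\<delta>\<bar> \<le> C0 * (1 + N) + (6 * E * N + 4 * E * E')"
      using \<tau> unfolding \<delta>_def N_def by (simp add: add.assoc)
    also have "\<dots> \<le> C2 * (1 + N)"
      using E0 by (simp add: C2_def N_def algebra_simps)
    also have "\<dots> \<le> C2 * ((1 + 2 * E') * (1 + pnorm p + pnorm q))"
    proof (intro mult_left_mono C20)
      have "pnorm (pderiv S) \<le> pnorm p + E'"
        using pnorm_diff_le[of p "pderiv e"] e' by (simp add: p_def pderiv_add)
      moreover have "pnorm (pderiv T) \<le> pnorm q + E'"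
        using pnorm_diff_le[of q "pderiv g"] g' by (simp add: q_def pderiv_add)
      ultimately have "1 + N \<le> (1 + 2 * E') + pnorm p + pnorm q" by (simp add: N_def)
      also have "\<dots> \<le> (1 + 2 * E') + (1 + 2 * E') * (pnorm p + pnorm q)"
        using E0 by (simp add: distrib_right)
      finally show "1 + N \<le> (1 + 2 * E') * (1 + pnorm p + pnorm q)" by (simp add: algebra_simps)
    qed
    finally have \<delta>: "\<bar>\<delta>\<bar> \<le> C3 * (1 + pnorm p + pnorm q)" by (simp add: C3_def mult.assoc)
    have dp: "degree p \<le> m + dh" "degree q \<le> m + dh"
      unfolding p_def q_def degree_pderiv using S T e(1) g(1)
        degree_add_le[of S "m + dh" e] degree_add_le[of T "m + dh" g] by auto
    obtain u v where uv: "end_weight (Suc m) dvd u" "end_weight (Suc m) dvd v" "degree u \<le> D" "degree v \<le> D"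
      "pnorm u \<le> C4" "pnorm v \<le> C4" and eq: "4 * pint (p * v - q * u) + 2 * poly_area u v = \<delta>"
      using solve[OF dp \<delta>] by blast
    have van: "poly ((pderiv ^^ k) y) 0 = 0 \<and> poly ((pderiv ^^ k) y) 1 = 0"
      if "end_weight (Suc m) dvd y" "k \<le> m" for y k
      using higher_pderiv_root[of 0 "Suc m" y k] higher_pderiv_root[of 1 "Suc m" y k]
        dvd_trans[OF end_weight_dvd(1) that(1)] dvd_trans[OF end_weight_dvd(2) that(1)] that(2) by simp
    have jets: "\<forall>k\<le>m. poly ((pderiv ^^ k) (S + e + u)) 0 = poly ((pderiv ^^ k) S) 0 \<and>
              poly ((pderiv ^^ k) (S + e + u)) 1 = poly ((pderiv ^^ k) S) 1 + r k \<and>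
              poly ((pderiv ^^ k) (T + g + v)) 0 = poly ((pderiv ^^ k) T) 0 \<and>
              poly ((pderiv ^^ k) (T + g + v)) 1 = poly ((pderiv ^^ k) T) 1 + s k"
      using ek gk van[OF uv(1)] van[OF uv(2)] by (simp add: higher_pderiv_add)
    have "2 * poly_area (S + e + u) (T + g + v) = 2 * poly_area (S + e) (T + g) + \<delta>"
      using poly_area_add[of u v "S + e" "T + g"] van[OF uv(1), of 0] van[OF uv(2), of 0] eq
      by (simp add: p_def q_def)
    then have ar: "2 * poly_area (S + e + u) (T + g + v) = \<tau>" by (simp add: \<delta>_def)
    have top: "\<bar>poly ((pderiv ^^ Suc m) (S + e + u)) t\<bar> \<le> C1"
      if "t \<in> {0..1}" "degree S \<le> m" "degree e \<le> dh" "pnorm e \<le> E" "degree u \<le> D" "pnorm u \<le> C4" for t S e u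
    proof -
      have t: "\<bar>t\<bar> \<le> 1" using that(1) by auto
      have "(pderiv ^^ Suc m) S = 0" using that(2) by (intro higher_pderiv_degree_less) simp
      then have "poly ((pderiv ^^ Suc m) (S + e + u)) t = poly ((pderiv ^^ Suc m) e) t + poly ((pderiv ^^ Suc m) u) t"
        by (simp only: higher_pderiv_add) simp
      moreover have "\<bar>poly ((pderiv ^^ Suc m) e) t\<bar> \<le> real dh ^ Suc m * E"
        by (rule order_trans[OF abs_poly_le_pnorm[OF t] order_trans[OF pnorm_higher_pderiv_le[OF that(3)]]])
          (rule mult_left_mono[OF that(4)], simp)
      moreover have "\<bar>poly ((pderiv ^^ Suc m) u) t\<bar> \<le> real D ^ Suc m * C4"
        by (rule order_trans[OF abs_poly_le_pnorm[OF t] order_trans[OF pnorm_higher_pderiv_le[OF that(5)]]])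
          (rule mult_left_mono[OF that(6)], simp)
      ultimately show ?thesis unfolding C1_def by linarith
    qed
    show "\<exists>P Q. (\<forall>k\<le>m. poly ((pderiv ^^ k) P) 0 = poly ((pderiv ^^ k) S) 0 \<and>
              poly ((pderiv ^^ k) P) 1 = poly ((pderiv ^^ k) S) 1 + r k \<and>
              poly ((pderiv ^^ k) Q) 0 = poly ((pderiv ^^ k) T) 0 \<and>
              poly ((pderiv ^^ k) Q) 1 = poly ((pderiv ^^ k) T) 1 + s k) \<and>
       2 * poly_area P Q = \<tau> \<and>
       (\<forall>t\<in>{0..1}. \<bar>poly ((pderiv ^^ Suc m) P) t\<bar> \<le> C1 \<and> \<bar>poly ((pderiv ^^ Suc m) Q) t\<bar> \<le> C1)"
      by (intro exI[of _ "S + e + u"] exI[of _ "T + g + v"] conjI jets ar ballI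
          top[OF _ S e uv(3) uv(5)] top[OF _ T g uv(4) uv(6)])
  qed
qed

section \<open>Filling one gap\<close>

text \<open>The \<open>k\<close>-th derivative of \<open>N P((x - a) / L)\<close>.\<close>

definition rescale :: "real \<Rightarrow> real \<Rightarrow> real \<Rightarrow> real poly \<Rightarrow> nat \<Rightarrow> real \<Rightarrow> real" where
  "rescale N a L P k x = N / L ^ k * poly ((pderiv ^^ k) P) ((x - a) / L)"

lemma rescale_chain:
  assumes "L \<noteq> 0"
  shows "deriv_chain n (rescale N a L P)"
  unfolding deriv_chain_def
proof (intro allI impI)
  fix k x
  have "((\<lambda>x. (x - a) / L) has_real_derivative 1 / L) (at x)"
    using assms by (auto intro!: derivative_eq_intros)
  then have "((\<lambda>x. poly ((pderiv ^^ k) P) ((x - a) / L)) has_real_derivative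
      poly (pderiv ((pderiv ^^ k) P)) ((x - a) / L) * (1 / L)) (at x)"
    by (rule DERIV_chain2[OF poly_DERIV])
  then have "((\<lambda>x. N / L ^ k * poly ((pderiv ^^ k) P) ((x - a) / L)) has_real_derivative
      N / L ^ k * (poly (pderiv ((pderiv ^^ k) P)) ((x - a) / L) * (1 / L))) (at x)"
    by (rule DERIV_cmult)
  then show "(rescale N a L P k has_real_derivative rescale N a L P (Suc k) x) (at x)"
    using assms by (simp add: rescale_def[abs_def] field_simps)
qed

lemma chain_unique:
  assumes "deriv_chain m D" "deriv_chain m E" "D 0 = E 0" "k \<le> m"
  shows "D k = E k"
  using iter_deriv_chain[OF assms(1,4)] iter_deriv_chain[OF assms(2,4)] assms(3) by simp

lemma integral_rescale:
  fixes h :: "real \<Rightarrow> real"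
  assumes "a < b" "continuous_on {0..1} h"
  shows "integral {a..b} (\<lambda>x. h ((x - a) / (b - a))) = (b - a) * integral {0..1} h"
proof -
  have "(h has_integral integral {0..1} h) (cbox 0 1)"
    using assms(2) by (simp add: integrable_continuous_real integrable_integral)
  from has_integral_affinity[OF this, of "1 / (b - a)" "- a / (b - a)"]
  have "((\<lambda>x. h ((1 / (b - a)) *\<^sub>R x + - a / (b - a))) has_integral (1 / \<bar>1 / (b - a)\<bar> ^ DIM(real)) *\<^sub>R integral {0..1} h)
     ((\<lambda>x. (1 / (1 / (b - a))) *\<^sub>R x + - ((1 / (1 / (b - a))) *\<^sub>R (- a / (b - a)))) ` cbox 0 1)"
    using assms(1) by simp
  moreover have "(\<lambda>x. (1 / (1 / (b - a))) *\<^sub>R x + - ((1 / (1 / (b - a))) *\<^sub>R (- a / (b - a)))) ` cbox 0 1 = {a..b}"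
    using assms(1) image_affinity_atLeastAtMost[of "b - a" a 0 1] by simp
  moreover have "(\<lambda>x. h ((1 / (b - a)) *\<^sub>R x + - a / (b - a))) = (\<lambda>x. h ((x - a) / (b - a)))"
    by (simp add: diff_divide_distrib)
  ultimately show ?thesis using assms(1) by (simp add: integral_unique)
qed

lemma area_rescale:
  assumes "a < b"
  shows "area a b (rescale N a (b - a) P 0) (rescale N a (b - a) P 1) (rescale N a (b - a) Q 0) (rescale N a (b - a) Q 1)
    = N\<^sup>2 * poly_area P Q"
proof -
  let ?h = "poly (pderiv P * Q - pderiv Q * P)"
  have "area a b (rescale N a (b - a) P 0) (rescale N a (b - a) P 1) (rescale N a (b - a) Q 0) (rescale N a (b - a) Q 1)
    = integral {a..b} (\<lambda>x. N\<^sup>2 / (b - a) * ?h ((x - a) / (b - a)))"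
    unfolding area_def rescale_def
    by (rule integral_cong) (simp add: power2_eq_square algebra_simps diff_divide_distrib)
  also have "\<dots> = N\<^sup>2 / (b - a) * ((b - a) * integral {0..1} ?h)"
    by (simp only: integral_mult_right integral_rescale[OF assms continuous_on_poly_fun])
  finally show ?thesis using assms by (simp add: poly_area_def pint_def)
qed

lemma taylor_rescale:
  assumes "a < b" "N \<noteq> 0"
  obtains S where "degree S \<le> m" "\<And>k. k \<le> m \<Longrightarrow> rescale N a (b - a) S k = taylor (m - k) (\<lambda>l. F (k + l)) a"
proof -
  define L where "L = b - a"
  have L: "L \<noteq> 0" using assms by (simp add: L_def)
  define S where "S = (\<Sum>k\<le>m. monom (F k a * L ^ k / (fact k * N)) k)"
  have "degree S \<le> m" unfolding S_def
    by (intro degree_sum_le) (auto intro: order_trans[OF degree_monom_le])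
  moreover have "rescale N a L S 0 = taylor m F a"
  proof
    fix x
    show "rescale N a L S 0 x = taylor m F a x"
      unfolding rescale_def taylor_def S_def using L assms(2)
      by (simp add: poly_sum poly_monom power_divide sum_distrib_left mult_ac)
  qed
  then have "rescale N a L S k = taylor (m - k) (\<lambda>l. F (k + l)) a" if "k \<le> m" for k
    using chain_unique[OF rescale_chain[OF L, of m N a S] taylor_chain[of m F a] _ that] by simp
  ultimately show ?thesis using that[of S] by (simp add: L_def)
qed

text \<open>The unit gap lemma, transported to \<open>[a, b]\<close> with the scaling factor
\<open>N = W (b - a)\<^sup>m\<close> for the values. The area scales by \<open>N\<^sup>2\<close>,
as the velocity does.\<close>

lemma gap_fill:
  assumes C0: "0 \<le> C0" and m: "1 \<le> m"
  shows "\<exists>C1. \<forall>a b W F G \<tau>. a < b \<longrightarrow> 0 < W \<longrightarrow>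
    (\<forall>k\<le>m. \<bar>F k b - taylor (m - k) (\<lambda>l. F (k + l)) a b\<bar> \<le> C0 * W * (b - a) ^ (m - k)) \<longrightarrow>
    (\<forall>k\<le>m. \<bar>G k b - taylor (m - k) (\<lambda>l. G (k + l)) a b\<bar> \<le> C0 * W * (b - a) ^ (m - k)) \<longrightarrow>
    \<bar>\<tau> - 2 * area a b (taylor m F a) (deriv (taylor m F a)) (taylor m G a) (deriv (taylor m G a))
       + 2 * F 0 a * (G 0 b - taylor m G a b) - 2 * G 0 a * (F 0 b - taylor m F a b)\<bar>
     \<le> C0 * (W\<^sup>2 * (b - a) ^ (2 * m) + W * (b - a) ^ m *
          integral {a..b} (\<lambda>s. \<bar>deriv (taylor m F a) s\<bar> + \<bar>deriv (taylor m G a) s\<bar>)) \<longrightarrow>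
    (\<exists>f g. deriv_chain (Suc m) f \<and> deriv_chain (Suc m) g \<and>
       (\<forall>k\<le>m. f k a = F k a \<and> f k b = F k b \<and> g k a = G k a \<and> g k b = G k b) \<and>
       2 * area a b (f 0) (f 1) (g 0) (g 1) = \<tau> \<and>
       (\<forall>x\<in>{a..b}. \<bar>f (Suc m) x\<bar> \<le> C1 * W / (b - a) \<and> \<bar>g (Suc m) x\<bar> \<le> C1 * W / (b - a)))"
proof -
  obtain C1 where C1: "\<And>S T r s \<tau>. degree S \<le> m \<Longrightarrow> degree T \<le> m \<Longrightarrow>
    (\<And>k. k \<le> m \<Longrightarrow> \<bar>r k\<bar> \<le> C0 \<and> \<bar>s k\<bar> \<le> C0) \<Longrightarrow>
    \<bar>\<tau> - 2 * poly_area S T + 2 * poly S 0 * s 0 - 2 * poly T 0 * r 0\<bar>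
       \<le> C0 * (1 + pnorm (pderiv S) + pnorm (pderiv T)) \<Longrightarrow>
    \<exists>P Q. (\<forall>k\<le>m. poly ((pderiv ^^ k) P) 0 = poly ((pderiv ^^ k) S) 0 \<and>
              poly ((pderiv ^^ k) P) 1 = poly ((pderiv ^^ k) S) 1 + r k \<and>
              poly ((pderiv ^^ k) Q) 0 = poly ((pderiv ^^ k) T) 0 \<and>
              poly ((pderiv ^^ k) Q) 1 = poly ((pderiv ^^ k) T) 1 + s k) \<and>
       2 * poly_area P Q = \<tau> \<and>
       (\<forall>t\<in>{0..1}. \<bar>poly ((pderiv ^^ Suc m) P) t\<bar> \<le> C1 \<and> \<bar>poly ((pderiv ^^ Suc m) Q) t\<bar> \<le> C1)"
    using unit_gap_fill[OF C0, of m] by blast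
  show ?thesis
  proof (rule exI[of _ C1], intro allI impI)
    fix a b W :: real and F G :: "nat \<Rightarrow> real \<Rightarrow> real" and \<tau> :: real
    assume ab: "a < b" and W: "0 < W"
      and F: "\<forall>k\<le>m. \<bar>F k b - taylor (m - k) (\<lambda>l. F (k + l)) a b\<bar> \<le> C0 * W * (b - a) ^ (m - k)"
      and G: "\<forall>k\<le>m. \<bar>G k b - taylor (m - k) (\<lambda>l. G (k + l)) a b\<bar> \<le> C0 * W * (b - a) ^ (m - k)"
      and A: "\<bar>\<tau> - 2 * area a b (taylor m F a) (deriv (taylor m F a)) (taylor m G a) (deriv (taylor m G a))
       + 2 * F 0 a * (G 0 b - taylor m G a b) - 2 * G 0 a * (F 0 b - taylor m F a b)\<bar>
     \<le> C0 * (W\<^sup>2 * (b - a) ^ (2 * m) + W * (b - a) ^ m *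
          integral {a..b} (\<lambda>s. \<bar>deriv (taylor m F a) s\<bar> + \<bar>deriv (taylor m G a) s\<bar>))"
    define L where "L = b - a"
    have L: "0 < L" using ab by (simp add: L_def)
    define N where "N = W * L ^ m"
    have N: "0 < N" using W L by (simp add: N_def)
    obtain S where S: "degree S \<le> m" and Sk: "\<And>k. k \<le> m \<Longrightarrow> rescale N a L S k = taylor (m - k) (\<lambda>l. F (k + l)) a"
      using taylor_rescale[of a b N m F] ab N unfolding L_def by (metis less_irrefl)
    obtain T where T: "degree T \<le> m" and Tk: "\<And>k. k \<le> m \<Longrightarrow> rescale N a L T k = taylor (m - k) (\<lambda>l. G (k + l)) a"
      using taylor_rescale[of a b N m G] ab N unfolding L_def by (metis less_irrefl)
    have at_a: "rescale N a L P k a = N / L ^ k * poly ((pderiv ^^ k) P) 0" for P k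
      by (simp add: rescale_def)
    have at_b: "rescale N a L P k b = N / L ^ k * poly ((pderiv ^^ k) P) 1" for P k
      using L unfolding rescale_def L_def by simp
    have d: "rescale N a L P 1 = deriv (rescale N a L P 0)" for P
      using deriv_chainD[OF rescale_chain[of L 1 N a P], of 0] L by (auto intro!: DERIV_imp_deriv[symmetric])
    have S0: "taylor m F a = rescale N a L S 0" "taylor m G a = rescale N a L T 0"
      using Sk[of 0] Tk[of 0] by auto
    define r where "r k = L ^ k / N * F k b - poly ((pderiv ^^ k) S) 1" for k
    define s where "s k = L ^ k / N * G k b - poly ((pderiv ^^ k) T) 1" for k
    have Fb: "F k b = N / L ^ k * (poly ((pderiv ^^ k) S) 1 + r k)" for k
      using L N by (simp add: r_def)
    have Gb: "G k b = N / L ^ k * (poly ((pderiv ^^ k) T) 1 + s k)" for k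
      using L N by (simp add: s_def)
    have Fa: "F k a = N / L ^ k * poly ((pderiv ^^ k) S) 0" if "k \<le> m" for k
      using fun_cong[OF Sk[OF that], of a] by (simp add: at_a)
    have Ga: "G k a = N / L ^ k * poly ((pderiv ^^ k) T) 0" if "k \<le> m" for k
      using fun_cong[OF Tk[OF that], of a] by (simp add: at_a)
    have bd: "\<bar>z\<bar> \<le> C0" if "k \<le> m" "\<bar>N / L ^ k * z\<bar> \<le> C0 * W * L ^ (m - k)" for z k
    proof -
      have "L ^ m = L ^ k * L ^ (m - k)" using that(1) by (simp flip: power_add)
      then have "C0 * W * L ^ (m - k) = C0 * (N / L ^ k)" using L by (simp add: N_def)
      moreover have "\<bar>N / L ^ k * z\<bar> = \<bar>z\<bar> * (N / L ^ k)" using N L by (simp add: abs_mult)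
      ultimately have "\<bar>z\<bar> * (N / L ^ k) \<le> C0 * (N / L ^ k)" using that(2) by simp
      then show ?thesis by (rule mult_right_le_imp_le) (use N L in simp)
    qed
    have rs: "\<bar>r k\<bar> \<le> C0 \<and> \<bar>s k\<bar> \<le> C0" if k: "k \<le> m" for k
    proof -
      have eF: "F k b - taylor (m - k) (\<lambda>l. F (k + l)) a b = N / L ^ k * r k"
        unfolding Sk[OF k, symmetric] at_b Fb by (simp add: algebra_simps)
      have eG: "G k b - taylor (m - k) (\<lambda>l. G (k + l)) a b = N / L ^ k * s k"
        unfolding Tk[OF k, symmetric] at_b Gb by (simp add: algebra_simps)
      have "\<bar>N / L ^ k * r k\<bar> \<le> C0 * W * L ^ (m - k)" "\<bar>N / L ^ k * s k\<bar> \<le> C0 * W * L ^ (m - k)"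
        unfolding eF[symmetric] eG[symmetric] unfolding L_def using F G k by blast+
      then show ?thesis using bd[OF k] by blast
    qed
    define I where "I = integral {a..b} (\<lambda>x. \<bar>deriv (taylor m F a) x\<bar> + \<bar>deriv (taylor m G a) x\<bar>)"
    have I: "I \<le> N * (pnorm (pderiv S) + pnorm (pderiv T))"
    proof -
      have b1: "\<bar>rescale N a L P 1 x\<bar> \<le> N / L * pnorm (pderiv P)" if "x \<in> {a..b}" for P x
      proof -
        have "\<bar>(x - a) / L\<bar> \<le> 1" using that L by (auto simp: L_def)
        then show ?thesis unfolding rescale_def using N L abs_poly_le_pnorm[of "(x - a) / L" "pderiv P"]
          by (simp add: abs_mult divide_right_mono mult_left_mono)
      qed
      have cont: "continuous_on {a..b} (rescale N a L P 1)" for P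
        by (rule deriv_chain_continuous[OF rescale_chain[of L 2]]) (use L in auto)
      have "\<bar>I\<bar> \<le> integral {a..b} (\<lambda>x. N / L * pnorm (pderiv S) + N / L * pnorm (pderiv T))"
        unfolding I_def S0 d[symmetric]
      proof (rule integral_abs_le_real)
        fix x assume x: "x \<in> {a..b}"
        show "\<bar>\<bar>rescale N a L S 1 x\<bar> + \<bar>rescale N a L T 1 x\<bar>\<bar>
            \<le> N / L * pnorm (pderiv S) + N / L * pnorm (pderiv T)"
          using b1[OF x, of S] b1[OF x, of T] by linarith
      qed (intro continuous_on_add continuous_on_rabs cont continuous_on_const)+
      also have "\<dots> = L * (N / L * pnorm (pderiv S) + N / L * pnorm (pderiv T))"
        using ab by (simp add: L_def)
      also have "\<dots> = N * (pnorm (pderiv S) + pnorm (pderiv T))"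
        using L by (simp add: distrib_left)
      finally show ?thesis by simp
    qed
    define \<tau>' where "\<tau>' = \<tau> / N\<^sup>2"
    have \<tau>: "\<tau> = N\<^sup>2 * \<tau>'" using N by (simp add: \<tau>'_def)
    have "\<bar>N\<^sup>2 * (\<tau>' - 2 * poly_area S T + 2 * poly S 0 * s 0 - 2 * poly T 0 * r 0)\<bar>
       \<le> C0 * (N\<^sup>2 + N * I)"
    proof -
      have "area a b (taylor m F a) (deriv (taylor m F a)) (taylor m G a) (deriv (taylor m G a)) = N\<^sup>2 * poly_area S T"
        unfolding S0 d[symmetric] unfolding L_def by (rule area_rescale[OF ab])
      moreover have "F 0 a = N * poly S 0" "G 0 a = N * poly T 0" using Fa[of 0] Ga[of 0] by auto
      moreover have "G 0 b - taylor m G a b = N * s 0" "F 0 b - taylor m F a b = N * r 0"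
        unfolding S0 at_b Fb Gb by (simp_all add: algebra_simps)
      moreover have "W\<^sup>2 * (b - a) ^ (2 * m) = N\<^sup>2" "W * (b - a) ^ m = N"
        by (simp_all add: N_def L_def power_mult_distrib power_mult[symmetric] mult.commute)
      ultimately show ?thesis using A unfolding \<tau> I_def[symmetric]
        by (simp add: algebra_simps power2_eq_square)
    qed
    also have "C0 * (N\<^sup>2 + N * I) \<le> C0 * (N\<^sup>2 + N * (N * (pnorm (pderiv S) + pnorm (pderiv T))))"
      using I N C0 by (intro mult_left_mono add_left_mono) auto
    also have "\<dots> = N\<^sup>2 * (C0 * (1 + pnorm (pderiv S) + pnorm (pderiv T)))"
      by (simp add: power2_eq_square algebra_simps)
    finally have "\<bar>\<tau>' - 2 * poly_area S T + 2 * poly S 0 * s 0 - 2 * poly T 0 * r 0\<bar>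
       \<le> C0 * (1 + pnorm (pderiv S) + pnorm (pderiv T))"
      using N unfolding abs_mult by simp
    from C1[of S T r s \<tau>', OF S T rs this] obtain P Q where
       PQ: "\<And>k. k \<le> m \<Longrightarrow> poly ((pderiv ^^ k) P) 0 = poly ((pderiv ^^ k) S) 0 \<and>
              poly ((pderiv ^^ k) P) 1 = poly ((pderiv ^^ k) S) 1 + r k \<and>
              poly ((pderiv ^^ k) Q) 0 = poly ((pderiv ^^ k) T) 0 \<and>
              poly ((pderiv ^^ k) Q) 1 = poly ((pderiv ^^ k) T) 1 + s k"
       and ar: "2 * poly_area P Q = \<tau>'"
       and top: "\<And>t. t \<in> {0..1} \<Longrightarrow> \<bar>poly ((pderiv ^^ Suc m) P) t\<bar> \<le> C1 \<and> \<bar>poly ((pderiv ^^ Suc m) Q) t\<bar> \<le> C1"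
      by blast
    have L0: "L \<noteq> 0" using L by simp
    have up: "\<bar>rescale N a L P (Suc m) x\<bar> \<le> C1 * W / (b - a)"
      if "x \<in> {a..b}" "\<And>t. t \<in> {0..1} \<Longrightarrow> \<bar>poly ((pderiv ^^ Suc m) P) t\<bar> \<le> C1" for x P
    proof -
      have "(x - a) / L \<in> {0..1}" using that(1) L by (auto simp: L_def)
      then have le: "\<bar>poly ((pderiv ^^ Suc m) P) ((x - a) / L)\<bar> \<le> C1" by (rule that(2))
      have eq: "N / L ^ Suc m = W / L" using L by (simp add: N_def)
      have "\<bar>rescale N a L P (Suc m) x\<bar> = W / L * \<bar>poly ((pderiv ^^ Suc m) P) ((x - a) / L)\<bar>"
        unfolding rescale_def abs_mult eq using W L by simp
      also have "\<dots> \<le> W / L * C1" using le W L by (intro mult_left_mono) auto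
      finally show ?thesis by (simp add: L_def mult.commute)
    qed
    show "\<exists>f g. deriv_chain (Suc m) f \<and> deriv_chain (Suc m) g \<and>
       (\<forall>k\<le>m. f k a = F k a \<and> f k b = F k b \<and> g k a = G k a \<and> g k b = G k b) \<and>
       2 * area a b (f 0) (f 1) (g 0) (g 1) = \<tau> \<and>
       (\<forall>x\<in>{a..b}. \<bar>f (Suc m) x\<bar> \<le> C1 * W / (b - a) \<and> \<bar>g (Suc m) x\<bar> \<le> C1 * W / (b - a))"
    proof (intro exI conjI allI impI ballI)
      show "deriv_chain (Suc m) (rescale N a L P)" "deriv_chain (Suc m) (rescale N a L Q)"
        by (rule rescale_chain[OF L0])+
      show "2 * area a b (rescale N a L P 0) (rescale N a L P 1) (rescale N a L Q 0) (rescale N a L Q 1) = \<tau>"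
        using area_rescale[OF ab, of N P Q] ar unfolding \<tau> L_def by simp
    next
      fix k assume k: "k \<le> m"
      show "rescale N a L P k a = F k a" "rescale N a L Q k a = G k a"
        unfolding at_a using Fa[OF k] Ga[OF k] PQ[OF k] by simp_all
      show "rescale N a L P k b = F k b" "rescale N a L Q k b = G k b"
        unfolding at_b Fb Gb using PQ[OF k] by simp_all
    next
      fix x assume x: "x \<in> {a..b}"
      show "\<bar>rescale N a L P (Suc m) x\<bar> \<le> C1 * W / (b - a)" "\<bar>rescale N a L Q (Suc m) x\<bar> \<le> C1 * W / (b - a)"
        using up[OF x, of P] up[OF x, of Q] top by auto
    qed
  qed
qed

section \<open>Gluing along a compact set\<close>

definition gap :: "real set \<Rightarrow> real \<Rightarrow> real \<Rightarrow> bool" where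
  "gap K c d \<longleftrightarrow> c \<in> K \<and> d \<in> K \<and> c < d \<and> {c<..<d} \<inter> K = {}"

lemma gap_exists:
  assumes "compact K" "x \<notin> K" "a \<in> K" "b \<in> K" "a < x" "x < b"
  shows "\<exists>c d. gap K c d \<and> c < x \<and> x < d \<and> a \<le> c \<and> d \<le> b"
proof -
  have "compact (K \<inter> {..x})" "K \<inter> {..x} \<noteq> {}" using assms by (auto intro: compact_Int_closed)
  then obtain c where c: "c \<in> K" "c \<le> x" "\<And>y. y \<in> K \<Longrightarrow> y \<le> x \<Longrightarrow> y \<le> c"
    using compact_attains_sup[of "K \<inter> {..x}"] by auto
  have "compact (K \<inter> {x..})" "K \<inter> {x..} \<noteq> {}" using assms by (auto intro: compact_Int_closed)
  then obtain d where d: "d \<in> K" "x \<le> d" "\<And>y. y \<in> K \<Longrightarrow> x \<le> y \<Longrightarrow> d \<le> y"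
    using compact_attains_inf[of "K \<inter> {x..}"] by auto
  have "c \<noteq> x" "d \<noteq> x" using c d assms(2) by auto
  then have "c < x" "x < d" using c d by auto
  moreover have "gap K c d" unfolding gap_def
    using c d calculation by (auto simp: disjoint_iff) (meson linear not_less)
  ultimately show ?thesis using c(3)[OF assms(3)] d(3)[OF assms(4)] assms(5,6) by auto
qed

lemma gap_unique:
  assumes "gap K c d" "gap K c' d'" "x \<in> {c<..<d}" "x \<in> {c'<..<d'}"
  shows "c = c' \<and> d = d'"
  using assms unfolding gap_def disjoint_iff by (metis greaterThanLessThan_iff less_trans linorder_neqE_linordered_idom)

lemma gap_endpoint:
  assumes "gap K c d" "a \<in> K"
  shows "a \<le> c \<or> d \<le> a"
  using assms by (force simp: gap_def disjoint_iff)

lemma taylor_cong: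
  "(\<And>l. l \<le> n \<Longrightarrow> F l a = G l a) \<Longrightarrow> taylor n F a x = taylor n G a x"
  by (simp add: taylor_def)

lemma abs_taylor_le:
  assumes "\<And>l. l \<le> n \<Longrightarrow> \<bar>F l a\<bar> \<le> B l"
  shows "\<bar>taylor n F a x\<bar> \<le> (\<Sum>l\<le>n. B l * \<bar>x - a\<bar> ^ l)"
  unfolding taylor_def
proof (rule order_trans[OF sum_abs sum_mono])
  fix l assume "l \<in> {..n}"
  then have "\<bar>F l a\<bar> \<le> B l" using assms by simp
  moreover have "\<bar>F l a\<bar> / fact l \<le> \<bar>F l a\<bar> / 1" by (intro divide_left_mono) (auto simp: fact_ge_1)
  ultimately have "\<bar>F l a\<bar> / fact l \<le> B l" by simp
  then have "\<bar>F l a\<bar> / fact l * \<bar>x - a\<bar> ^ l \<le> B l * \<bar>x - a\<bar> ^ l"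
    by (rule mult_right_mono) simp
  then show "\<bar>F l a / fact l * (x - a) ^ l\<bar> \<le> B l * \<bar>x - a\<bar> ^ l"
    by (simp add: abs_mult power_abs)
qed

definition whitney_bound :: "nat \<Rightarrow> (real \<Rightarrow> real) \<Rightarrow> real set \<Rightarrow> real \<Rightarrow> (nat \<Rightarrow> real \<Rightarrow> real) \<Rightarrow> bool" where
  "whitney_bound m w K C F \<longleftrightarrow> (\<forall>k\<le>m. \<forall>a\<in>K. \<forall>b\<in>K.
     \<bar>F k b - taylor (m - k) (\<lambda>l. F (k + l)) a b\<bar> \<le> C * w \<bar>b - a\<bar> * \<bar>b - a\<bar> ^ (m - k))"

context modulus
begin

lemma abs_lim: "((\<lambda>h. w \<bar>h\<bar>) \<longlongrightarrow> 0) (at 0)"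
proof -
  have "filterlim (\<lambda>h::real. \<bar>h\<bar>) (at_right 0) (at 0)"
    unfolding filterlim_at by (auto intro!: tendsto_eq_intros simp: eventually_at_filter)
  from filterlim_compose[OF lim this] show ?thesis .
qed

text \<open>The hypothesis at \<open>x = a\<close> forces \<open>R a = 0\<close>, and
\<open>w\<close> tends to \<open>0\<close>.\<close>

lemma deriv_zero_bound:
  assumes "\<And>x. \<bar>x - a\<bar> \<le> 1 \<Longrightarrow> \<bar>R x\<bar> \<le> C * w \<bar>x - a\<bar> * \<bar>x - a\<bar>"
  shows "(R has_real_derivative 0) (at a)"
proof -
  have Ra: "R a = 0" using assms[of a] by simp
  have "((\<lambda>h. (R (a + h) - R a) / h) \<longlongrightarrow> 0) (at 0)"
  proof (rule Lim_null_comparison)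
    show "((\<lambda>h. \<bar>C\<bar> * w \<bar>h\<bar>) \<longlongrightarrow> 0) (at 0)"
      by (rule tendsto_mult_right_zero[OF abs_lim])
    have "\<forall>\<^sub>F h in at (0::real). h \<noteq> 0 \<and> \<bar>h\<bar> < 1"
      unfolding eventually_at by (intro exI[of _ 1]) (auto simp: dist_real_def)
    then show "\<forall>\<^sub>F h in at 0. norm ((R (a + h) - R a) / h) \<le> \<bar>C\<bar> * w \<bar>h\<bar>"
    proof eventually_elim
      case (elim h)
      have "\<bar>R (a + h)\<bar> \<le> C * w \<bar>h\<bar> * \<bar>h\<bar>" using assms[of "a + h"] elim by simp
      also have "\<dots> \<le> \<bar>C\<bar> * w \<bar>h\<bar> * \<bar>h\<bar>" by (intro mult_right_mono) auto
      finally show ?case using elim Ra by (simp add: abs_divide divide_le_eq)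
    qed
  qed
  then show ?thesis by (simp add: DERIV_def)
qed

text \<open>Concavity gives \<open>|x - y| w(d - c) / (d - c) \<le> w |x - y|\<close>. Thus a
derivative of size \<open>w(d - c) / (d - c)\<close> on an interval of length \<open>d - c\<close>
is compatible with the modulus at all smaller scales.\<close>

lemma mean_value_modulus:
  assumes "\<And>x. (f has_real_derivative f' x) (at x)" "c < d" "0 \<le> C"
    and "\<And>x. x \<in> {c..d} \<Longrightarrow> \<bar>f' x\<bar> \<le> C * w (d - c) / (d - c)"
    and "x \<in> {c..d}" "y \<in> {c..d}"
  shows "\<bar>f x - f y\<bar> \<le> C * w \<bar>x - y\<bar>"
proof -
  have "norm (f x - f y) \<le> C * w (d - c) / (d - c) * norm (x - y)"
    by (rule field_differentiable_bound[of "{c..d}" f f'])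
      (use assms in \<open>auto intro: has_field_derivative_at_within\<close>)
  also have "\<dots> = C * (\<bar>x - y\<bar> * w (d - c)) / (d - c)" by simp
  also have "\<dots> \<le> C * ((d - c) * w \<bar>x - y\<bar>) / (d - c)"
    using assms by (intro divide_right_mono mult_left_mono star) auto
  finally show ?thesis using assms(2) by simp
qed

end

text \<open>A Whitney field \<open>F\<close> on \<open>K\<close> and, for each gap of
\<open>K\<close>, a function \<open>p c d\<close> that matches the jets at both ends. The zero
jets at the extreme points \<open>lo\<close> and \<open>hi\<close> allow to continue by
\<open>0\<close> outside.\<close>

locale whitney_gluing = modulus w for w +
  fixes m :: nat and K :: "real set" and F :: "nat \<Rightarrow> real \<Rightarrow> real"
    and p :: "real \<Rightarrow> real \<Rightarrow> nat \<Rightarrow> real \<Rightarrow> real" and C C1 lo hi :: real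
  assumes K: "compact K" and C: "0 \<le> C" and C1: "0 \<le> C1"
    and F: "whitney_bound m w K C F"
    and lohi: "lo \<in> K" "hi \<in> K" "K \<subseteq> {lo..hi}" "\<And>k. k \<le> m \<Longrightarrow> F k lo = 0" "\<And>k. k \<le> m \<Longrightarrow> F k hi = 0"
    and p_chain: "\<And>c d. gap K c d \<Longrightarrow> deriv_chain (Suc m) (p c d)"
    and p_left: "\<And>c d k. gap K c d \<Longrightarrow> k \<le> m \<Longrightarrow> p c d k c = F k c"
    and p_right: "\<And>c d k. gap K c d \<Longrightarrow> k \<le> m \<Longrightarrow> p c d k d = F k d"
    and p_top: "\<And>c d x. gap K c d \<Longrightarrow> x \<in> {c..d} \<Longrightarrow> \<bar>p c d (Suc m) x\<bar> \<le> C1 * w (d - c) / (d - c)"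
begin

text \<open>At most one gap contains a given point, so the choice is immaterial.\<close>

definition D :: "nat \<Rightarrow> real \<Rightarrow> real" where
  "D k x = (if x \<in> K then F k x
     else if \<exists>c d. gap K c d \<and> x \<in> {c<..<d}
       then (case SOME (c, d). gap K c d \<and> x \<in> {c<..<d} of (c, d) \<Rightarrow> p c d k x)
     else 0)"

lemma D_K: "x \<in> K \<Longrightarrow> D k x = F k x"
  by (simp add: D_def)

lemma D_open_gap:
  assumes "gap K c d" "x \<in> {c<..<d}"
  shows "D k x = p c d k x"
proof -
  have "x \<notin> K" using assms by (auto simp: gap_def)
  have u: "cd = (c, d)" if "case cd of (c, d) \<Rightarrow> gap K c d \<and> x \<in> {c<..<d}" for cd
    using that gap_unique[OF assms(1) _ assms(2)] by (cases cd) auto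
  have "(SOME (c, d). gap K c d \<and> x \<in> {c<..<d}) = (c, d)"
    by (rule some_equality) (use assms u in auto)
  then show ?thesis using \<open>x \<notin> K\<close> assms by (auto simp: D_def)
qed

lemma D_gap:
  assumes "gap K c d" "x \<in> {c..d}" "k \<le> m"
  shows "D k x = p c d k x"
proof -
  consider "x = c" | "x = d" | "x \<in> {c<..<d}" using assms(2) by force
  then show ?thesis
    using assms(1,3) D_open_gap D_K p_left p_right by cases (auto simp: gap_def)
qed

lemma D_outside:
  assumes "x < lo \<or> hi < x"
  shows "D k x = 0"
proof -
  have "x \<notin> K" using assms lohi(3) by auto
  moreover have "\<not> (\<exists>c d. gap K c d \<and> x \<in> {c<..<d})"
    using assms lohi(3) by (force simp: gap_def)
  ultimately show ?thesis by (auto simp: D_def)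
qed

lemma p_modulus:
  assumes "gap K c d" "x \<in> {c..d}" "y \<in> {c..d}"
  shows "\<bar>p c d m x - p c d m y\<bar> \<le> C1 * w \<bar>x - y\<bar>"
  by (rule mean_value_modulus[of _ "p c d (Suc m)" c d])
    (use assms C1 p_top[OF assms(1)] deriv_chainD[OF p_chain[OF assms(1)], of m] in \<open>auto simp: gap_def\<close>)

text \<open>The top derivative of \<open>p c d\<close> obeys the modulus on the gap, so Taylor's
theorem yields the estimate of a Whitney field between an endpoint and any point of the
gap.\<close>

lemma p_remainder:
  assumes g: "gap K c d" and x: "x \<in> {c..d}" and e: "e = c \<or> e = d" and k: "k \<le> m"
  shows "\<bar>p c d k x - taylor (m - k) (\<lambda>l. F (k + l)) e x\<bar> \<le> C1 * w \<bar>x - e\<bar> * \<bar>x - e\<bar> ^ (m - k)"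
proof -
  have cd: "c < d" using g by (simp add: gap_def)
  have "deriv_chain m (p c d)" using p_chain[OF g] by (simp add: deriv_chain_def)
  then have "\<bar>p c d k x - taylor (m - k) (\<lambda>l. p c d (k + l)) e x\<bar> \<le> C1 * w \<bar>x - e\<bar> * \<bar>x - e\<bar> ^ (m - k)"
  proof (rule taylor_remainder[OF _ _ k])
    fix \<xi> assume \<xi>: "\<xi> \<in> closed_segment e x"
    then have "\<xi> \<in> {c..d}" "\<bar>\<xi> - e\<bar> \<le> \<bar>x - e\<bar>" using x e cd
      by (auto simp: closed_segment_eq_real_ivl split: if_splits)
    moreover have "e \<in> {c..d}" using e cd by auto
    ultimately have "\<bar>p c d m \<xi> - p c d m e\<bar> \<le> C1 * w \<bar>\<xi> - e\<bar>" by (intro p_modulus[OF g])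
    also have "\<dots> \<le> C1 * w \<bar>x - e\<bar>" using C1 \<open>\<bar>\<xi> - e\<bar> \<le> \<bar>x - e\<bar>\<close> by (intro mult_left_mono mono) auto
    finally show "\<bar>p c d m \<xi> - p c d m e\<bar> \<le> C1 * w \<bar>x - e\<bar>" .
  qed
  moreover have "taylor (m - k) (\<lambda>l. p c d (k + l)) e x = taylor (m - k) (\<lambda>l. F (k + l)) e x"
    using p_left[OF g] p_right[OF g] e k by (intro taylor_cong) auto
  ultimately show ?thesis by simp
qed

text \<open>Re-expanded at \<open>c\<close>, the difference of the two Taylor polynomials has the
Whitney errors \<open>F (k + l) c - taylor (m - k - l) _ a c\<close> as coefficients.\<close>

lemma taylor_centre_change:
  assumes a: "a \<in> K" and c: "c \<in> K" and k: "k \<le> m" and "\<bar>c - a\<bar> \<le> \<bar>x - a\<bar>" "\<bar>x - c\<bar> \<le> \<bar>x - a\<bar>"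
  shows "\<bar>taylor (m - k) (\<lambda>l. F (k + l)) c x - taylor (m - k) (\<lambda>l. F (k + l)) a x\<bar>
     \<le> real (Suc m) * C * w \<bar>x - a\<bar> * \<bar>x - a\<bar> ^ (m - k)"
proof -
  let ?B = "C * w \<bar>x - a\<bar> * \<bar>x - a\<bar> ^ (m - k)"
  have "taylor (m - k) (\<lambda>l. F (k + l)) c x - taylor (m - k) (\<lambda>l. F (k + l)) a x =
     taylor (m - k) (\<lambda>l y. F (k + l) y - taylor (m - k - l) (\<lambda>j. F (k + (l + j))) a y) c x"
    by (subst taylor_recentre[of "m - k" _ a x c]) (rule taylor_diff)
  also have "\<bar>\<dots>\<bar> \<le> (\<Sum>l\<le>m - k. (C * w \<bar>c - a\<bar> * \<bar>c - a\<bar> ^ (m - k - l)) * \<bar>x - c\<bar> ^ l)"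
  proof (rule abs_taylor_le)
    fix l assume "l \<le> m - k"
    then have "k + l \<le> m" using k by simp
    then show "\<bar>F (k + l) c - taylor (m - k - l) (\<lambda>j. F (k + (l + j))) a c\<bar>
       \<le> C * w \<bar>c - a\<bar> * \<bar>c - a\<bar> ^ (m - k - l)"
      using F a c unfolding whitney_bound_def by (auto simp: add.assoc)
  qed
  also have "\<dots> \<le> (\<Sum>l\<le>m - k. ?B)"
  proof (rule sum_mono)
    fix l assume "l \<in> {..m - k}"
    then have "m - k = (m - k - l) + l" by simp
    then have e: "\<bar>x - a\<bar> ^ (m - k) = \<bar>x - a\<bar> ^ (m - k - l) * \<bar>x - a\<bar> ^ l"
      by (metis power_add)
    show "(C * w \<bar>c - a\<bar> * \<bar>c - a\<bar> ^ (m - k - l)) * \<bar>x - c\<bar> ^ l \<le> ?B"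
      unfolding e mult.assoc[symmetric]
      using assms C by (intro mult_mono power_mono mono) auto
  qed
  also have "\<dots> = real (Suc (m - k)) * ?B" by simp
  also have "\<dots> \<le> real (Suc m) * ?B"
    using C by (intro mult_right_mono) auto
  finally show ?thesis by (simp add: mult.assoc)
qed

definition C3 :: real where "C3 = C1 + real (Suc m) * C"

lemma C3_nonneg: "0 \<le> C3" using C C1 by (simp add: C3_def)

text \<open>Let \<open>c\<close> be the last point of \<open>K\<close> on the way from
\<open>a\<close> to \<open>x\<close>: \<open>x\<close> itself, an endpoint of the gap of
\<open>x\<close>, or \<open>lo\<close> or \<open>hi\<close>. The estimate holds between
\<open>c\<close> and \<open>x\<close>, and changing the centre from \<open>c\<close> to
\<open>a\<close> costs an error of the same size.\<close>

lemma D_remainder: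
  assumes a: "a \<in> K" and k: "k \<le> m"
  shows "\<bar>D k x - taylor (m - k) (\<lambda>l. F (k + l)) a x\<bar> \<le> C3 * w \<bar>x - a\<bar> * \<bar>x - a\<bar> ^ (m - k)"
proof -
  have key: ?thesis
    if c: "c \<in> K" "\<bar>c - a\<bar> \<le> \<bar>x - a\<bar>" "\<bar>x - c\<bar> \<le> \<bar>x - a\<bar>"
      and b: "\<bar>D k x - taylor (m - k) (\<lambda>l. F (k + l)) c x\<bar> \<le> C1 * w \<bar>x - c\<bar> * \<bar>x - c\<bar> ^ (m - k)" for c
  proof -
    have "C1 * w \<bar>x - c\<bar> * \<bar>x - c\<bar> ^ (m - k) \<le> C1 * w \<bar>x - a\<bar> * \<bar>x - a\<bar> ^ (m - k)"
      using c C1 by (intro mult_mono power_mono mono) auto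
    then show ?thesis
      using taylor_centre_change[OF a c(1) k c(2,3)] b unfolding C3_def distrib_right by linarith
  qed
  consider "x \<in> K" | "x \<notin> K" "lo < x" "x < hi" | "x < lo" | "hi < x"
    using lohi(1,2) by force
  then show ?thesis
  proof cases
    case 1
    have "C1 * w \<bar>x - x\<bar> * \<bar>x - x\<bar> ^ (m - k) = 0" by simp
    then show ?thesis by (intro key[of x]) (use 1 D_K in auto)
  next
    case 2
    obtain c d where cd: "gap K c d" "c < x" "x < d"
      using gap_exists[OF K 2(1) lohi(1,2) 2(2,3)] by blast
    have r: "\<bar>D k x - taylor (m - k) (\<lambda>l. F (k + l)) e x\<bar> \<le> C1 * w \<bar>x - e\<bar> * \<bar>x - e\<bar> ^ (m - k)"
      if "e = c \<or> e = d" for e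
      using p_remainder[OF cd(1) _ that k, of x] D_gap[OF cd(1) _ k, of x] cd by simp
    \<comment> \<open>The endpoint on the side of \<open>a\<close> serves as intermediate centre.\<close>
    from gap_endpoint[OF cd(1) a] show ?thesis
    proof
      assume "a \<le> c" then show ?thesis using cd by (intro key[of c] r) (auto simp: gap_def)
    next
      assume "d \<le> a" then show ?thesis using cd by (intro key[of d] r) (auto simp: gap_def)
    qed
  next
    case 3
    then have "lo \<le> a" "D k x = 0" "taylor (m - k) (\<lambda>l. F (k + l)) lo x = 0"
      using a lohi D_outside k by (auto simp: taylor_def)
    then show ?thesis using 3 C1 lohi(1) by (intro key[of lo]) (auto intro!: mult_nonneg_nonneg nonneg)
  next
    case 4
    then have "a \<le> hi" "D k x = 0" "taylor (m - k) (\<lambda>l. F (k + l)) hi x = 0"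
      using a lohi D_outside k by (auto simp: taylor_def)
    then show ?thesis using 4 C1 lohi(2) by (intro key[of hi]) (auto intro!: mult_nonneg_nonneg nonneg)
  qed
qed

lemma D_deriv_K:
  assumes a: "a \<in> K" and k: "k < m"
  shows "(D k has_real_derivative D (Suc k) a) (at a)"
proof -
  let ?T = "taylor (m - k) (\<lambda>l. F (k + l)) a"
  have "((\<lambda>x. D k x - ?T x) has_real_derivative 0) (at a)"
  proof (rule deriv_zero_bound)
    fix x assume x: "\<bar>x - a\<bar> \<le> 1"
    have "\<bar>x - a\<bar> ^ (m - k) \<le> \<bar>x - a\<bar> ^ 1" using k x by (intro power_decreasing) auto
    then have "C3 * w \<bar>x - a\<bar> * \<bar>x - a\<bar> ^ (m - k) \<le> C3 * w \<bar>x - a\<bar> * \<bar>x - a\<bar>"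
      using C3_nonneg by (intro mult_left_mono) auto
    then show "\<bar>D k x - ?T x\<bar> \<le> C3 * w \<bar>x - a\<bar> * \<bar>x - a\<bar>"
      using D_remainder[OF a, of k x] k by simp
  qed
  moreover have "(?T has_real_derivative F (Suc k) a) (at a)"
    using deriv_taylor(2)[of "m - k" "\<lambda>l. F (k + l)" a a] k by simp
  ultimately have "((\<lambda>x. (D k x - ?T x) + ?T x) has_real_derivative 0 + F (Suc k) a) (at a)"
    by (rule DERIV_add)
  then show ?thesis using D_K[OF a] by simp
qed

lemma D_chain: "deriv_chain m D"
  unfolding deriv_chain_def
proof (intro allI impI)
  fix k x assume k: "k < m"
  consider "x \<in> K" | "x \<notin> K" "lo < x" "x < hi" | "x < lo" | "hi < x"
    using lohi(1,2) by force
  then show "(D k has_real_derivative D (Suc k) x) (at x)"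
  proof cases
    case 1 then show ?thesis using D_deriv_K k by blast
  next
    case 2
    obtain c d where cd: "gap K c d" "c < x" "x < d"
      using gap_exists[OF K 2(1) lohi(1,2) 2(2,3)] by blast
    have "(p c d k has_real_derivative D (Suc k) x) (at x)"
      using deriv_chainD[OF p_chain[OF cd(1)], of k x] D_open_gap[OF cd(1), of x] cd k by simp
    then show ?thesis
      by (rule has_field_derivative_transform_within_open[of _ _ _ "{c<..<d}"])
        (use cd D_open_gap in auto)
  next
    case 3
    have "((\<lambda>_. 0) has_real_derivative D (Suc k) x) (at x)" using D_outside[of x] 3 by simp
    then show ?thesis
      by (rule has_field_derivative_transform_within_open[of _ _ _ "{..<lo}"])
        (use 3 D_outside in auto)
  next
    case 4
    have "((\<lambda>_. 0) has_real_derivative D (Suc k) x) (at x)" using D_outside[of x] 4 by simp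
    then show ?thesis
      by (rule has_field_derivative_transform_within_open[of _ _ _ "{hi<..}"])
        (use 4 D_outside in auto)
  qed
qed

text \<open>If a point of \<open>K\<close> separates \<open>x\<close> and \<open>y\<close>, both
are compared with it; otherwise \<open>x\<close> and \<open>y\<close> lie in one gap or on one
side of \<open>K\<close>.\<close>

lemma D_modulus: "\<bar>D m x - D m y\<bar> \<le> 2 * C3 * w \<bar>x - y\<bar>"
proof -
  have main: "\<bar>D m x - D m y\<bar> \<le> 2 * C3 * w \<bar>x - y\<bar>" if xy: "x < y" for x y
  proof (cases "\<exists>a\<in>K. a \<in> {x..y}")
    case True
    then obtain a where a: "a \<in> K" "x \<le> a" "a \<le> y" by auto
    have "\<bar>D m z - F m a\<bar> \<le> C3 * w \<bar>x - y\<bar>" if "z = x \<or> z = y" for z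
    proof -
      have "\<bar>D m z - F m a\<bar> \<le> C3 * w \<bar>z - a\<bar>" using D_remainder[OF a(1), of m z] by simp
      also have "\<dots> \<le> C3 * w \<bar>x - y\<bar>" using C3_nonneg that a by (intro mult_left_mono mono) auto
      finally show ?thesis .
    qed
    from this[of x] this[of y] show ?thesis by (simp add: abs_le_iff algebra_simps)
  next
    case False
    consider "lo < x" "x < hi" | "x < lo" | "hi < x" using False lohi(1,2) xy by force
    then show ?thesis
    proof cases
      case 1
      have "x \<notin> K" using False xy by auto
      then obtain c d where cd: "gap K c d" "c < x" "x < d"
        using gap_exists[OF K _ lohi(1,2) 1] by blast
      have "y < d" using False cd by (auto simp: gap_def)
      then have "\<bar>D m x - D m y\<bar> \<le> C1 * w \<bar>x - y\<bar>"
        using p_modulus[OF cd(1), of x y] D_gap[OF cd(1), of _ m] cd xy by simp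
      also have "\<dots> \<le> 2 * C3 * w \<bar>x - y\<bar>"
        using C C1 by (intro mult_right_mono) (auto simp: C3_def)
      finally show ?thesis .
    next
      case 2
      then have "y < lo" using False lohi(1) by force
      then show ?thesis using 2 D_outside[of x] D_outside[of y] C3_nonneg by simp
    next
      case 3
      then show ?thesis using xy D_outside[of x] D_outside[of y] C3_nonneg by (simp add: nonneg)
    qed
  qed
  consider "x < y" | "x = y" | "y < x" by linarith
  then show ?thesis
  proof cases
    case 3 then show ?thesis using main[OF 3] by (simp add: abs_minus_commute)
  qed (use main in auto)
qed

end

section \<open>Necessity of the conditions\<close>

text \<open>The \<open>k\<close>-th derivative of \<open>2 (f' g - g' f)\<close>, hence the
derivative of order \<open>k + 1\<close> of the vertical coordinate. The formula also makes sense
for jets on \<open>K\<close>.\<close>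

definition contact :: "(nat \<Rightarrow> real \<Rightarrow> real) \<Rightarrow> (nat \<Rightarrow> real \<Rightarrow> real) \<Rightarrow> nat \<Rightarrow> real \<Rightarrow> real" where
  "contact f g k x = 2 * (\<Sum>i\<le>k. real (k choose i) * (f (Suc (k - i)) x * g i x - g (Suc (k - i)) x * f i x))"

lemma contact_0: "contact f g 0 x = 2 * (f 1 x * g 0 x - g 1 x * f 0 x)"
  by (simp add: contact_def)

lemma integral_contact: "integral {a..b} (contact f g 0) = 2 * area a b (f 0) (f 1) (g 0) (g 1)"
proof -
  have "contact f g 0 = (\<lambda>x. 2 * (f 1 x * g 0 x - g 1 x * f 0 x))" by (simp add: contact_0 fun_eq_iff)
  then show ?thesis unfolding area_def by (simp only: integral_mult_right)
qed

lemma deriv_chain_Suc: "deriv_chain m f \<Longrightarrow> deriv_chain (m - 1) (\<lambda>k. f (Suc k))"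
  by (simp add: deriv_chain_def less_diff_conv)

lemma deriv_chain_le: "deriv_chain m f \<Longrightarrow> n \<le> m \<Longrightarrow> deriv_chain n f"
  by (auto simp: deriv_chain_def)

lemma deriv_chain_diff:
  "deriv_chain n p \<Longrightarrow> deriv_chain n q \<Longrightarrow> deriv_chain n (\<lambda>k x. p k x - q k x)"
  by (simp add: deriv_chain_def DERIV_diff)

lemma deriv_chain_cmult: "deriv_chain n p \<Longrightarrow> deriv_chain n (\<lambda>k x. c * p k x)"
  by (simp add: deriv_chain_def DERIV_cmult)

lemma contact_chain:
  assumes "deriv_chain m f" "deriv_chain m g"
  shows "deriv_chain (m - 1) (contact f g)"
proof -
  have fg: "deriv_chain (m - 1) (\<lambda>k x. \<Sum>i\<le>k. real (k choose i) * (f (Suc (k - i)) x * g i x))"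
    if "deriv_chain m f" "deriv_chain m g" for f g
    by (rule leibniz_chain[of _ "\<lambda>k. f (Suc k)"]) (use that deriv_chain_Suc deriv_chain_le in auto)
  have "contact f g = (\<lambda>k x. 2 * ((\<Sum>i\<le>k. real (k choose i) * (f (Suc (k - i)) x * g i x))
      - (\<Sum>i\<le>k. real (k choose i) * (g (Suc (k - i)) x * f i x))))"
    by (simp add: contact_def fun_eq_iff sum_subtractf right_diff_distrib)
  then show ?thesis
    by (simp only: deriv_chain_cmult deriv_chain_diff fg[OF assms] fg[OF assms(2,1)])
qed

lemma contact_eq_sum:
  assumes "1 \<le> k"
  shows "2 * (\<Sum>i = 0..k - 1. real ((k - 1) choose i) * (F (k - i) x * G i x - G (k - i) x * F i x))
    = contact F G (k - 1) x"
proof -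
  have "Suc (k - 1 - i) = k - i" if "i \<le> k - 1" for i using that assms by simp
  then show ?thesis unfolding contact_def atLeast0AtMost by (intro arg_cong[of _ _ "(*) 2"] sum.cong) auto
qed

lemma contact_cong:
  assumes "\<And>i. i \<le> Suc k \<Longrightarrow> f i x = F i x" "\<And>i. i \<le> Suc k \<Longrightarrow> g i x = G i x"
  shows "contact f g k x = contact F G k x"
  unfolding contact_def using assms by (intro arg_cong[of _ _ "(*) 2"] sum.cong) auto

text \<open>The set where \<open>E\<close> does not vanish is open and a null set.\<close>

lemma continuous_AE_zero:
  fixes E :: "real \<Rightarrow> real"
  assumes "continuous_on UNIV E" "AE s in lborel. E s = 0"
  shows "E s = 0"
proof (rule ccontr)
  assume s: "E s \<noteq> 0"
  have op: "open {s. E s \<noteq> 0}"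
    by (intro open_Collect_neq assms(1) continuous_on_const)
  then obtain e where e: "e > 0" "ball s e \<subseteq> {s. E s \<noteq> 0}" using s unfolding open_contains_ball by blast
  have sub: "{s - e<..<s + e} \<subseteq> {s. E s \<noteq> 0}" using e(2) by (auto simp: ball_def dist_real_def subset_iff abs_less_iff)
  have "emeasure lborel {s. E s \<noteq> 0} = 0"
    using assms(2) op by (subst (asm) AE_iff_measurable[of "{s. E s \<noteq> 0}"]) auto
  moreover have "emeasure lborel {s - e<..<s + e} \<le> emeasure lborel {s. E s \<noteq> 0}"
    using sub op by (intro emeasure_mono) auto
  ultimately show False using e(1) by simp
qed

lemma C_m_continuous:
  assumes "C_m m \<phi>" "k \<le> m"
  shows "continuous_on S (iter_deriv k \<phi>)"
proof (cases "k = m")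
  case True
  then show ?thesis using assms by (auto simp: C_m_def intro: continuous_on_subset)
next
  case False
  then show ?thesis using deriv_chain_continuous[OF C_m_chain[OF assms(1)]] assms(2) by simp
qed

text \<open>Reading off the coefficients of \<open>X\<close> and \<open>Y\<close> from the first
two components gives the contact equation almost everywhere; both sides are continuous, as
\<open>m \<ge> 1\<close>.\<close>

lemma horizontal_contact:
  assumes m: "1 \<le> m" and \<Gamma>: "\<And>i. C_m m (\<lambda>s. \<Gamma> s $ i)" and hor: "horizontal \<Gamma>"
  shows "iter_deriv 1 (\<lambda>s. \<Gamma> s $ 3) s = contact (\<lambda>k. iter_deriv k (\<lambda>s. \<Gamma> s $ 1)) (\<lambda>k. iter_deriv k (\<lambda>s. \<Gamma> s $ 2)) 0 s"
proof -
  define f where "f i k = iter_deriv k (\<lambda>s. \<Gamma> s $ i)" for i k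
  have d: "(f i 0 has_real_derivative f i 1 s) (at s)" for i s
    using deriv_chainD[OF C_m_chain[OF \<Gamma>[of i]], of 0 s] m by (simp add: f_def)
  define E where "E s = f 3 1 s - 2 * (f 1 1 s * f 2 0 s - f 2 1 s * f 1 0 s)" for s
  have "AE s in lborel. \<exists>w. (\<Gamma> has_vector_derivative w) (at s) \<and> w \<in> span {heis_X (\<Gamma> s), heis_Y (\<Gamma> s)}"
    using hor by (simp add: horizontal_def)
  then have "AE s in lborel. E s = 0"
  proof eventually_elim
    case (elim s)
    then obtain v where v: "(\<Gamma> has_vector_derivative v) (at s)" "v \<in> span {heis_X (\<Gamma> s), heis_Y (\<Gamma> s)}"
      by blast
    have comp: "((\<lambda>s. \<Gamma> s $ i) has_vector_derivative v $ i) (at s)" for i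
      using bounded_linear.has_vector_derivative[OF bounded_linear_vec_nth v(1)] .
    have vi: "v $ i = f i 1 s" for i
      by (rule vector_derivative_unique_at[OF comp[of i]])
        (use d[of i s] in \<open>simp add: f_def has_real_derivative_iff_has_vector_derivative\<close>)
    from v(2) obtain a where "v - a *\<^sub>R heis_X (\<Gamma> s) \<in> span {heis_Y (\<Gamma> s)}"
      by (auto simp: span_breakdown_eq)
    then obtain b where "v - a *\<^sub>R heis_X (\<Gamma> s) = b *\<^sub>R heis_Y (\<Gamma> s)"
      by (auto simp: span_singleton)
    then have "v = a *\<^sub>R heis_X (\<Gamma> s) + b *\<^sub>R heis_Y (\<Gamma> s)" by (simp add: algebra_simps)
    then have "v $ 1 = a" "v $ 2 = b" "v $ 3 = a * (2 * \<Gamma> s $ 2) + b * (- 2 * \<Gamma> s $ 1)"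
      by (simp_all add: heis_X_def heis_Y_def)
    then show ?case using vi[of 1] vi[of 2] vi[of 3] by (simp add: E_def f_def)
  qed
  moreover have "continuous_on UNIV E"
    unfolding E_def f_def using m by (intro continuous_intros C_m_continuous[OF \<Gamma>]) auto
  ultimately have "E s = 0" by (intro continuous_AE_zero)
  then show ?thesis by (simp add: E_def f_def contact_0)
qed

lemma C_m_omega_modulus:
  assumes "modulus (modulus_real \<omega>)" "C_m_omega m \<omega> \<phi>"
  obtains C where "0 \<le> C" "\<And>a b. \<bar>iter_deriv m \<phi> b - iter_deriv m \<phi> a\<bar> \<le> C * modulus_real \<omega> \<bar>b - a\<bar>"
proof -
  interpret modulus "modulus_real \<omega>" by fact
  obtain M where M: "\<And>a b. a \<noteq> b \<Longrightarrow> \<bar>iter_deriv m \<phi> b - iter_deriv m \<phi> a\<bar> / modulus_real \<omega> \<bar>b - a\<bar> \<le> M"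
    using assms(2) unfolding C_m_omega_def bdd_above_def by blast
  have "\<bar>iter_deriv m \<phi> b - iter_deriv m \<phi> a\<bar> \<le> \<bar>M\<bar> * modulus_real \<omega> \<bar>b - a\<bar>" for a b
  proof (cases "a = b")
    case False
    then have p: "0 < modulus_real \<omega> \<bar>b - a\<bar>" by (intro pos) simp
    then have "\<bar>iter_deriv m \<phi> b - iter_deriv m \<phi> a\<bar> \<le> M * modulus_real \<omega> \<bar>b - a\<bar>"
      using M[OF False] by (simp add: divide_le_eq)
    also have "\<dots> \<le> \<bar>M\<bar> * modulus_real \<omega> \<bar>b - a\<bar>" by (intro mult_right_mono) auto
    finally show ?thesis .
  qed simp
  then show ?thesis using that[of "\<bar>M\<bar>"] by simp
qed

lemma (in modulus) chain_remainder:
  assumes f: "deriv_chain m f" and C: "0 \<le> C" "\<And>a b. \<bar>f m b - f m a\<bar> \<le> C * w \<bar>b - a\<bar>" and k: "k \<le> m"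
  shows "\<bar>f k b - taylor (m - k) (\<lambda>l. f (k + l)) a b\<bar> \<le> C * w \<bar>b - a\<bar> * \<bar>b - a\<bar> ^ (m - k)"
proof (rule taylor_remainder[OF f _ k])
  fix \<xi> assume "\<xi> \<in> closed_segment a b"
  then have "\<bar>\<xi> - a\<bar> \<le> \<bar>b - a\<bar>" by (auto simp: closed_segment_eq_real_ivl split: if_splits)
  then have "C * w \<bar>\<xi> - a\<bar> \<le> C * w \<bar>b - a\<bar>" using C(1) by (intro mult_left_mono mono) auto
  then show "\<bar>f m \<xi> - f m a\<bar> \<le> C * w \<bar>b - a\<bar>" using C(2)[of \<xi> a] by linarith
qed

lemma whitney_bound_chain:
  assumes "modulus w" "deriv_chain m f" "0 \<le> C" "\<And>a b. \<bar>f m b - f m a\<bar> \<le> C * w \<bar>b - a\<bar>"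
    and "\<And>k x. k \<le> m \<Longrightarrow> x \<in> K \<Longrightarrow> F k x = f k x"
  shows "whitney_bound m w K C F"
  unfolding whitney_bound_def
proof (intro allI impI ballI)
  fix k a b assume k: "k \<le> m" and a: "a \<in> K" and b: "b \<in> K"
  have "taylor (m - k) (\<lambda>l. F (k + l)) a b = taylor (m - k) (\<lambda>l. f (k + l)) a b"
    using assms(5) a k by (intro taylor_cong) auto
  then show "\<bar>F k b - taylor (m - k) (\<lambda>l. F (k + l)) a b\<bar> \<le> C * w \<bar>b - a\<bar> * \<bar>b - a\<bar> ^ (m - k)"
    using modulus.chain_remainder[OF assms(1-4) k, of b a] assms(5)[OF k b] by simp
qed

lemma whitney_field_iff:
  "whitney_field m \<omega> K F \<longleftrightarrow> (\<exists>C>0. whitney_bound m (modulus_real \<omega>) K C F)"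
  by (simp add: whitney_field_def whitney_bound_def)

lemma whitney_bound_mono:
  assumes "modulus w" "whitney_bound m w K C F" "C \<le> C'"
  shows "whitney_bound m w K C' F"
  unfolding whitney_bound_def
proof (intro allI impI ballI)
  interpret modulus w by fact
  fix k a b assume "k \<le> m" "a \<in> K" "b \<in> K"
  then have "\<bar>F k b - taylor (m - k) (\<lambda>l. F (k + l)) a b\<bar> \<le> C * w \<bar>b - a\<bar> * \<bar>b - a\<bar> ^ (m - k)"
    using assms(2) by (simp add: whitney_bound_def)
  also have "\<dots> \<le> C' * w \<bar>b - a\<bar> * \<bar>b - a\<bar> ^ (m - k)"
    using assms(3) by (intro mult_right_mono) auto
  finally show "\<bar>F k b - taylor (m - k) (\<lambda>l. F (k + l)) a b\<bar> \<le> C' * w \<bar>b - a\<bar> * \<bar>b - a\<bar> ^ (m - k)" .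
qed

lemma velocity_pos:
  assumes "modulus (modulus_real \<omega>)" "a < b"
  shows "0 < velocity m \<omega> F G a b"
proof -
  interpret modulus "modulus_real \<omega>" by fact
  have w: "0 < modulus_real \<omega> (b - a)" using assms(2) by (intro pos) simp
  have "0 \<le> integral {a..b} (\<lambda>s. \<bar>deriv (taylor m F a) s\<bar> + \<bar>deriv (taylor m G a) s\<bar>)"
    by (cases "(\<lambda>s. \<bar>deriv (taylor m F a) s\<bar> + \<bar>deriv (taylor m G a) s\<bar>) integrable_on {a..b}")
      (auto intro: Henstock_Kurzweil_Integration.integral_nonneg simp: not_integrable_integral)
  then show ?thesis unfolding velocity_def using w assms(2)
    by (intro add_pos_nonneg mult_pos_pos mult_nonneg_nonneg) auto
qed

lemma area_discrepancy_eq: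
  "area_discrepancy m F G H a b = H 0 b - H 0 a
     - 2 * area a b (taylor m F a) (deriv (taylor m F a)) (taylor m G a) (deriv (taylor m G a))
     + 2 * F 0 a * (G 0 b - taylor m G a b) - 2 * G 0 a * (F 0 b - taylor m F a b)"
  by (simp add: area_discrepancy_def area_def)

lemma cont_deriv_taylor:
  assumes "1 \<le> m"
  shows "cont_deriv (taylor m F a) (deriv (taylor m F a))"
  unfolding cont_deriv_def deriv_taylor(1)[OF assms]
  using deriv_taylor(2)[OF assms] continuous_on_taylor by blast

text \<open>This is \<open>area_estimate\<close> with the Taylor polynomials at \<open>a\<close>
as \<open>S\<close> and \<open>T\<close> and the Taylor remainders as perturbations.\<close>

lemma area_discrepancy_bound:
  assumes m: "1 \<le> m" and w: "modulus (modulus_real \<omega>)"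
    and f: "deriv_chain m f" "continuous_on UNIV (f 1)" and g: "deriv_chain m g" "continuous_on UNIV (g 1)"
    and C: "0 \<le> C" "\<And>a b. \<bar>f m b - f m a\<bar> \<le> C * modulus_real \<omega> \<bar>b - a\<bar>"
      "\<And>a b. \<bar>g m b - g m a\<bar> \<le> C * modulus_real \<omega> \<bar>b - a\<bar>"
    and FG: "\<And>k x. k \<le> m \<Longrightarrow> x \<in> K \<Longrightarrow> F k x = f k x" "\<And>k x. k \<le> m \<Longrightarrow> x \<in> K \<Longrightarrow> G k x = g k x"
    and H: "H 0 b - H 0 a = 2 * area a b (f 0) (f 1) (g 0) (g 1)"
    and ab: "a \<in> K" "b \<in> K" "a < b"
  shows "\<bar>area_discrepancy m F G H a b\<bar> \<le> (1 + 6 * C + 4 * C\<^sup>2) * velocity m \<omega> F G a b"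
proof -
  interpret modulus "modulus_real \<omega>" by fact
  define W where "W = modulus_real \<omega> (b - a)"
  define L where "L = b - a"
  have L: "0 < L" using ab by (simp add: L_def)
  have W: "0 < W" unfolding W_def using ab by (intro pos) simp
  have T: "taylor n (\<lambda>l. F (k + l)) a = taylor n (\<lambda>l. f (k + l)) a"
    "taylor n (\<lambda>l. G (k + l)) a = taylor n (\<lambda>l. g (k + l)) a" if "n + k \<le> m" for n k
    using FG ab(1) that by (auto intro!: ext taylor_cong)
  have C1f: "cont_deriv (f 0) (f 1)" "cont_deriv (g 0) (g 1)"
    unfolding cont_deriv_def using deriv_chainD[OF f(1), of 0] deriv_chainD[OF g(1), of 0] f(2) g(2) m by auto
  define e where "e x = f 0 x - taylor m F a x" for x
  define e' where "e' x = f 1 x - deriv (taylor m F a) x" for x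
  define d where "d x = g 0 x - taylor m G a x" for x
  define d' where "d' x = g 1 x - deriv (taylor m G a) x" for x
  have C1e: "cont_deriv e e'" "cont_deriv d d'"
    unfolding e_def[abs_def] e'_def[abs_def] d_def[abs_def] d'_def[abs_def]
    by (intro cont_deriv_diff C1f cont_deriv_taylor m)+
  have rem: "\<bar>f k x - taylor (m - k) (\<lambda>l. F (k + l)) a x\<bar> \<le> C * W * L ^ (m - k)"
     "\<bar>g k x - taylor (m - k) (\<lambda>l. G (k + l)) a x\<bar> \<le> C * W * L ^ (m - k)"
    if x: "x \<in> {a..b}" and k: "k \<le> m" for x k
  proof -
    have "C * modulus_real \<omega> \<bar>x - a\<bar> * \<bar>x - a\<bar> ^ (m - k) \<le> C * W * L ^ (m - k)"
      unfolding W_def L_def using x C(1) by (intro mult_mono power_mono mono mult_left_mono) (auto intro!: mult_nonneg_nonneg nonneg)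
    then show "\<bar>f k x - taylor (m - k) (\<lambda>l. F (k + l)) a x\<bar> \<le> C * W * L ^ (m - k)"
      "\<bar>g k x - taylor (m - k) (\<lambda>l. G (k + l)) a x\<bar> \<le> C * W * L ^ (m - k)"
      using chain_remainder[OF f(1) C(1,2) k, of x a] chain_remainder[OF g(1) C(1,3) k, of x a] T[of "m - k" k] k
      by auto
  qed
  have M1: "\<bar>e x\<bar> \<le> C * W * L ^ m" "\<bar>d x\<bar> \<le> C * W * L ^ m" if "x \<in> {a..b}" for x
    using rem[OF that, of 0] by (simp_all add: e_def d_def)
  have M2: "\<bar>e' x\<bar> \<le> C * W * L ^ (m - 1)" "\<bar>d' x\<bar> \<le> C * W * L ^ (m - 1)" if "x \<in> {a..b}" for x
    using rem[OF that m] by (simp_all add: e'_def d'_def deriv_taylor(1)[OF m])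
  have ea: "e a = 0" "d a = 0" using FG[of 0 a] ab by (simp_all add: e_def d_def)
  define I where "I = integral {a..b} (\<lambda>s. \<bar>deriv (taylor m F a) s\<bar> + \<bar>deriv (taylor m G a) s\<bar>)"
  have I: "0 \<le> I" unfolding I_def
    by (cases "(\<lambda>s. \<bar>deriv (taylor m F a) s\<bar> + \<bar>deriv (taylor m G a) s\<bar>) integrable_on {a..b}")
      (auto intro: Henstock_Kurzweil_Integration.integral_nonneg simp: not_integrable_integral)
  have "\<bar>2 * area a b (f 0) (f 1) (g 0) (g 1)
     - 2 * area a b (taylor m F a) (deriv (taylor m F a)) (taylor m G a) (deriv (taylor m G a))
     + 2 * taylor m F a a * d b - 2 * taylor m G a a * e b\<bar>
     \<le> 6 * (C * W * L ^ m) * I + 4 * (C * W * L ^ m) * (C * W * L ^ (m - 1)) * (b - a)"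
    using area_estimate[OF cont_deriv_taylor[OF m, of F a] cont_deriv_taylor[OF m, of G a] C1e less_imp_le[OF ab(3)] ea M1 M2]
    by (simp add: e_def d_def e'_def d'_def I_def)
  moreover have "e b = F 0 b - taylor m F a b" "d b = G 0 b - taylor m G a b"
    using FG ab by (simp_all add: e_def d_def)
  ultimately have "\<bar>area_discrepancy m F G H a b\<bar>
     \<le> 6 * (C * W * L ^ m) * I + 4 * (C * W * L ^ m) * (C * W * L ^ (m - 1)) * (b - a)"
    unfolding area_discrepancy_eq H by simp
  also have "\<dots> = 6 * C * (W * L ^ m * I) + 4 * C\<^sup>2 * (W\<^sup>2 * L ^ (2 * m))"
  proof -
    have "L ^ m * L ^ (m - 1) * L = L ^ (2 * m)"
      using m by (simp flip: power_add power_Suc2 add: mult.assoc) (simp add: mult_2)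
    then have "4 * (C * W * L ^ m) * (C * W * L ^ (m - 1)) * L = 4 * C\<^sup>2 * (W\<^sup>2 * L ^ (2 * m))"
      by (simp add: power2_eq_square mult_ac)
    then show ?thesis by (simp add: L_def)
  qed
  also have "\<dots> \<le> (1 + 6 * C + 4 * C\<^sup>2) * (W * L ^ m * I) + (1 + 6 * C + 4 * C\<^sup>2) * (W\<^sup>2 * L ^ (2 * m))"
    using C(1) W L I by (intro add_mono mult_right_mono mult_nonneg_nonneg) auto
  also have "\<dots> = (1 + 6 * C + 4 * C\<^sup>2) * velocity m \<omega> F G a b"
    by (simp add: velocity_def W_def L_def I_def algebra_simps)
  finally show ?thesis .
qed

lemma horizontal_imp_conditions:
  fixes \<Gamma> :: "real \<Rightarrow> real ^ 3"
  assumes m: "1 \<le> m" and \<omega>: "modulus (modulus_real \<omega>)"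
    and hor: "horizontal \<Gamma>" and cur: "curve_C_m_omega m \<omega> \<Gamma>"
    and jets: "\<forall>k\<le>m. \<forall>x\<in>K. iter_deriv k \<Gamma> x = vector [F k x, G k x, H k x]"
  shows "whitney_field m \<omega> K F \<and> whitney_field m \<omega> K G \<and> whitney_field m \<omega> K H"
    and "\<forall>k\<in>{1..m}. \<forall>x\<in>K. H k x = contact F G (k - 1) x"
    and "\<exists>C\<ge>1. \<forall>a\<in>K. \<forall>b\<in>K. a < b \<longrightarrow> \<bar>area_discrepancy m F G H a b / velocity m \<omega> F G a b\<bar> \<le> C"
proof -
  define f where "f i k = iter_deriv k (\<lambda>s. \<Gamma> s $ i)" for i k
  have Cm: "C_m m (\<lambda>s. \<Gamma> s $ i)" and Cmo: "C_m_omega m \<omega> (\<lambda>s. \<Gamma> s $ i)" for i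
    using cur by (auto simp: curve_C_m_omega_def C_m_omega_def)
  have chain: "deriv_chain m (f i)" for i
    using C_m_chain[OF Cm[of i]] by (simp add: f_def[abs_def])
  have cont: "continuous_on UNIV (f i 1)" for i
    unfolding f_def by (rule C_m_continuous[OF Cm m])
  have f0: "f i 0 = (\<lambda>s. \<Gamma> s $ i)" for i by (simp add: f_def)
  have "iter_deriv k \<Gamma> = (\<lambda>x. \<chi> i. f i k x)" if "k \<le> m" for k
  proof -
    have "\<Gamma> = (\<lambda>x. \<chi> i. f i 0 x)" by (simp add: f0)
    then show ?thesis using iter_deriv_vec_lambda[of m f k, OF chain that] by simp
  qed
  then have eq: "f 1 k x = F k x" "f 2 k x = G k x" "f 3 k x = H k x" if "k \<le> m" "x \<in> K" for k x
    using jets that by (auto simp: vec_eq_iff forall_3)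
  have "\<exists>C\<ge>0. \<forall>a b. \<bar>f i m b - f i m a\<bar> \<le> C * modulus_real \<omega> \<bar>b - a\<bar>" for i
    unfolding f_def by (rule C_m_omega_modulus[OF \<omega> Cmo[of i]]) blast
  then obtain c where c: "\<And>i. 0 \<le> c i" "\<And>i a b. \<bar>f i m b - f i m a\<bar> \<le> c i * modulus_real \<omega> \<bar>b - a\<bar>"
    by metis
  define C where "C = 1 + c 1 + c 2 + c 3"
  have Ci: "\<bar>f i m b - f i m a\<bar> \<le> C * modulus_real \<omega> \<bar>b - a\<bar>" for i a b
  proof -
    have "c i \<le> C" using c(1)[of 1] c(1)[of 2] c(1)[of 3] exhaust_3[of i] by (auto simp: C_def)
    then have "c i * modulus_real \<omega> \<bar>b - a\<bar> \<le> C * modulus_real \<omega> \<bar>b - a\<bar>"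
      by (intro mult_right_mono) (simp_all add: modulus_real_def)
    then show ?thesis using c(2)[where i = i and a = a and b = b] by linarith
  qed
  have C: "0 < C" using c(1)[of 1] c(1)[of 2] c(1)[of 3] by (simp add: C_def)
  then have C0: "0 \<le> C" by simp
  have "whitney_bound m (modulus_real \<omega>) K C F"
    by (rule whitney_bound_chain[OF \<omega> chain[of 1] C0 Ci]) (simp add: eq)
  moreover have "whitney_bound m (modulus_real \<omega>) K C G"
    by (rule whitney_bound_chain[OF \<omega> chain[of 2] C0 Ci]) (simp add: eq)
  moreover have "whitney_bound m (modulus_real \<omega>) K C H"
    by (rule whitney_bound_chain[OF \<omega> chain[of 3] C0 Ci]) (simp add: eq)
  ultimately show "whitney_field m \<omega> K F \<and> whitney_field m \<omega> K G \<and> whitney_field m \<omega> K H"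
    using C unfolding whitney_field_iff by blast
  have h1: "f 3 1 s = contact (f 1) (f 2) 0 s" for s
    using horizontal_contact[OF m Cm hor, of s] by (simp add: f_def[abs_def])
  have hk: "f 3 (Suc k) = contact (f 1) (f 2) k" if "k \<le> m - 1" for k
    using chain_unique[OF deriv_chain_Suc[OF chain[of 3]] contact_chain[OF chain chain] _ that, of 1 2] h1
    by (simp add: fun_eq_iff)
  show "\<forall>k\<in>{1..m}. \<forall>x\<in>K. H k x = contact F G (k - 1) x"
  proof (intro ballI)
    fix k x assume k: "k \<in> {1..m}" and x: "x \<in> K"
    then have "H k x = contact (f 1) (f 2) (k - 1) x"
      using hk[of "k - 1"] eq(3)[of k x] by auto
    also have "\<dots> = contact F G (k - 1) x" by (rule contact_cong) (use k x eq in auto)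
    finally show "H k x = contact F G (k - 1) x" .
  qed
  have ar: "H 0 b - H 0 a = 2 * area a b (f 1 0) (f 1 1) (f 2 0) (f 2 1)" if "a \<in> K" "b \<in> K" "a < b" for a b
  proof -
    have "cont_deriv (f 3 0) (f 3 1)" unfolding cont_deriv_def using deriv_chainD[OF chain, of 0 3] m cont by simp
    then have "f 3 0 b - f 3 0 a = integral {a..b} (f 3 1)" using cont_deriv_integral that(3) by simp
    also have "f 3 1 = contact (f 1) (f 2) 0" using h1 by blast
    also have "integral {a..b} \<dots> = 2 * area a b (f 1 0) (f 1 1) (f 2 0) (f 2 1)" by (rule integral_contact)
    finally show ?thesis using eq(3) that by simp
  qed
  show "\<exists>C\<ge>1. \<forall>a\<in>K. \<forall>b\<in>K. a < b \<longrightarrow> \<bar>area_discrepancy m F G H a b / velocity m \<omega> F G a b\<bar> \<le> C"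
  proof (intro exI[of _ "1 + 6 * C + 4 * C\<^sup>2"] conjI ballI impI)
    show "1 \<le> 1 + 6 * C + 4 * C\<^sup>2" using C by simp
    fix a b assume ab: "a \<in> K" "b \<in> K" "a < b"
    have "\<bar>area_discrepancy m F G H a b\<bar> \<le> (1 + 6 * C + 4 * C\<^sup>2) * velocity m \<omega> F G a b"
      by (rule area_discrepancy_bound[where f = "f 1" and g = "f 2" and K = K and C = C])
        (rule m \<omega> chain cont C0 Ci ar ab | simp add: eq)+
    then show "\<bar>area_discrepancy m F G H a b / velocity m \<omega> F G a b\<bar> \<le> 1 + 6 * C + 4 * C\<^sup>2"
      using velocity_pos[OF \<omega> ab(3), of m F G] by (simp add: abs_divide divide_le_eq)
  qed
qed

section \<open>Lifting planar curves\<close>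

lemma C_m_omega_chain:
  assumes "modulus (modulus_real \<omega>)" and D: "deriv_chain m D"
    and cont: "continuous_on UNIV (D m)"
    and C: "\<And>x y. \<bar>D m x - D m y\<bar> \<le> C * modulus_real \<omega> \<bar>x - y\<bar>"
  shows "C_m_omega m \<omega> (D 0)"
proof -
  interpret modulus "modulus_real \<omega>" by fact
  have it: "iter_deriv k (D 0) = D k" if "k \<le> m" for k
    by (rule iter_deriv_chain[OF D that])
  have "D k differentiable (at x)" if "k < m" for k x
    unfolding real_differentiable_def using deriv_chainD[OF D that] by blast
  then have "C_m m (D 0)" unfolding C_m_def using it cont by simp
  moreover have "\<bar>D m b - D m a\<bar> / modulus_real \<omega> \<bar>b - a\<bar> \<le> C" if "a \<noteq> b" for a b
    using C[of b a] pos[of "\<bar>b - a\<bar>"] that by (simp add: divide_le_eq)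
  then have "bdd_above {\<bar>iter_deriv m (D 0) b - iter_deriv m (D 0) a\<bar> / modulus_real \<omega> \<bar>b - a\<bar> | a b. a \<noteq> b}"
    unfolding bdd_above_def it[OF order_refl] by blast
  ultimately show ?thesis by (simp add: C_m_omega_def)
qed

context modulus
begin

text \<open>The coefficients of the contact equation are products, and for products the modulus is
preserved only in presence of bounds.\<close>

definition lip_bdd :: "(real \<Rightarrow> real) \<Rightarrow> bool" where
  "lip_bdd u \<longleftrightarrow> (\<exists>B. \<forall>x. \<bar>u x\<bar> \<le> B) \<and> (\<exists>C. \<forall>x y. \<bar>u x - u y\<bar> \<le> C * w \<bar>x - y\<bar>)"

lemma lip_bddE:
  assumes "lip_bdd u"
  obtains B C where "0 \<le> B" "0 \<le> C" "\<And>x. \<bar>u x\<bar> \<le> B" "\<And>x y. \<bar>u x - u y\<bar> \<le> C * w \<bar>x - y\<bar>"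
proof -
  obtain B C where B: "\<And>x. \<bar>u x\<bar> \<le> B" and C: "\<And>x y. \<bar>u x - u y\<bar> \<le> C * w \<bar>x - y\<bar>"
    using assms unfolding lip_bdd_def by blast
  have "0 \<le> B" using B[of 0] by simp
  moreover have "\<bar>u x - u y\<bar> \<le> \<bar>C\<bar> * w \<bar>x - y\<bar>" for x y
    by (rule order_trans[OF C]) (rule mult_right_mono, auto)
  ultimately show ?thesis using B that[of B "\<bar>C\<bar>"] by simp
qed

lemma lip_bdd_continuous:
  assumes "lip_bdd u"
  shows "continuous_on S u"
proof -
  obtain C where C: "\<And>x y. \<bar>u x - u y\<bar> \<le> C * w \<bar>x - y\<bar>" using assms by (auto simp: lip_bdd_def)
  have "isCont u a" for a
  proof -
    have "((\<lambda>h. u (a + h) - u a) \<longlongrightarrow> 0) (at 0)"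
    proof (rule Lim_null_comparison)
      show "((\<lambda>h. C * w \<bar>h\<bar>) \<longlongrightarrow> 0) (at 0)" by (rule tendsto_mult_right_zero[OF abs_lim])
      show "\<forall>\<^sub>F h in at 0. norm (u (a + h) - u a) \<le> C * w \<bar>h\<bar>"
        using C[of "a + _" a] by simp
    qed
    then show ?thesis unfolding isCont_iff by (rule LIM_zero_cancel)
  qed
  then show ?thesis by (simp add: continuous_at_imp_continuous_on)
qed

lemma lip_bdd_add:
  assumes "lip_bdd u" "lip_bdd v"
  shows "lip_bdd (\<lambda>x. u x + v x)"
proof -
  obtain B C where u: "\<And>x. \<bar>u x\<bar> \<le> B" "\<And>x y. \<bar>u x - u y\<bar> \<le> C * w \<bar>x - y\<bar>"
    using lip_bddE[OF assms(1)] by metis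
  obtain B' C' where v: "\<And>x. \<bar>v x\<bar> \<le> B'" "\<And>x y. \<bar>v x - v y\<bar> \<le> C' * w \<bar>x - y\<bar>"
    using lip_bddE[OF assms(2)] by metis
  have "\<bar>u x + v x\<bar> \<le> B + B'" for x using u(1)[of x] v(1)[of x] by linarith
  moreover have "\<bar>(u x + v x) - (u y + v y)\<bar> \<le> (C + C') * w \<bar>x - y\<bar>" for x y
    using u(2)[of x y] v(2)[of x y] by (simp add: distrib_right abs_le_iff)
  ultimately show ?thesis unfolding lip_bdd_def by blast
qed

lemma lip_bdd_mult:
  assumes "lip_bdd u" "lip_bdd v"
  shows "lip_bdd (\<lambda>x. u x * v x)"
proof -
  obtain B C where u: "0 \<le> B" "0 \<le> C" "\<And>x. \<bar>u x\<bar> \<le> B" "\<And>x y. \<bar>u x - u y\<bar> \<le> C * w \<bar>x - y\<bar>"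
    using lip_bddE[OF assms(1)] by metis
  obtain B' C' where v: "0 \<le> B'" "0 \<le> C'" "\<And>x. \<bar>v x\<bar> \<le> B'" "\<And>x y. \<bar>v x - v y\<bar> \<le> C' * w \<bar>x - y\<bar>"
    using lip_bddE[OF assms(2)] by metis
  have "\<bar>u x * v x\<bar> \<le> B * B'" for x unfolding abs_mult using u v by (intro mult_mono) auto
  moreover have "\<bar>u x * v x - u y * v y\<bar> \<le> (B * C' + C * B') * w \<bar>x - y\<bar>" for x y
  proof -
    have "u x * v x - u y * v y = u x * (v x - v y) + (u x - u y) * v y" by (simp add: algebra_simps)
    moreover have "\<bar>u x * (v x - v y)\<bar> \<le> B * (C' * w \<bar>x - y\<bar>)"
      unfolding abs_mult using u v by (intro mult_mono) auto
    moreover have "\<bar>(u x - u y) * v y\<bar> \<le> (C * w \<bar>x - y\<bar>) * B'"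
      unfolding abs_mult using u v by (intro mult_mono) auto
    ultimately show ?thesis by (simp add: algebra_simps)
  qed
  ultimately show ?thesis unfolding lip_bdd_def by blast
qed

lemma lip_bdd_const: "lip_bdd (\<lambda>x. c)"
  unfolding lip_bdd_def by (intro conjI, rule exI[of _ "\<bar>c\<bar>"], simp, rule exI[of _ 0], simp)

lemma lip_bdd_diff:
  assumes "lip_bdd u" "lip_bdd v"
  shows "lip_bdd (\<lambda>x. u x - v x)"
  using lip_bdd_add[OF assms(1) lip_bdd_mult[OF lip_bdd_const[of "-1"] assms(2)]] by simp

lemma lip_bdd_sum: "(\<And>i. i \<in> A \<Longrightarrow> lip_bdd (u i)) \<Longrightarrow> lip_bdd (\<lambda>x. \<Sum>i\<in>A. u i x)"
  by (induction A rule: infinite_finite_induct) (auto intro: lip_bdd_const lip_bdd_add)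

text \<open>At distances up to \<open>1\<close> a Lipschitz bound is stronger than the modulus, as
\<open>|x - y| w 1 \<le> w |x - y|\<close> by concavity. At larger distances boundedness suffices
because \<open>w 1 \<le> w |x - y|\<close>.\<close>

lemma lip_bdd_primitive:
  assumes d: "\<And>x. (u has_real_derivative u' x) (at x)" and B: "\<And>x. \<bar>u' x\<bar> \<le> B"
    and 0: "\<And>x. x \<notin> {lo..hi} \<Longrightarrow> u x = 0"
  shows "lip_bdd u"
proof -
  have B0: "0 \<le> B" using B[of 0] by simp
  have lip: "\<bar>u x - u y\<bar> \<le> B * \<bar>x - y\<bar>" for x y
    using field_differentiable_bound[of UNIV u u' B x y] d B by simp
  \<comment> \<open>The point \<open>hi + 1\<close> lies outside the support, and every point of the support is within \<open>hi + 1 - lo\<close> of it.\<close>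
  define M where "M = B * \<bar>hi + 1 - lo\<bar>"
  have M: "\<bar>u x\<bar> \<le> M" for x
  proof (cases "x \<in> {lo..hi}")
    case True
    have "\<bar>u x\<bar> \<le> B * \<bar>x - (hi + 1)\<bar>" using lip[of x "hi + 1"] 0[of "hi + 1"] by simp
    also have "\<dots> \<le> M" unfolding M_def using True B0 by (intro mult_left_mono) auto
    finally show ?thesis .
  next
    case False
    then show ?thesis using 0 B0 by (simp add: M_def)
  qed
  have w1: "0 < w 1" by (rule pos) simp
  have "\<bar>u x - u y\<bar> \<le> (B + 2 * M) / w 1 * w \<bar>x - y\<bar>" for x y
  proof (cases "\<bar>x - y\<bar> \<le> 1")
    case True
    \<comment> \<open>Concavity between \<open>0\<close> and \<open>1\<close>.\<close>
    have "B * \<bar>x - y\<bar> * w 1 \<le> B * w \<bar>x - y\<bar>"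
      unfolding mult.assoc using star[of "\<bar>x - y\<bar>" 1] True B0 by (intro mult_left_mono) auto
    also have "\<dots> \<le> (B + 2 * M) * w \<bar>x - y\<bar>" using M[of 0] by (intro mult_right_mono) auto
    finally have "B * \<bar>x - y\<bar> \<le> (B + 2 * M) / w 1 * w \<bar>x - y\<bar>" using w1 by (simp add: field_simps)
    then show ?thesis using lip[of x y] by linarith
  next
    case False
    then have "w 1 \<le> w \<bar>x - y\<bar>" by (intro mono) auto
    moreover have "0 \<le> B + 2 * M" using M[of 0] B0 by simp
    ultimately have "(B + 2 * M) * w 1 \<le> (B + 2 * M) * w \<bar>x - y\<bar>" by (rule mult_left_mono)
    then have "B + 2 * M \<le> (B + 2 * M) / w 1 * w \<bar>x - y\<bar>" using w1 by (simp add: field_simps)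
    then show ?thesis using M[of x] M[of y] B0 by linarith
  qed
  then show ?thesis using M unfolding lip_bdd_def by blast
qed

text \<open>Downward induction on the order of the derivative, starting from the top one.\<close>

lemma lip_bdd_chain:
  assumes f: "deriv_chain m f" and C: "\<And>x y. \<bar>f m x - f m y\<bar> \<le> C * w \<bar>x - y\<bar>"
    and 0: "\<And>k x. k \<le> m \<Longrightarrow> x \<notin> {lo..hi} \<Longrightarrow> f k x = 0" and k: "k \<le> m"
  shows "lip_bdd (f k)"
  using k
proof (induction "m - k" arbitrary: k)
  case 0
  then have k: "k = m" by simp
  have "\<bar>f m x\<bar> \<le> \<bar>C\<bar> * w \<bar>hi + 1 - lo\<bar>" for x
  proof (cases "x \<in> {lo..hi}")
    case True
    have "\<bar>f m x\<bar> \<le> C * w \<bar>x - (hi + 1)\<bar>" using C[of x "hi + 1"] assms(3)[of m "hi + 1"] by simp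
    also have "\<dots> \<le> \<bar>C\<bar> * w \<bar>hi + 1 - lo\<bar>" using True by (intro mult_mono mono) (auto intro!: nonneg)
    finally show ?thesis .
  next
    case False
    then show ?thesis using assms(3)[of m x] by simp
  qed
  then show ?case using C unfolding k lip_bdd_def by blast
next
  case (Suc n)
  then have "lip_bdd (f (Suc k))" by (intro Suc.hyps(1)) auto
  then obtain B where "\<And>x. \<bar>f (Suc k) x\<bar> \<le> B" unfolding lip_bdd_def by blast
  then show ?case
    using deriv_chainD[OF f, of k] Suc.hyps(2) assms(3)[OF Suc.prems]
    by (intro lip_bdd_primitive[where u' = "f (Suc k)"]) auto
qed

lemma lip_bdd_contact:
  assumes "\<And>k. k \<le> m \<Longrightarrow> lip_bdd (f k)" "\<And>k. k \<le> m \<Longrightarrow> lip_bdd (g k)" "k < m"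
  shows "lip_bdd (contact f g k)"
  unfolding contact_def[abs_def]
  by (intro lip_bdd_mult lip_bdd_const lip_bdd_sum lip_bdd_diff assms(1,2)) (use assms(3) in auto)

text \<open>Extend \<open>u\<close> by its value at the last point of \<open>K\<close> to the
left. Inside gaps the extension is constant, and at points of \<open>K\<close> its derivative is
\<open>0\<close>: for a nearby point in a gap, the value at the endpoint nearer to the base point
can be used, since \<open>u\<close> agrees at both endpoints.\<close>

lemma constant_on_compact:
  assumes K: "compact K" and al: "\<alpha> \<in> K" "\<And>x. x \<in> K \<Longrightarrow> \<alpha> \<le> x"
    and gaps: "\<And>c d. gap K c d \<Longrightarrow> u c = u d"
    and C: "\<And>a b. a \<in> K \<Longrightarrow> b \<in> K \<Longrightarrow> \<bar>b - a\<bar> \<le> 1 \<Longrightarrow> \<bar>u b - u a\<bar> \<le> C * w \<bar>b - a\<bar> * \<bar>b - a\<bar>"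
    and x: "x \<in> K"
  shows "u x = u \<alpha>"
proof -
  define l where "l x = Sup (K \<inter> {..x})" for x
  define U where "U x = (if x < \<alpha> then u \<alpha> else u (l x))" for x
  have l: "l x = c" if "c \<in> K" "c \<le> x" "K \<inter> {c<..x} = {}" for x c
    unfolding l_def by (rule cSup_eq_maximum) (use that in \<open>auto simp: disjoint_iff not_less[symmetric]\<close>)
  have UK: "U x = u x" if "x \<in> K" for x using l[of x x] al(2)[OF that] that by (simp add: U_def)
  have Ugap: "U x = u c" if "gap K c d" "x \<in> {c..<d}" for x c d
    using l[of c x] that al(2)[of c] by (force simp: U_def gap_def disjoint_iff)
  have cases: "(\<exists>c d. gap K c d \<and> c < x \<and> x < d) \<or> x < \<alpha> \<or> (\<exists>b\<in>K. b < x \<and> K \<subseteq> {..b})" if "x \<notin> K" for x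
  proof (cases "\<exists>b\<in>K. x < b")
    case True
    then obtain b where "b \<in> K" "x < b" by blast
    then show ?thesis using gap_exists[OF K that al(1), of b] al that by (cases "x < \<alpha>") (auto, force)
  next
    case False
    obtain b where "b \<in> K" "\<And>y. y \<in> K \<Longrightarrow> y \<le> b" using compact_attains_sup[OF K] al(1) by blast
    moreover have "b < x" using False that calculation(1) by (metis linorder_neqE_linordered_idom)
    ultimately show ?thesis by blast
  qed
  have Utop: "U x = u b" if "b \<in> K" "b < x" "K \<subseteq> {..b}" for x b
    using l[of b x] that al(2)[of b] by (force simp: U_def disjoint_iff)
  have "(U has_real_derivative 0) (at x)" for x
  proof (cases "x \<in> K")
    case True
    have "\<bar>U y - U x\<bar> \<le> \<bar>C\<bar> * w \<bar>y - x\<bar> * \<bar>y - x\<bar>" if y: "\<bar>y - x\<bar> \<le> 1" for y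
    proof -
      have "\<exists>e\<in>K. U y = u e \<and> \<bar>e - x\<bar> \<le> \<bar>y - x\<bar>"
      proof (cases "y \<in> K")
        case True then show ?thesis using UK by auto
      next
        case False
        from cases[OF this] show ?thesis
        proof (elim disjE exE bexE conjE)
          fix c d assume cd: "gap K c d" "c < y" "y < d"
          then have "U y = u c" "U y = u d" using Ugap[OF cd(1), of y] gaps[OF cd(1)] by auto
          moreover have "x \<le> c \<or> d \<le> x" by (rule gap_endpoint[OF cd(1) True])
          ultimately show ?thesis using cd by (force simp: gap_def)
        next
          assume "y < \<alpha>"
          then show ?thesis using al(1) al(2)[OF True] by (intro bexI[of _ \<alpha>]) (auto simp: U_def)
        next
          fix b assume "b \<in> K" "b < y" "K \<subseteq> {..b}"
          then show ?thesis using Utop[of b y] True by (intro bexI[of _ b]) auto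
        qed
      qed
      then obtain e where e: "e \<in> K" "U y = u e" "\<bar>e - x\<bar> \<le> \<bar>y - x\<bar>" by blast
      have "\<bar>u e - u x\<bar> \<le> C * w \<bar>e - x\<bar> * \<bar>e - x\<bar>" using C[OF True e(1)] e(3) y by simp
      also have "\<dots> \<le> \<bar>C\<bar> * w \<bar>y - x\<bar> * \<bar>y - x\<bar>"
        using e(3) by (intro mult_mono mono) (auto intro!: mult_nonneg_nonneg)
      finally show ?thesis using e(2) UK[OF True] by simp
    qed
    then have "((\<lambda>y. U y - U x) has_real_derivative 0) (at x)" by (rule deriv_zero_bound)
    then have "((\<lambda>y. (U y - U x) + U x) has_real_derivative 0 + 0) (at x)" by (intro DERIV_add DERIV_const)
    then show ?thesis by simp
  next
    case False
    from cases[OF this] show ?thesis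
    proof (elim disjE exE bexE conjE)
      fix c d assume cd: "gap K c d" "c < x" "x < d"
      show ?thesis
        by (rule has_field_derivative_transform_within_open[OF DERIV_const[of "u c"], of "{c<..<d}"])
          (use cd Ugap[OF cd(1)] in auto)
    next
      assume "x < \<alpha>"
      then show ?thesis
        by (intro has_field_derivative_transform_within_open[OF DERIV_const[of "u \<alpha>"], of "{..<\<alpha>}"])
          (auto simp: U_def)
    next
      fix b assume b: "b \<in> K" "b < x" "K \<subseteq> {..b}"
      show ?thesis
        by (rule has_field_derivative_transform_within_open[OF DERIV_const[of "u b"], of "{b<..}"])
          (use b Utop[of b] in auto)
    qed
  qed
  then have "U x = U \<alpha>" by (intro DERIV_isconst_all) blast
  then show ?thesis using UK x al(1) by simp
qed

end

lemma abs_continuous_on_lipschitz: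
  assumes "0 \<le> B" "\<And>x y. dist (f x) (f y) \<le> B * dist x y"
  shows "abs_continuous_on S f"
  unfolding abs_continuous_on_def
proof (intro allI impI)
  fix \<epsilon> :: real assume \<epsilon>: "0 < \<epsilon>"
  show "\<exists>\<delta>>0. \<forall>n (u :: nat \<Rightarrow> real) v. (\<forall>i<n. u i \<le> v i \<and> {u i..v i} \<subseteq> S) \<and> disjoint_family_on (\<lambda>i. {u i<..<v i}) {..<n} \<and>
      (\<Sum>i<n. v i - u i) < \<delta> \<longrightarrow> (\<Sum>i<n. dist (f (u i)) (f (v i))) < \<epsilon>"
  proof (intro exI[of _ "\<epsilon> / (B + 1)"] conjI allI impI)
    show "0 < \<epsilon> / (B + 1)" using \<epsilon> assms(1) by simp
    fix n :: nat and u v :: "nat \<Rightarrow> real"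
    assume a: "(\<forall>i<n. u i \<le> v i \<and> {u i..v i} \<subseteq> S) \<and> disjoint_family_on (\<lambda>i. {u i<..<v i}) {..<n} \<and>
      (\<Sum>i<n. v i - u i) < \<epsilon> / (B + 1)"
    have "(\<Sum>i<n. dist (f (u i)) (f (v i))) \<le> (\<Sum>i<n. B * (v i - u i))"
      using a assms(2) by (intro sum_mono order_trans[OF assms(2)]) (auto simp: dist_real_def)
    also have "\<dots> = B * (\<Sum>i<n. v i - u i)" by (simp add: sum_distrib_left)
    also have "\<dots> \<le> B * (\<epsilon> / (B + 1))" using a assms(1) by (intro mult_left_mono) auto
    also have "\<dots> < \<epsilon>" using assms(1) \<epsilon> by (simp add: field_simps)
    finally show "(\<Sum>i<n. dist (f (u i)) (f (v i))) < \<epsilon>" .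
  qed
qed

lemma primitive_exists:
  fixes v :: "real \<Rightarrow> real"
  assumes "continuous_on UNIV v" "\<And>x. x < lo \<Longrightarrow> v x = 0"
  shows "\<exists>P. (\<forall>x. (P has_real_derivative v x) (at x)) \<and> P p = c"
proof -
  \<comment> \<open>Starting at \<open>lo - 1\<close> keeps \<open>lo\<close> in the interior of the interval of integration.\<close>
  define Q where "Q x = integral {lo - 1..x} v" for x
  have Q: "(Q has_real_derivative v x) (at x)" for x
  proof (cases "x < lo")
    case True
    have Q0: "Q y = 0" if "y < lo" for y
      unfolding Q_def using assms(2) that by (intro integral_unique has_integral_is_0) auto
    have "((\<lambda>_. 0) has_real_derivative v x) (at x)" using assms(2)[OF True] by simp
    then show ?thesis
      by (rule has_field_derivative_transform_within_open[of _ _ _ "{..<lo}"]) (use True Q0 in auto)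
  next
    case False
    have "(Q has_real_derivative v x) (at x within {lo - 1..x + 1})"
      unfolding Q_def using False
      by (intro integral_has_real_derivative continuous_on_subset[OF assms(1)]) auto
    moreover have "at x within {lo - 1..x + 1} = at x"
      by (rule at_within_interior) (use False in simp)
    ultimately show ?thesis by (simp only:)
  qed
  have "((\<lambda>x. Q x + (c - Q p)) has_real_derivative v x + 0) (at x)" for x
    by (rule DERIV_add[OF Q DERIV_const])
  then have "\<And>x. ((\<lambda>x. Q x + (c - Q p)) has_real_derivative v x) (at x)" by (simp only: add_0_right)
  then show ?thesis by (intro exI[of _ "\<lambda>x. Q x + (c - Q p)"]) simp
qed

text \<open>The vertical coordinate is a primitive of \<open>2 (f' g - g' f)\<close>. Compact
support of \<open>f\<close> and \<open>g\<close> makes all derivatives bounded, which gives a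
global modulus of continuity for the top derivative of \<open>h\<close> and the Lipschitz bound
behind absolute continuity.\<close>

lemma horizontal_lift:
  assumes m: "1 \<le> m" and \<omega>: "modulus (modulus_real \<omega>)"
    and f: "deriv_chain m f" "\<And>x y. \<bar>f m x - f m y\<bar> \<le> Cf * modulus_real \<omega> \<bar>x - y\<bar>"
      "\<And>k x. k \<le> m \<Longrightarrow> x \<notin> {lo..hi} \<Longrightarrow> f k x = 0"
    and g: "deriv_chain m g" "\<And>x y. \<bar>g m x - g m y\<bar> \<le> Cg * modulus_real \<omega> \<bar>x - y\<bar>"
      "\<And>k x. k \<le> m \<Longrightarrow> x \<notin> {lo..hi} \<Longrightarrow> g k x = 0"
  obtains \<Gamma> h where "horizontal \<Gamma>" "curve_C_m_omega m \<omega> \<Gamma>" "deriv_chain m h" "h 0 p = c"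
    "\<And>k. h (Suc k) = contact f g k" "\<exists>C\<ge>0. \<forall>x y. \<bar>h m x - h m y\<bar> \<le> C * modulus_real \<omega> \<bar>x - y\<bar>"
    "continuous_on UNIV (h 1)"
    "\<And>k x. k \<le> m \<Longrightarrow> iter_deriv k \<Gamma> x = vector [f k x, g k x, h k x]"
proof -
  interpret modulus "modulus_real \<omega>" by fact
  have lf: "lip_bdd (f k)" if "k \<le> m" for k by (rule lip_bdd_chain[OF f that])
  have lg: "lip_bdd (g k)" if "k \<le> m" for k by (rule lip_bdd_chain[OF g that])
  have lc: "lip_bdd (contact f g k)" if "k < m" for k by (rule lip_bdd_contact[OF lf lg that])
  have z: "contact f g 0 x = 0" if "x < lo" for x using f(3)[of _ x] g(3)[of _ x] that by (simp add: contact_0)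
  have "continuous_on UNIV (contact f g 0)" by (rule lip_bdd_continuous[OF lc]) (use m in simp)
  then obtain P where P: "\<And>x. (P has_real_derivative contact f g 0 x) (at x)" "P p = c"
    using primitive_exists[of "contact f g 0" lo p c] z by blast
  define h where "h k = (case k of 0 \<Rightarrow> P | Suc j \<Rightarrow> contact f g j)" for k
  have hS: "h (Suc k) = contact f g k" and h0: "h 0 = P" for k by (simp_all add: h_def)
  have hch: "deriv_chain m h"
    unfolding deriv_chain_def
  proof (intro allI impI)
    fix k x assume k: "k < m"
    show "(h k has_real_derivative h (Suc k) x) (at x)"
    proof (cases k)
      case 0 then show ?thesis using P(1) by (simp add: hS h0)
    next
      case (Suc j)
      then show ?thesis using deriv_chainD[OF contact_chain[OF f(1) g(1)], of j x] k by (simp add: hS)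
    qed
  qed
  have lh: "lip_bdd (h k)" if "1 \<le> k" "k \<le> m" for k
    using lc[of "k - 1"] hS[of "k - 1"] that by simp
  define E :: "3 \<Rightarrow> nat \<Rightarrow> real \<Rightarrow> real" where "E i = (if i = 1 then f else if i = 2 then g else h)" for i
  have E: "E 1 = f" "E 2 = g" "E 3 = h" by (simp_all add: E_def)
  have Ech: "deriv_chain m (E i)" for i using f(1) g(1) hch by (simp add: E_def)
  have lE: "lip_bdd (E i k)" if "1 \<le> k" "k \<le> m" for i k using lf lg lh that by (simp add: E_def)
  define \<Gamma> :: "real \<Rightarrow> real ^ 3" where "\<Gamma> = (\<lambda>s. \<chi> i. E i 0 s)"
  have \<Gamma>k: "iter_deriv k \<Gamma> = (\<lambda>x. \<chi> i. E i k x)" if "k \<le> m" for k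
    unfolding \<Gamma>_def by (rule iter_deriv_vec_lambda[of m E, OF Ech that])
  have jets: "iter_deriv k \<Gamma> x = vector [f k x, g k x, h k x]" if "k \<le> m" for k x
    using \<Gamma>k[OF that] by (simp add: vec_eq_iff forall_3 E)
  have "C_m_omega m \<omega> (\<lambda>s. \<Gamma> s $ i)" for i
  proof -
    obtain C where "\<And>x y. \<bar>E i m x - E i m y\<bar> \<le> C * modulus_real \<omega> \<bar>x - y\<bar>"
      using lip_bddE[OF lE[OF m order_refl, of i]] by metis
    from C_m_omega_chain[OF \<omega> Ech lip_bdd_continuous[OF lE[OF m order_refl]] this]
    show ?thesis by (simp add: \<Gamma>_def)
  qed
  then have cur: "curve_C_m_omega m \<omega> \<Gamma>" by (simp add: curve_C_m_omega_def)
  have dE: "(E i 0 has_real_derivative E i 1 s) (at s)" for i s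
    using deriv_chainD[OF Ech, of 0 i s] m by simp
  have "\<exists>B\<ge>0. \<forall>x. \<bar>E i 1 x\<bar> \<le> B" for i
    using lip_bddE[OF lE[OF order_refl m, of i]] by metis
  then obtain b where b: "\<And>i. 0 \<le> b i" "\<And>i x. \<bar>E i 1 x\<bar> \<le> b i" by metis
  have "dist (\<Gamma> x) (\<Gamma> y) \<le> (\<Sum>i\<in>UNIV. b i) * dist x y" for x y
  proof -
    have "dist (\<Gamma> x) (\<Gamma> y) \<le> (\<Sum>i\<in>UNIV. \<bar>(\<Gamma> x - \<Gamma> y) $ i\<bar>)" unfolding dist_norm by (rule norm_le_l1_cart)
    also have "\<dots> \<le> (\<Sum>i\<in>UNIV. b i * dist x y)"
    proof (rule sum_mono)
      fix i
      have "norm (E i 0 x - E i 0 y) \<le> b i * norm (x - y)"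
        by (rule field_differentiable_bound[of UNIV "E i 0" "E i 1"]) (use dE b in auto)
      then show "\<bar>(\<Gamma> x - \<Gamma> y) $ i\<bar> \<le> b i * dist x y" by (simp add: \<Gamma>_def dist_norm)
    qed
    finally show ?thesis by (simp add: sum_distrib_right)
  qed
  then have ac: "abs_continuous_on S \<Gamma>" for S
    using b(1) by (intro abs_continuous_on_lipschitz[of "\<Sum>i\<in>UNIV. b i"] sum_nonneg) auto
  have "(\<Gamma> has_vector_derivative (\<chi> i. E i 1 s)) (at s)" for s
    unfolding \<Gamma>_def by (rule has_vector_derivative_vec_lambda[OF dE])
  moreover have "(\<chi> i. E i 1 s) \<in> span {heis_X (\<Gamma> s), heis_Y (\<Gamma> s)}" for s
  proof -
    have "(\<chi> i. E i 1 s) = f 1 s *\<^sub>R heis_X (\<Gamma> s) + g 1 s *\<^sub>R heis_Y (\<Gamma> s)"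
      using hS[of 0] by (simp add: vec_eq_iff forall_3 E heis_X_def heis_Y_def \<Gamma>_def contact_0 algebra_simps)
    then show ?thesis by (simp add: span_add span_base span_scale)
  qed
  ultimately have "horizontal \<Gamma>" unfolding horizontal_def using ac by blast
  moreover have "\<exists>C\<ge>0. \<forall>x y. \<bar>h m x - h m y\<bar> \<le> C * modulus_real \<omega> \<bar>x - y\<bar>"
    using lip_bddE[OF lh[OF m order_refl]] by metis
  moreover have "continuous_on UNIV (h 1)" by (rule lip_bdd_continuous[OF lh[OF order_refl m]])
  ultimately show ?thesis using that[of \<Gamma> h] cur hch hS jets P(2) h0 by simp
qed

section \<open>Sufficiency of the conditions\<close>

lemma jet_bounded:
  fixes F :: "nat \<Rightarrow> real \<Rightarrow> real"
  assumes "compact K" "\<And>k. k \<le> m \<Longrightarrow> continuous_on K (F k)"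
  obtains B where "0 \<le> B" "\<And>k x. k \<le> m \<Longrightarrow> x \<in> K \<Longrightarrow> \<bar>F k x\<bar> \<le> B"
proof -
  have "\<exists>b\<ge>0. \<forall>x\<in>K. \<bar>F k x\<bar> \<le> b" if "k \<le> m" for k
  proof -
    have "bounded (F k ` K)"
      by (rule compact_imp_bounded[OF compact_continuous_image[OF assms(2)[OF that] assms(1)]])
    then obtain b where "b > 0" "\<forall>y\<in>F k ` K. norm y \<le> b" using bounded_pos by blast
    then show ?thesis by (intro exI[of _ b]) auto
  qed
  then obtain b where b: "\<And>k. k \<le> m \<Longrightarrow> 0 \<le> b k" "\<And>k x. k \<le> m \<Longrightarrow> x \<in> K \<Longrightarrow> \<bar>F k x\<bar> \<le> b k" by metis
  have "\<bar>F k x\<bar> \<le> (\<Sum>k\<le>m. b k)" if "k \<le> m" "x \<in> K" for k x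
  proof -
    have "b k \<le> (\<Sum>k\<le>m. b k)" using that b(1) by (intro member_le_sum) auto
    then show ?thesis using b(2)[OF that] by simp
  qed
  moreover have "0 \<le> (\<Sum>k\<le>m. b k)" using b(1) by (intro sum_nonneg) auto
  ultimately show ?thesis using that by blast
qed

text \<open>New points with zero jets at distance at least \<open>1\<close> from \<open>K\<close>:
at such distances the Whitney estimates only require the jets to be bounded.\<close>

lemma (in modulus) whitney_extend:
  assumes C: "0 \<le> C" "whitney_bound m w K C F"
    and B: "0 \<le> B" "\<And>k x. k \<le> m \<Longrightarrow> x \<in> K \<Longrightarrow> \<bar>F k x\<bar> \<le> B"
    and far: "\<And>x. x \<in> K \<Longrightarrow> lo + 1 \<le> x \<and> x \<le> hi - 1"
  shows "whitney_bound m w (insert lo (insert hi K)) (C + real (Suc m) * B / w 1) (\<lambda>k x. if x \<in> K then F k x else 0)"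
  unfolding whitney_bound_def
proof (intro allI impI ballI)
  let ?F = "\<lambda>k x. if x \<in> K then F k x else 0"
  let ?C = "C + real (Suc m) * B / w 1"
  fix k a b assume k: "k \<le> m" and a: "a \<in> insert lo (insert hi K)" and b: "b \<in> insert lo (insert hi K)"
  have w1: "0 < w 1" by (rule pos) simp
  have C': "C \<le> ?C" "real (Suc m) * B / w 1 \<le> ?C" "0 \<le> ?C" using B(1) C(1) w1 by simp_all
  have far_case: "X \<le> ?C * w \<bar>b - a\<bar> * \<bar>b - a\<bar> ^ (m - k)"
    if ge: "1 \<le> \<bar>b - a\<bar>" and X: "X \<le> real (Suc m) * B * \<bar>b - a\<bar> ^ (m - k)" for X
  proof -
    have "real (Suc m) * B = real (Suc m) * B / w 1 * w 1" using w1 by simp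
    also have "\<dots> \<le> ?C * w \<bar>b - a\<bar>" using C' ge w1 by (intro mult_mono mono) auto
    finally have "real (Suc m) * B * \<bar>b - a\<bar> ^ (m - k) \<le> ?C * w \<bar>b - a\<bar> * \<bar>b - a\<bar> ^ (m - k)"
      by (rule mult_right_mono) simp
    with X show ?thesis by linarith
  qed
  consider "a \<in> K" "b \<in> K" | "a \<in> K" "b \<notin> K" | "a \<notin> K" by blast
  then show "\<bar>?F k b - taylor (m - k) (\<lambda>l. ?F (k + l)) a b\<bar> \<le> ?C * w \<bar>b - a\<bar> * \<bar>b - a\<bar> ^ (m - k)"
  proof cases
    case 1
    have "taylor (m - k) (\<lambda>l. ?F (k + l)) a b = taylor (m - k) (\<lambda>l. F (k + l)) a b"
      using 1 by (intro taylor_cong) auto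
    then have "\<bar>?F k b - taylor (m - k) (\<lambda>l. ?F (k + l)) a b\<bar> \<le> C * w \<bar>b - a\<bar> * \<bar>b - a\<bar> ^ (m - k)"
      using C(2) 1 k by (simp add: whitney_bound_def)
    also have "\<dots> \<le> ?C * w \<bar>b - a\<bar> * \<bar>b - a\<bar> ^ (m - k)"
      using C' by (intro mult_right_mono) auto
    finally show ?thesis .
  next
    case 2
    then have ge: "1 \<le> \<bar>b - a\<bar>" using b far[of a] by auto
    have "\<bar>taylor (m - k) (\<lambda>l. ?F (k + l)) a b\<bar> \<le> (\<Sum>l\<le>m - k. B * \<bar>b - a\<bar> ^ l)"
      by (rule abs_taylor_le) (use B 2 k in auto)
    also have "\<dots> \<le> (\<Sum>l\<le>m - k. B * \<bar>b - a\<bar> ^ (m - k))"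
      using B(1) ge by (intro sum_mono mult_left_mono power_increasing) auto
    also have "\<dots> = real (Suc (m - k)) * B * \<bar>b - a\<bar> ^ (m - k)" by simp
    also have "\<dots> \<le> real (Suc m) * B * \<bar>b - a\<bar> ^ (m - k)"
      using B(1) by (intro mult_right_mono) auto
    finally show ?thesis using 2 by (intro far_case[OF ge]) simp
  next
    case 3
    then have T: "taylor (m - k) (\<lambda>l. ?F (k + l)) a b = 0" by (simp add: taylor_def)
    show ?thesis
    proof (cases "b \<in> K")
      case True
      then have ge: "1 \<le> \<bar>b - a\<bar>" using a 3 far[of b] by auto
      have "\<bar>F k b\<bar> \<le> 1 * B * 1" using B(2)[OF k True] by simp
      also have "\<dots> \<le> real (Suc m) * B * \<bar>b - a\<bar> ^ (m - k)"
        using B(1) ge one_le_power[OF ge] by (intro mult_mono) auto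
      finally show ?thesis using T True by (intro far_case[OF ge]) simp
    next
      case False
      then show ?thesis using T C' by simp
    qed
  qed
qed

lemma taylor_vanishing:
  assumes "\<And>l. 1 \<le> l \<Longrightarrow> l \<le> n \<Longrightarrow> F l a = 0"
  shows "taylor n F a x = F 0 a"
proof -
  have "taylor n F a x = (\<Sum>l\<le>n. if l = 0 then F 0 a else 0)"
    unfolding taylor_def by (rule sum.cong) (use assms in \<open>auto simp: Suc_le_eq\<close>)
  then show ?thesis by simp
qed

text \<open>The target area \<open>\<tau>\<close> of a gap is the increment of \<open>H\<close> if
both endpoints belong to \<open>K\<close>. For the two outer gaps any area is admissible, and the
one with zero discrepancy is prescribed.\<close>

lemma conditions_imp_horizontal:
  assumes m: "1 \<le> m" and \<omega>: "modulus (modulus_real \<omega>)" and K: "compact K" "K \<noteq> {}"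
    and cont: "\<And>k. k \<le> m \<Longrightarrow> continuous_on K (F k)" "\<And>k. k \<le> m \<Longrightarrow> continuous_on K (G k)"
    and C: "0 \<le> C" "whitney_bound m (modulus_real \<omega>) K C F" "whitney_bound m (modulus_real \<omega>) K C G"
      "whitney_bound m (modulus_real \<omega>) K C H"
    and Hk: "\<And>k x. k < m \<Longrightarrow> x \<in> K \<Longrightarrow> H (Suc k) x = contact F G k x"
    and A: "\<And>a b. a \<in> K \<Longrightarrow> b \<in> K \<Longrightarrow> a < b \<Longrightarrow> \<bar>area_discrepancy m F G H a b\<bar> \<le> C * velocity m \<omega> F G a b"
  shows "\<exists>\<Gamma> :: real \<Rightarrow> real ^ 3. horizontal \<Gamma> \<and> curve_C_m_omega m \<omega> \<Gamma> \<and>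
     (\<forall>k\<le>m. \<forall>x\<in>K. iter_deriv k \<Gamma> x = vector [F k x, G k x, H k x])"
proof -
  interpret modulus "modulus_real \<omega>" by fact
  let ?w = "modulus_real \<omega>"
  obtain \<alpha> where al: "\<alpha> \<in> K" "\<And>x. x \<in> K \<Longrightarrow> \<alpha> \<le> x" using compact_attains_inf[OF K] by blast
  obtain \<beta> where be: "\<beta> \<in> K" "\<And>x. x \<in> K \<Longrightarrow> x \<le> \<beta>" using compact_attains_sup[OF K] by blast
  define lo where "lo = \<alpha> - 1"
  define hi where "hi = \<beta> + 1"
  define K' where "K' = insert lo (insert hi K)"
  define F' where "F' k x = (if x \<in> K then F k x else 0)" for k x
  define G' where "G' k x = (if x \<in> K then G k x else 0)" for k x
  have far: "lo + 1 \<le> x \<and> x \<le> hi - 1" if "x \<in> K" for x using al(2)[OF that] be(2)[OF that] by (simp add: lo_def hi_def)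
  have lohi: "lo \<notin> K" "hi \<notin> K" using far[of lo] far[of hi] by auto
  have "\<alpha> \<le> \<beta>" using al(2) be(1) by blast
  then have K': "compact K'" "lo \<in> K'" "hi \<in> K'" "K' \<subseteq> {lo..hi}" "lo \<le> hi"
    using K(1) far by (force simp: K'_def lo_def hi_def)+
  obtain BF where BF: "0 \<le> BF" "\<And>k x. k \<le> m \<Longrightarrow> x \<in> K \<Longrightarrow> \<bar>F k x\<bar> \<le> BF"
    using jet_bounded[of K m F, OF K(1) cont(1)] by blast
  obtain BG where BG: "0 \<le> BG" "\<And>k x. k \<le> m \<Longrightarrow> x \<in> K \<Longrightarrow> \<bar>G k x\<bar> \<le> BG"
    using jet_bounded[of K m G, OF K(1) cont(2)] by blast
  define C0 where "C0 = C + real (Suc m) * (BF + BG) / ?w 1"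
  have w1: "0 < ?w 1" by (rule pos) simp
  have C0: "0 \<le> C0" "C \<le> C0" using C(1) BF(1) BG(1) w1 by (simp_all add: C0_def)
  have "real (Suc m) * BF / ?w 1 \<le> real (Suc m) * (BF + BG) / ?w 1"
    "real (Suc m) * BG / ?w 1 \<le> real (Suc m) * (BF + BG) / ?w 1"
    using BF(1) BG(1) w1 by (auto intro!: divide_right_mono mult_left_mono)
  then have le0: "C + real (Suc m) * BF / ?w 1 \<le> C0" "C + real (Suc m) * BG / ?w 1 \<le> C0"
    by (simp_all add: C0_def)
  have WF: "whitney_bound m ?w K' C0 F'"
    using whitney_bound_mono[OF \<omega> whitney_extend[OF C(1,2) BF far] le0(1)] unfolding K'_def F'_def .
  have WG: "whitney_bound m ?w K' C0 G'"
    using whitney_bound_mono[OF \<omega> whitney_extend[OF C(1,3) BG far] le0(2)] unfolding K'_def G'_def .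
  obtain M1 where fill: "\<And>a b W F G \<tau>. a < b \<Longrightarrow> 0 < W \<Longrightarrow>
    (\<And>k. k \<le> m \<Longrightarrow> \<bar>F k b - taylor (m - k) (\<lambda>l. F (k + l)) a b\<bar> \<le> C0 * W * (b - a) ^ (m - k)) \<Longrightarrow>
    (\<And>k. k \<le> m \<Longrightarrow> \<bar>G k b - taylor (m - k) (\<lambda>l. G (k + l)) a b\<bar> \<le> C0 * W * (b - a) ^ (m - k)) \<Longrightarrow>
    \<bar>\<tau> - 2 * area a b (taylor m F a) (deriv (taylor m F a)) (taylor m G a) (deriv (taylor m G a))
       + 2 * F 0 a * (G 0 b - taylor m G a b) - 2 * G 0 a * (F 0 b - taylor m F a b)\<bar>
     \<le> C0 * (W\<^sup>2 * (b - a) ^ (2 * m) + W * (b - a) ^ m *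
          integral {a..b} (\<lambda>s. \<bar>deriv (taylor m F a) s\<bar> + \<bar>deriv (taylor m G a) s\<bar>)) \<Longrightarrow>
    (\<exists>f g. deriv_chain (Suc m) f \<and> deriv_chain (Suc m) g \<and>
       (\<forall>k\<le>m. f k a = F k a \<and> f k b = F k b \<and> g k a = G k a \<and> g k b = G k b) \<and>
       2 * area a b (f 0) (f 1) (g 0) (g 1) = \<tau> \<and>
       (\<forall>x\<in>{a..b}. \<bar>f (Suc m) x\<bar> \<le> M1 * W / (b - a) \<and> \<bar>g (Suc m) x\<bar> \<le> M1 * W / (b - a)))"
    using gap_fill[OF C0(1) m] by blast
  define R where "R c d = 2 * area c d (taylor m F' c) (deriv (taylor m F' c)) (taylor m G' c) (deriv (taylor m G' c))
       - 2 * F' 0 c * (G' 0 d - taylor m G' c d) + 2 * G' 0 c * (F' 0 d - taylor m F' c d)" for c d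
  \<comment> \<open>\<open>R c d\<close> is the increment of the vertical coordinate that makes the area discrepancy vanish.\<close>
  define \<tau> where "\<tau> c d = (if c \<in> K \<and> d \<in> K then H 0 d - H 0 c else R c d)" for c d
  define P where "P c d f g \<longleftrightarrow> deriv_chain (Suc m) f \<and> deriv_chain (Suc m) g \<and>
       (\<forall>k\<le>m. f k c = F' k c \<and> f k d = F' k d \<and> g k c = G' k c \<and> g k d = G' k d) \<and>
       2 * area c d (f 0) (f 1) (g 0) (g 1) = \<tau> c d \<and>
       (\<forall>x\<in>{c..d}. \<bar>f (Suc m) x\<bar> \<le> M1 * ?w (d - c) / (d - c) \<and> \<bar>g (Suc m) x\<bar> \<le> M1 * ?w (d - c) / (d - c))"
    for c d and f g :: "nat \<Rightarrow> real \<Rightarrow> real"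
  have \<tau>R: "\<bar>\<tau> c d - R c d\<bar> \<le> C0 * velocity m \<omega> F' G' c d" if cd: "c < d" for c d
  proof (cases "c \<in> K \<and> d \<in> K")
    case True
    then have T: "taylor m F' c = taylor m F c" "taylor m G' c = taylor m G c"
      by (auto intro!: ext taylor_cong simp: F'_def G'_def)
    then have v: "velocity m \<omega> F' G' c d = velocity m \<omega> F G c d" by (simp add: velocity_def)
    have "\<tau> c d - R c d = area_discrepancy m F G H c d"
      using True unfolding area_discrepancy_eq \<tau>_def R_def T by (simp add: F'_def G'_def)
    also have "\<bar>\<dots>\<bar> \<le> C * velocity m \<omega> F G c d" using A True cd by blast
    also have "\<dots> \<le> C0 * velocity m \<omega> F G c d"
      using C0(2) velocity_pos[OF \<omega> cd, of m F G] by (intro mult_right_mono) auto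
    finally show ?thesis by (simp add: v)
  next
    case False
    then have "\<tau> c d = R c d" by (auto simp: \<tau>_def)
    then show ?thesis using C0(1) velocity_pos[OF \<omega> cd, of m F' G'] by simp
  qed
  have "\<exists>f g. P c d f g" if "gap K' c d" for c d
  proof -
    have cd: "c < d" "c \<in> K'" "d \<in> K'" using that by (auto simp: gap_def)
    have "0 < ?w (d - c)" using cd by (intro pos) simp
    moreover have "\<bar>F' k d - taylor (m - k) (\<lambda>l. F' (k + l)) c d\<bar> \<le> C0 * ?w (d - c) * (d - c) ^ (m - k)"
      "\<bar>G' k d - taylor (m - k) (\<lambda>l. G' (k + l)) c d\<bar> \<le> C0 * ?w (d - c) * (d - c) ^ (m - k)" if "k \<le> m" for k
      using WF WG that cd unfolding whitney_bound_def by force+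
    moreover have "\<bar>\<tau> c d - 2 * area c d (taylor m F' c) (deriv (taylor m F' c)) (taylor m G' c) (deriv (taylor m G' c))
       + 2 * F' 0 c * (G' 0 d - taylor m G' c d) - 2 * G' 0 c * (F' 0 d - taylor m F' c d)\<bar>
     \<le> C0 * ((?w (d - c))\<^sup>2 * (d - c) ^ (2 * m) + ?w (d - c) * (d - c) ^ m *
          integral {c..d} (\<lambda>s. \<bar>deriv (taylor m F' c) s\<bar> + \<bar>deriv (taylor m G' c) s\<bar>))"
      using \<tau>R[OF cd(1)] unfolding R_def velocity_def by (simp add: algebra_simps)
    ultimately show ?thesis unfolding P_def by (intro fill[OF cd(1)])
  qed
  then obtain p q where pq: "\<And>c d. gap K' c d \<Longrightarrow> P c d (p c d) (q c d)" by metis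
  have top: "y \<le> \<bar>M1\<bar> * ?w (d - c) / (d - c)" if "y \<le> M1 * ?w (d - c) / (d - c)" "c < d" for y c d
  proof -
    have "M1 * ?w (d - c) / (d - c) \<le> \<bar>M1\<bar> * ?w (d - c) / (d - c)"
      using that(2) by (intro divide_right_mono mult_right_mono) (auto intro: nonneg)
    then show ?thesis using that(1) by linarith
  qed
  interpret f: whitney_gluing ?w m K' F' p C0 "\<bar>M1\<bar>" lo hi
  proof (intro whitney_gluing.intro whitney_gluing_axioms.intro)
    show "modulus ?w" by fact
    show "\<bar>p c d (Suc m) x\<bar> \<le> \<bar>M1\<bar> * ?w (d - c) / (d - c)" if "gap K' c d" "x \<in> {c..d}" for c d x
      using pq[OF that(1)] that by (intro top) (auto simp: P_def gap_def)
  qed (use K' C0 WF lohi pq in \<open>auto simp: F'_def P_def\<close>)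
  interpret g: whitney_gluing ?w m K' G' q C0 "\<bar>M1\<bar>" lo hi
  proof (intro whitney_gluing.intro whitney_gluing_axioms.intro)
    show "modulus ?w" by fact
    show "\<bar>q c d (Suc m) x\<bar> \<le> \<bar>M1\<bar> * ?w (d - c) / (d - c)" if "gap K' c d" "x \<in> {c..d}" for c d x
      using pq[OF that(1)] that by (intro top) (auto simp: P_def gap_def)
  qed (use K' C0 WG lohi pq in \<open>auto simp: G'_def P_def\<close>)
  have out: "f.D k x = 0" "g.D k x = 0" if "x \<notin> {lo..hi}" for k x
    using f.D_outside[of x k] g.D_outside[of x k] that by auto
  obtain \<Gamma> h where \<Gamma>: "horizontal \<Gamma>" "curve_C_m_omega m \<omega> \<Gamma>" and h: "deriv_chain m h" "h 0 \<alpha> = H 0 \<alpha>"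
    "\<And>k. h (Suc k) = contact f.D g.D k" "continuous_on UNIV (h 1)"
    and hm: "\<exists>C\<ge>0. \<forall>x y. \<bar>h m x - h m y\<bar> \<le> C * ?w \<bar>x - y\<bar>"
    and jets: "\<And>k x. k \<le> m \<Longrightarrow> iter_deriv k \<Gamma> x = vector [f.D k x, g.D k x, h k x]"
    by (rule horizontal_lift[where lo = lo and hi = hi and p = \<alpha> and c = "H 0 \<alpha>",
          OF m \<omega> f.D_chain f.D_modulus out(1) g.D_chain g.D_modulus out(2)]) blast+
  have fK: "f.D k x = F k x" "g.D k x = G k x" if "x \<in> K" for k x
    using f.D_K[of x k] g.D_K[of x k] that by (simp_all add: K'_def F'_def G'_def)
  have hS: "h (Suc k) x = H (Suc k) x" if "k < m" "x \<in> K" for k x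
    using Hk[OF that] contact_cong[of k f.D x F g.D G] fK[OF that(2)] by (simp add: h(3))
  define u where "u x = H 0 x - h 0 x" for x
  obtain Ch where Ch: "0 \<le> Ch" "\<And>x y. \<bar>h m x - h m y\<bar> \<le> Ch * ?w \<bar>x - y\<bar>" using hm by blast
  have "u x = u \<alpha>" if "x \<in> K" for x
  proof (rule constant_on_compact[OF K(1) al _ _ that])
    fix c d assume cd: "gap K c d"
    then have cdK: "c \<in> K" "d \<in> K" "c < d" by (auto simp: gap_def)
    have gap': "gap K' c d" using cd far[OF cdK(1)] far[OF cdK(2)] by (auto simp: gap_def K'_def disjoint_iff)
    have "cont_deriv (h 0) (h 1)" unfolding cont_deriv_def using deriv_chainD[OF h(1), of 0] m h(4) by simp
    then have "h 0 d - h 0 c = integral {c..d} (h 1)" using cont_deriv_integral cdK(3) by simp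
    also have "h 1 = contact f.D g.D 0" using h(3)[of 0] by simp
    also have "integral {c..d} \<dots> = 2 * area c d (f.D 0) (f.D 1) (g.D 0) (g.D 1)" by (rule integral_contact)
    also have "\<dots> = 2 * area c d (p c d 0) (p c d 1) (q c d 0) (q c d 1)"
      unfolding area_def using f.D_gap[OF gap'] g.D_gap[OF gap'] m
      by (intro arg_cong[of _ _ "(*) 2"] integral_cong) simp
    also have "\<dots> = H 0 d - H 0 c" using pq[OF gap'] cdK by (simp add: P_def \<tau>_def)
    finally show "u c = u d" by (simp add: u_def)
  next
    fix a b assume a: "a \<in> K" and b: "b \<in> K" and ab: "\<bar>b - a\<bar> \<le> 1"
    have "taylor m H a b - taylor m h a b = taylor m (\<lambda>l y. H l y - h l y) a b" by (rule taylor_diff)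
    also have "\<dots> = u a" unfolding u_def
    proof (rule taylor_vanishing)
      fix l assume "1 \<le> l" "l \<le> m"
      then show "H l a - h l a = 0" using hS[of "l - 1" a] a by simp
    qed
    finally have "u b - u a = (H 0 b - taylor m H a b) - (h 0 b - taylor m h a b)" by (simp add: u_def)
    moreover have "\<bar>H 0 b - taylor m H a b\<bar> \<le> C * ?w \<bar>b - a\<bar> * \<bar>b - a\<bar> ^ m"
      using C(4) a b unfolding whitney_bound_def by force
    moreover have "\<bar>h 0 b - taylor m h a b\<bar> \<le> Ch * ?w \<bar>b - a\<bar> * \<bar>b - a\<bar> ^ m"
      using chain_remainder[OF h(1) Ch, of 0 b a] by simp
    ultimately have "\<bar>u b - u a\<bar> \<le> (C + Ch) * ?w \<bar>b - a\<bar> * \<bar>b - a\<bar> ^ m"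
      by (simp add: distrib_right abs_le_iff)
    also have "\<dots> \<le> (C + Ch) * ?w \<bar>b - a\<bar> * \<bar>b - a\<bar> ^ 1"
      using C(1) Ch(1) ab m by (intro mult_left_mono power_decreasing) auto
    finally show "\<bar>u b - u a\<bar> \<le> (C + Ch) * ?w \<bar>b - a\<bar> * \<bar>b - a\<bar>" by simp
  qed
  then have h0K: "h 0 x = H 0 x" if "x \<in> K" for x using that h(2) by (simp add: u_def)
  have "h k x = H k x" if "k \<le> m" "x \<in> K" for k x
    using that h0K hS by (cases k) auto
  then show ?thesis using \<Gamma> jets fK by (intro exI[of _ \<Gamma>]) simp
qed

theorem theorem1p1:
  fixes m :: nat and \<omega> :: "ennreal \<Rightarrow> ennreal" and K :: "real set"
    and F G H :: "nat \<Rightarrow> real \<Rightarrow> real"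
  assumes "1 \<le> m"
    and "modulus_of_continuity \<omega>"
    and "compact K"
    and "\<And>k. k \<le> m \<Longrightarrow> continuous_on K (F k)"
    and "\<And>k. k \<le> m \<Longrightarrow> continuous_on K (G k)"
    and "\<And>k. k \<le> m \<Longrightarrow> continuous_on K (H k)"
  shows "(\<exists>\<Gamma> :: real \<Rightarrow> real ^ 3.
            horizontal \<Gamma> \<and> curve_C_m_omega m \<omega> \<Gamma> \<and>
            (\<forall>k\<le>m. \<forall>x\<in>K. iter_deriv k \<Gamma> x = vector [F k x, G k x, H k x]))
     \<longleftrightarrow>
         (whitney_field m \<omega> K F \<and> whitney_field m \<omega> K G \<and> whitney_field m \<omega> K H) \<and>
         (\<forall>k\<in>{1..m}. \<forall>x\<in>K.
            H k x = 2 * (\<Sum>i = 0..k - 1. real ((k - 1) choose i) *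
                          (F (k - i) x * G i x - G (k - i) x * F i x))) \<and>
         (\<exists>C\<ge>1. \<forall>a\<in>K. \<forall>b\<in>K. a < b \<longrightarrow>
            \<bar>area_discrepancy m F G H a b / velocity m \<omega> F G a b\<bar> \<le> C)"
    (is "?curve \<longleftrightarrow> ?whitney \<and> ?leibniz \<and> ?area")
proof -
  note \<omega> = modulus_modulus_real[OF assms(2)]
  have leib: "?leibniz \<longleftrightarrow> (\<forall>k\<in>{1..m}. \<forall>x\<in>K. H k x = contact F G (k - 1) x)"
    by (intro ball_cong refl) (simp only: contact_eq_sum atLeastAtMost_iff)
  have bwd: ?curve if whit: ?whitney and "?leibniz" and area: ?area
  proof (cases "K = {}")
    case True
    \<comment> \<open>For empty \<open>K\<close> the lift of the zero curve serves.\<close>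
    have z: "deriv_chain m (\<lambda>_ _. 0)" by (simp add: deriv_chain_def)
    obtain \<Gamma> :: "real \<Rightarrow> real ^ 3" where "horizontal \<Gamma>" "curve_C_m_omega m \<omega> \<Gamma>"
      by (rule horizontal_lift[where lo = 0 and hi = 0 and p = 0 and c = 0 and Cf = 0 and Cg = 0,
            OF assms(1) \<omega> z _ _ z]) auto
    then show ?thesis using True by blast
  next
    case False
    obtain c1 c2 c3 where c: "c1 > 0" "c2 > 0" "c3 > 0" and
      W: "whitney_bound m (modulus_real \<omega>) K c1 F" "whitney_bound m (modulus_real \<omega>) K c2 G"
        "whitney_bound m (modulus_real \<omega>) K c3 H"
      using whit unfolding whitney_field_iff by blast
    obtain c4 where c4: "c4 \<ge> 1" "\<And>a b. a \<in> K \<Longrightarrow> b \<in> K \<Longrightarrow> a < b \<Longrightarrow>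
        \<bar>area_discrepancy m F G H a b / velocity m \<omega> F G a b\<bar> \<le> c4"
      using area by blast
    define C where "C = c1 + c2 + c3 + c4"
    have C: "0 \<le> C" "c1 \<le> C" "c2 \<le> C" "c3 \<le> C" "c4 \<le> C" using c c4(1) by (simp_all add: C_def)
    show ?thesis
    proof (rule conditions_imp_horizontal[OF assms(1) \<omega> assms(3) False assms(4,5) C(1)
          whitney_bound_mono[OF \<omega> W(1) C(2)] whitney_bound_mono[OF \<omega> W(2) C(3)] whitney_bound_mono[OF \<omega> W(3) C(4)]])
      show "H (Suc k) x = contact F G k x" if "k < m" "x \<in> K" for k x
        using \<open>?leibniz\<close> that unfolding leib by force
    next
      fix a b assume ab: "a \<in> K" "b \<in> K" "a < b"
      have "\<bar>area_discrepancy m F G H a b\<bar> \<le> c4 * velocity m \<omega> F G a b"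
        using c4(2)[OF ab] velocity_pos[OF \<omega> ab(3), of m F G] by (simp add: abs_divide divide_le_eq)
      also have "\<dots> \<le> C * velocity m \<omega> F G a b"
        using C(5) velocity_pos[OF \<omega> ab(3), of m F G] by (intro mult_right_mono) auto
      finally show "\<bar>area_discrepancy m F G H a b\<bar> \<le> C * velocity m \<omega> F G a b" .
    qed
  qed
  show ?thesis
  proof
    assume ?curve
    then obtain \<Gamma> :: "real \<Rightarrow> real ^ 3" where "horizontal \<Gamma>" "curve_C_m_omega m \<omega> \<Gamma>"
      "\<forall>k\<le>m. \<forall>x\<in>K. iter_deriv k \<Gamma> x = vector [F k x, G k x, H k x]"
      by blast
    note c = horizontal_imp_conditions[OF assms(1) \<omega> this]
    show "?whitney \<and> ?leibniz \<and> ?area"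
      unfolding leib by (rule conjI[OF c(1) conjI[OF c(2,3)]])
  next
    assume h: "?whitney \<and> ?leibniz \<and> ?area"
    show ?curve
      by (rule bwd[OF conjunct1[OF h] conjunct1[OF conjunct2[OF h]] conjunct2[OF conjunct2[OF h]]])
  qed
qed

end
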